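(* Let $(X,d,m)$ be a countably infinite homogeneous ultrametric measure space, $L$ a homogeneous hierarchical Laplacian on it, $I=\{a_i\}_{i\ge1}$ a sequence of distinct points of $X$, and $\sigma_i(\omega)$, $i\ge1$, $\omega\in(\Omega,\mathcal{F},P)$, i.i.d. random variables whose common distribution is absolutely continuous with respect to the Lebesgue measure with a bounded density supported by a finite interval $[\alpha,\beta]$, $0<\alpha<\beta$. Let $V=-\sum_i\sigma_i(\omega)\delta_{a_i}$ and $H=L+V$. Assume that for some (whence for all) $y\in X$ the sequence $d(a_i,y)$ eventually increases, and that for some $r$ with $0<r<1/3$ $$\lim_{M\to\infty}\ \sup_{i\ge M}\ \sum_{j\ge M,\ j\ne i}\frac1{d(a_i,a_j)^r}=0.$$ Then the operator $H$ has a pure point spectrum for $P$-a.s. $\omega$.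
   Context: Countably infinite homogeneous ultrametric measure space: $X$ is a countably infinite set with an ultrametric $d$ ($d(x,y)\le\max\{d(x,z),d(z,y)\}$) whose balls $B_r(x)=\{y:d(x,y)\le r\}$ are all finite and whose isometry group acts transitively; $m$ is the counting measure, and $d$ is normalized so that $m(B)=\mathrm{diam}(B)$ for every non-singleton ball (so $d(x,y)$, $x\ne y$, is the measure of the minimal ball containing $x$ and $y$). $\mathcal{B}$ is the family of all balls of positive radius (singletons included), $\mathcal{B}(x)$ the family of those containing $x$. Homogeneous hierarchical Laplacian: let $C:\mathcal{B}\to(0,\infty)$ satisfy $C(A)=C(B)$ whenever $A,B$ have the same diameter, and $\sum_{T\in\mathcal{B},\,B\subseteq T}C(T)<\infty$ for all $B$. Then $$Lf(x)=\sum_{B\in\mathcal{B}(x)}C(B)\Big(f(x)-\frac1{m(B)}\int_B f\,dm\Big),$$ a bounded self-adjoint operator on $L^2(X,m)$. $\delta_a$ is the function equal to $1$ at $a$ and $0$ elsewhere. $H$ has pure point spectrum if $L^2(X,m)$ has an orthonormal basis of eigenfunctions of $H$ (equivalently, all spectral measures of $H$ are pure point). *)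

theory Defs
  imports "HOL-Probability.Probability"
begin

text \<open>The space \<open>X\<close> is the whole of a type of class \<^class>\<open>metric_space\<close>, with \<open>d\<close> = \<^const>\<open>dist\<close>.
  The measure \<open>m\<close> is the counting measure, so \<open>m(B)\<close> is \<^const>\<open>card\<close> (balls are finite), integrals
  over balls are finite sums, and integrals over \<open>X\<close> are unordered sums.\<close>

definition balls :: "'a::metric_space set set" where
  "balls = {cball x r | x r. r > 0}"

definition isometry_group :: "('a::metric_space \<Rightarrow> 'a) set" where
  "isometry_group = {\<phi>. bij \<phi> \<and> (\<forall>x y. dist (\<phi> x) (\<phi> y) = dist x y)}"

definition homogeneous_ultrametric_measure_space :: "'a::metric_space itself \<Rightarrow> bool" where
  "homogeneous_ultrametric_measure_space (_ :: 'a itself) \<longleftrightarrow>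
     countable (UNIV :: 'a set) \<and> infinite (UNIV :: 'a set) \<and>
     (\<forall>x y z :: 'a. dist x y \<le> max (dist x z) (dist z y)) \<and>
     (\<forall>(x :: 'a) r. finite (cball x r)) \<and>
     (\<forall>x y :: 'a. \<exists>\<phi>\<in>isometry_group. \<phi> x = y) \<and>
     (\<forall>B\<in>(balls :: 'a set set). \<not> is_singleton B \<longrightarrow> real (card B) = diameter B)"

definition homogeneous_choice_function :: "('a::metric_space set \<Rightarrow> real) \<Rightarrow> bool" where
  "homogeneous_choice_function C \<longleftrightarrow>
     (\<forall>B\<in>balls. C B > 0) \<and>
     (\<forall>A\<in>balls. \<forall>B\<in>balls. diameter A = diameter B \<longrightarrow> C A = C B) \<and>
     (\<forall>B\<in>balls. C summable_on {T \<in> balls. B \<subseteq> T})"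

definition hierarchical_laplacian ::
    "('a::metric_space set \<Rightarrow> real) \<Rightarrow> ('a \<Rightarrow> complex) \<Rightarrow> 'a \<Rightarrow> complex" where
  "hierarchical_laplacian C f x =
     (\<Sum>\<^sub>\<infinity>B\<in>{B \<in> balls. x \<in> B}.
        of_real (C B) * (f x - 1 / of_nat (card B) * (\<Sum>y\<in>B. f y)))"

definition delta :: "'a \<Rightarrow> 'a \<Rightarrow> real" where
  "delta a x = (if x = a then 1 else 0)"

text \<open>For injective \<open>a\<close>, at most one summand is nonzero at each point.\<close>

definition potential :: "(nat \<Rightarrow> real) \<Rightarrow> (nat \<Rightarrow> 'a) \<Rightarrow> 'a \<Rightarrow> real" where
  "potential s a x = - (\<Sum>\<^sub>\<infinity>i. s i * delta (a i) x)"

definition schroedinger ::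
    "('a::metric_space set \<Rightarrow> real) \<Rightarrow> ('a \<Rightarrow> real) \<Rightarrow> ('a \<Rightarrow> complex) \<Rightarrow> 'a \<Rightarrow> complex" where
  "schroedinger C V f x = hierarchical_laplacian C f x + of_real (V x) * f x"

definition L2 :: "('a \<Rightarrow> complex) set" where
  "L2 = {f. (\<lambda>x. (cmod (f x))\<^sup>2) summable_on UNIV}"

definition L2_inner :: "('a \<Rightarrow> complex) \<Rightarrow> ('a \<Rightarrow> complex) \<Rightarrow> complex" where
  "L2_inner f g = (\<Sum>\<^sub>\<infinity>x. f x * cnj (g x))"

definition L2_norm :: "('a \<Rightarrow> complex) \<Rightarrow> real" where
  "L2_norm f = sqrt (\<Sum>\<^sub>\<infinity>x. (cmod (f x))\<^sup>2)"

definition orthonormal_basis :: "('a \<Rightarrow> complex) set \<Rightarrow> bool" where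
  "orthonormal_basis E \<longleftrightarrow>
     E \<subseteq> L2 \<and>
     (\<forall>e\<in>E. \<forall>e'\<in>E. L2_inner e e' = (if e = e' then 1 else 0)) \<and>
     (\<forall>f\<in>L2. \<forall>\<epsilon>>0. \<exists>F c. finite F \<and> F \<subseteq> E \<and>
        L2_norm (\<lambda>x. f x - (\<Sum>e\<in>F. c e * e x)) < \<epsilon>)"

definition eigenfunction :: "(('a \<Rightarrow> complex) \<Rightarrow> 'a \<Rightarrow> complex) \<Rightarrow> ('a \<Rightarrow> complex) \<Rightarrow> bool" where
  "eigenfunction H e \<longleftrightarrow> e \<in> L2 \<and> e \<noteq> (\<lambda>x. 0) \<and> (\<exists>\<mu>. \<forall>x. H e x = \<mu> * e x)"

definition pure_point_spectrum :: "(('a \<Rightarrow> complex) \<Rightarrow> 'a \<Rightarrow> complex) \<Rightarrow> bool" where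
  "pure_point_spectrum H \<longleftrightarrow> (\<exists>E. orthonormal_basis E \<and> (\<forall>e\<in>E. eigenfunction H e))"

end

theory Submission
  imports Defs "HOL-Real_Asymp.Real_Asymp"
begin

text \<open>Write \<open>H\<close> for the operator \<open>L - \<Sum>\<^sub>i \<tau>\<^sub>i \<delta>\<^sub>a\<^sub>i\<close> with i.i.d. couplings \<open>\<tau>\<^sub>i\<close>, and \<open>H\<^sub>n\<close> for the operator in which only
  the wells with \<open>i \<ge> n\<close> are kept.  The proof follows the Simon-Wolff scheme: at almost every energy the point mass of a
  site lies in the range of \<open>H - l\<close> unless \<open>l\<close> is an eigenvalue, and averaging over the coupling of that site
  replaces Lebesgue measure by the spectral measure of the site.

  \<^emph>\<open>Spectral measures.\<close> The weights \<open>\<langle>f, (M + H)\<^sup>k (M - H)\<^sup>n\<^sup>-\<^sup>k f\<rangle>\<close> are nonnegative, so the moments \<open>\<langle>f, H\<^sup>m f\<rangle>\<close> belong to a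
  probability measure \<open>\<mu>\<close> (\<open>Hausdorff_moment_measure\<close>, \<open>spectral_measure_exists\<close>), and \<open>p \<mapsto> p(H) f\<close> extends from
  polynomials to dominated limits of polynomials (\<open>functional_calculus\<close>).  Four consequences are used.  If \<open>(H - l) u = f\<close>
  is solved weakly by a bounded sequence, then \<open>\<integral> (x - l)\<^sup>-\<^sup>2 d\<mu>\<close> is finite (\<open>weak_range_moment_bound\<close>).  If this integral is
  finite, there is an exact solution (\<open>range_if_moment_finite\<close>).  The energies with an exact solution have \<open>\<mu>\<close>-measure zero
  (\<open>AE_not_in_range\<close>).  A vector whose spectral measure is carried by a countable set lies in the closed span of the
  eigenvectors (\<open>pure_point_vector_in_closure\<close>).

  \<^emph>\<open>Fractional moments.\<close> Off the countable spectrum of \<open>L\<close> the resolvent \<open>R = (L - l)\<^sup>-\<^sup>1\<close> is an absolutely convergent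
  series of ball averages, and its kernel is \<open>O(1 / d(x,y))\<close> (\<open>free_resolvent_kernel_decay\<close>).  With
  \<open>u = R (\<delta>\<^sub>b + \<Sum>\<^sub>k v\<^sub>k \<delta>\<^sub>a\<^sub>k)\<close> and \<open>v\<^sub>k = \<tau>\<^sub>k u(a\<^sub>k)\<close> the equation \<open>(H\<^sub>n - l) u = \<delta>\<^sub>b\<close> becomes a symmetric linear system with
  diagonal \<open>1/\<tau>\<^sub>k - R\<^sub>k\<^sub>k\<close> and off-diagonal entries \<open>- R\<^sub>i\<^sub>k\<close>.  The bounded density of \<open>\<tau>\<^sub>k\<close> bounds \<open>E \<bar>1/\<tau>\<^sub>k - e\<bar>\<^sup>-\<^sup>r\<close>
  uniformly in \<open>e\<close> (\<open>law_negative_moment\<close>), so eliminating the site \<open>k\<close> last gives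
  \<open>E \<bar>v\<^sub>k\<bar>\<^sup>r \<le> c (\<bar>h\<^sub>k\<bar>\<^sup>r + \<Sum>\<^sub>l \<bar>R\<^sub>k\<^sub>l\<bar>\<^sup>r E \<bar>v\<^sub>l\<bar>\<^sup>r)\<close> (\<open>elim_solution_moment\<close>).  For large \<open>n\<close> sparseness of the sites makes
  \<open>c \<Sum>\<^sub>k \<bar>R\<^sub>k\<^sub>l\<bar>\<^sup>r \<le> 1/2\<close>; hence the solutions of the truncated systems stay bounded along a subsequence
  (\<open>AE_bounded_solutions\<close>) and, almost surely, \<open>\<delta>\<^sub>b\<close> lies in the range of \<open>H\<^sub>n - l\<close> (\<open>AE_moment_finite\<close>).

  \<^emph>\<open>Finite rank.\<close> The operators \<open>H\<^sub>n\<close> and \<open>H\<close> differ by the finitely many wells at sites \<open>b < n\<close>, whose point masses are all in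
  the range of \<open>H\<^sub>n - l\<close>.  Counting dimensions, either \<open>l\<close> is an eigenvalue of \<open>H\<close> or these point masses are in the range of
  \<open>H - l\<close> (\<open>finite_rank_dichotomy\<close>, \<open>range_or_eigenvalue\<close>).  For a site \<open>j < n\<close> the Lebesgue null set of energies to which
  this does not apply is independent of \<open>\<tau>\<^sub>j\<close>, while the spectral measure of \<open>\<delta>\<^sub>a\<^sub>j\<close>, averaged over \<open>\<tau>\<^sub>j\<close>, is absolutely
  continuous (\<open>rank_one_Poisson\<close>, \<open>averaged_site_measure_null\<close>).  So almost surely that spectral measure is carried by
  the countable set of eigenvalues, and \<open>\<delta>\<^sub>a\<^sub>j\<close> lies in the closed span of the eigenvectors (\<open>AE_site_in_point_space\<close>).

  \<^emph>\<open>Completeness.\<close> A vector orthogonal to all eigenvectors vanishes at every site, so \<open>H\<close> acts on it as \<open>L\<close>, which has no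
  spectral measure outside a countable set; therefore the eigenvectors are complete
  (\<open>orthonormal_eigenvectors_complete\<close>, \<open>pure_point_if_sites_in_point_space\<close>).  All operators have real kernels, so the
  argument takes place in the real space \<open>'a ell2\<close>, and an orthonormal basis of real eigenvectors is also one of the
  complex space (\<open>orthonormal_basis_embed_complex\<close>).\<close>

section \<open>Polynomials of a bounded selfadjoint operator and its spectral measures\<close>

text \<open>The vector \<open>p(H) f\<close>, evaluated by Horner's scheme.\<close>

definition opoly :: "('h::real_vector \<Rightarrow> 'h) \<Rightarrow> real poly \<Rightarrow> 'h \<Rightarrow> 'h" where
  "opoly H p f = fold_coeffs (\<lambda>a v. a *\<^sub>R f + H v) p 0"

locale bounded_selfadjoint =
  fixes H :: "'h::{real_inner,banach} \<Rightarrow> 'h" and M :: real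
  assumes linear_H: "linear H"
    and sym: "inner (H x) y = inner x (H y)"
    and norm_H: "norm (H x) \<le> M * norm x"
    and M_pos: "M > 0"
begin

lemma bounded_linear_H: "bounded_linear H"
  by (rule bounded_linear_intro[where K=M]) (auto simp: linear_H linear_add linear_cmul norm_H mult.commute)

lemma H_0 [simp]: "H 0 = 0"
  by (simp add: linear_0 linear_H)

lemma opoly_0 [simp]: "opoly H 0 f = 0"
  by (simp add: opoly_def)

lemma opoly_pCons [simp]: "opoly H (pCons a p) f = a *\<^sub>R f + H (opoly H p f)"
  by (cases "p = 0 \<and> a = 0") (auto simp: opoly_def fold_coeffs_pCons_not_0_0_eq)

lemma opoly_1 [simp]: "opoly H 1 f = f"
  by (simp add: one_pCons)

lemma opoly_add: "opoly H (p + q) f = opoly H p f + opoly H q f"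
  by (induction p q rule: poly_induct2) (auto simp: linear_H linear_add algebra_simps)

lemma opoly_smult: "opoly H (Polynomial.smult c p) f = c *\<^sub>R opoly H p f"
  by (induction p) (auto simp: linear_H linear_cmul linear_add algebra_simps)

lemma opoly_minus: "opoly H (- p) f = - opoly H p f"
  using opoly_smult[of "-1" p f] by simp

lemma opoly_diff: "opoly H (p - q) f = opoly H p f - opoly H q f"
  using opoly_add[of p "-q" f] by (simp add: opoly_minus)

lemma opoly_sum: "opoly H (\<Sum>i\<in>A. p i) f = (\<Sum>i\<in>A. opoly H (p i) f)"
  by (induction A rule: infinite_finite_induct) (auto simp: opoly_add)

lemma opoly_comm_H: "opoly H p (H f) = H (opoly H p f)"
  by (induction p) (auto simp: linear_add[OF linear_H] linear_cmul[OF linear_H])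

lemma opoly_mult: "opoly H (p * q) f = opoly H p (opoly H q f)"
  by (induction p) (auto simp: opoly_add opoly_smult)

lemma opoly_sym: "inner (opoly H p f) g = inner f (opoly H p g)"
proof (induction p arbitrary: f g)
  case (pCons a p)
  have "inner (H (opoly H p f)) g = inner (opoly H p f) (H g)" by (rule sym)
  also have "\<dots> = inner f (opoly H p (H g))"
    using pCons(2)[of f "H g"] by (simp add: sym opoly_comm_H pCons)
  finally show ?case by (simp add: inner_add_left inner_add_right opoly_comm_H)
qed simp

lemma bounded_linear_opoly: "bounded_linear (opoly H p)"
proof (induction p)
  case 0 then show ?case by simp
next
  case (pCons a p)
  have "bounded_linear (\<lambda>x. a *\<^sub>R x + H (opoly H p x))"
    by (intro bounded_linear_add bounded_linear_scaleR_right bounded_linear_compose[OF bounded_linear_H pCons(2)])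
  then show ?case by simp
qed

lemma tendsto_opoly: "(g \<longlongrightarrow> u) F \<Longrightarrow> ((\<lambda>k. opoly H p (g k)) \<longlongrightarrow> opoly H p u) F"
  by (rule bounded_linear.tendsto[OF bounded_linear_opoly])

lemma opoly_mult_inner: "inner (opoly H p f) (opoly H q f) = inner f (opoly H (p * q) f)"
  by (simp add: opoly_mult opoly_sym)

lemma inner_H_bound: "\<bar>inner g (H g)\<bar> \<le> M * inner g g"
proof -
  have "\<bar>inner g (H g)\<bar> \<le> norm g * norm (H g)" by (rule Cauchy_Schwarz_ineq2)
  also have "\<dots> \<le> norm g * (M * norm g)" by (intro mult_left_mono norm_H) auto
  finally show ?thesis by (simp add: dot_square_norm power2_eq_square mult_ac)
qed

text \<open>Even powers move to both sides of the inner product by symmetry; what is left is one of the four operators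
  \<open>1\<close>, \<open>(M + H)/2M\<close>, \<open>(M - H)/2M\<close> and the product of the last two, which is \<open>(M\<^sup>2 - H\<^sup>2)/4M\<^sup>2\<close>.\<close>

lemma Bernstein_weight_nonneg:
  "0 \<le> inner f (opoly H ([:1/2, 1/(2*M):] ^ k * [:1/2, -1/(2*M):] ^ j) f)"
proof -
  define a b where "a = [:1/2, 1/(2*M):]" and "b = [:1/2, -1/(2*M):]"
  have base: "0 \<le> inner g (opoly H (a ^ r * b ^ s) g)" if "r \<in> {0,1}" "s \<in> {0,1}" for r s :: nat and g
  proof -
    have Hg: "opoly H a g = (1/2) *\<^sub>R g + (1/(2*M)) *\<^sub>R H g" "opoly H b g = (1/2) *\<^sub>R g - (1/(2*M)) *\<^sub>R H g" for g
      using M_pos by (simp_all add: a_def b_def linear_cmul[OF linear_H] linear_neg[OF linear_H])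
    have 1: "0 \<le> inner g (opoly H a g)"
      using inner_H_bound[of g] M_pos by (simp add: Hg inner_add_right field_simps)
    have 2: "0 \<le> inner g (opoly H b g)"
      using inner_H_bound[of g] M_pos by (simp add: Hg inner_diff_right field_simps)
    have "inner g (opoly H (a * b) g) = inner (opoly H a g) (opoly H b g)"
      by (simp add: opoly_mult opoly_sym)
    also have "\<dots> = (M\<^sup>2 * inner g g - inner (H g) (H g)) / (4 * M\<^sup>2)"
      using M_pos by (simp add: Hg inner_add_left inner_add_right inner_diff_left inner_diff_right inner_commute[of "H g" g] field_simps power2_eq_square)
    also have "\<dots> \<ge> 0"
    proof -
      have "(norm (H g))\<^sup>2 \<le> (M * norm g)\<^sup>2" by (intro power_mono norm_H) auto
      then show ?thesis by (simp add: dot_square_norm power_mult_distrib)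
    qed
    finally have 3: "0 \<le> inner g (opoly H (a * b) g)" .
    show ?thesis using that 1 2 3 by auto
  qed
  define c where "c = a ^ (k div 2) * b ^ (j div 2)"
  have "a ^ k * b ^ j = c * ((a ^ (k mod 2) * b ^ (j mod 2)) * c)"
  proof -
    have "x ^ n = x ^ (n div 2) * x ^ (n div 2) * x ^ (n mod 2)" for x :: "real poly" and n
      by (metis power_add mult_2 mult_div_mod_eq)
    from this[of a k] this[of b j] show ?thesis unfolding c_def by (simp add: mult_ac)
  qed
  then have "inner f (opoly H (a ^ k * b ^ j) f)
      = inner (opoly H c f) (opoly H (a ^ (k mod 2) * b ^ (j mod 2)) (opoly H c f))"
    by (simp only: opoly_mult opoly_sym)
  also have "\<dots> \<ge> 0" by (rule base) auto
  finally show ?thesis by (simp add: a_def b_def)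
qed

definition spectral_measure :: "'h \<Rightarrow> real measure \<Rightarrow> bool" where
  "spectral_measure f \<mu> \<longleftrightarrow> prob_space \<mu> \<and> sets \<mu> = sets borel \<and> (AE x in \<mu>. \<bar>x\<bar> \<le> M) \<and>
     (\<forall>p. (\<integral>x. poly p x \<partial>\<mu>) = inner f (opoly H p f))"

end

text \<open>For \<open>a + b = 1\<close> these are the factorial moments of the binomial weights.  The ring is arbitrary because \<open>a\<close> and
  \<open>b\<close> will be polynomials in an operator.\<close>

lemma sum_binomial_factorial_moment:
  fixes a b :: "'a::comm_ring_1"
  assumes "m \<le> n"
  shows "(\<Sum>k\<le>n. of_nat (n choose k) * of_nat (k choose m) * a ^ k * b ^ (n - k))
    = of_nat (n choose m) * a ^ m * (a + b) ^ (n - m)"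
proof -
  have "(\<Sum>k\<le>n. of_nat (n choose k) * of_nat (k choose m) * a ^ k * b ^ (n - k))
      = (\<Sum>k=m..n. of_nat (n choose k) * of_nat (k choose m) * a ^ k * b ^ (n - k))"
    by (rule sum.mono_neutral_right) (auto simp: not_le binomial_eq_0)
  also have "\<dots> = (\<Sum>k=0..n-m. of_nat (n choose (k + m)) * of_nat ((k + m) choose m) * a ^ (k + m) * b ^ (n - (k + m)))"
    using assms sum.shift_bounds_cl_nat_ivl[of "\<lambda>k. of_nat (n choose k) * of_nat (k choose m) * a ^ k * b ^ (n - k)" 0 m "n - m"]
    by simp
  also have "\<dots> = (\<Sum>k\<le>n-m. of_nat (n choose m) * a ^ m * (of_nat ((n - m) choose k) * a ^ k * b ^ (n - m - k)))"
  proof (rule sum.cong)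
    fix k assume "k \<in> {..n-m}"
    then have "(n choose (k + m)) * ((k + m) choose m) = (n choose m) * ((n - m) choose k)"
      using choose_mult[of m "k+m" n] assms by simp
    then have "of_nat (n choose (k + m)) * of_nat ((k + m) choose m) = (of_nat (n choose m) * of_nat ((n - m) choose k) :: 'a)"
      by (metis of_nat_mult)
    moreover have "n - (k + m) = n - m - k" by simp
    ultimately show "of_nat (n choose (k + m)) * of_nat ((k + m) choose m) * a ^ (k + m) * b ^ (n - (k + m))
       = of_nat (n choose m) * a ^ m * (of_nat ((n - m) choose k) * a ^ k * b ^ (n - m - k))"
      by (simp add: power_add mult_ac)
  qed auto
  also have "\<dots> = of_nat (n choose m) * a ^ m * (a + b) ^ (n - m)"
    by (simp add: binomial_ring sum_distrib_left)
  finally show ?thesis .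
qed

lemma choose_scaled:
  assumes "n > 0"
  shows "fact m * real (k choose m) / real n ^ m = (\<Prod>i<m. real k / real n - real i / real n)"
proof -
  have "fact m * real (k choose m) = (\<Prod>i<m. real k - real i)"
    by (simp add: binomial_gbinomial gbinomial_prod_rev atLeast0LessThan)
  then show ?thesis
    using assms by (simp add: diff_divide_distrib[symmetric] prod_dividef)
qed

text \<open>The weights \<open>w n k\<close>, placed at the points \<open>k / n\<close> of the unit interval, form a tight sequence of distributions.
  Factorial moments, divided by \<open>n ^ m\<close>, differ from power moments by \<open>O(1 / n)\<close>, so a weak limit has the moments \<open>mom\<close>.\<close>

lemma Hausdorff_moment_measure:
  fixes w :: "nat \<Rightarrow> nat \<Rightarrow> real" and mom :: "nat \<Rightarrow> real"
  assumes w_nonneg: "\<And>n k. w n k \<ge> 0"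
    and factorial_moment: "\<And>n m. m \<le> n \<Longrightarrow> (\<Sum>k\<le>n. w n k * real (k choose m)) = real (n choose m) * mom m"
    and mom_0: "mom 0 = 1"
  shows "\<exists>\<mu>. prob_space \<mu> \<and> sets \<mu> = sets borel \<and> (AE x in \<mu>. x \<in> {0..1}) \<and> (\<forall>m. (\<integral>x. x ^ m \<partial>\<mu>) = mom m)"
proof -
  define W where "W n k = (if k \<le> n then w n k else 0)" for n k
  \<comment> \<open>The index \<open>Suc n\<close> avoids the degenerate grid \<open>k / 0\<close>.\<close>
  define pm where "pm n = embed_pmf (W (Suc n))" for n
  have W_sum: "(\<Sum>k\<le>n. W n k) = 1" for n
    using factorial_moment[of 0 n] by (simp add: W_def mom_0)
  have W0: "W n k \<ge> 0" for n k by (simp add: W_def w_nonneg)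
  have "(\<integral>\<^sup>+ k. ennreal (W n k) \<partial>count_space UNIV) = 1" for n
  proof -
    have "(\<integral>\<^sup>+ k. ennreal (W n k) \<partial>count_space UNIV) = (\<Sum>k\<le>n. ennreal (W n k))"
      by (rule nn_integral_count_space'[where A="{..n}"]) (auto simp: W_def)
    also have "\<dots> = 1" using W_sum[of n] W0 by (simp add: sum_ennreal)
    finally show ?thesis .
  qed
  then have pmf_pm: "pmf (pm n) k = W (Suc n) k" for n k
    unfolding pm_def using W0 by (intro pmf_embed_pmf) auto
  have set_pm: "set_pmf (pm n) \<subseteq> {..Suc n}" for n
    by (auto simp: set_pmf_iff pmf_pm W_def split: if_splits)
  define \<nu> where "\<nu> n = distr (measure_pmf (pm n)) borel (\<lambda>k. real k / real (Suc n))" for n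
  have rd: "real_distribution (\<nu> n)" for n
    unfolding \<nu>_def real_distribution_def real_distribution_axioms_def
    by (auto intro!: measure_pmf.prob_space_distr)
  have int_\<nu>: "(\<integral>x. \<phi> x \<partial>\<nu> n) = (\<Sum>k\<le>Suc n. W (Suc n) k * \<phi> (real k / real (Suc n)))"
    if "\<phi> \<in> borel_measurable borel" for \<phi> :: "real \<Rightarrow> real" and n
    unfolding \<nu>_def using that set_pm
    by (subst integral_distr) (auto simp: integral_measure_pmf_real[where A="{..Suc n}"] pmf_pm mult.commute
        intro!: integral_measure_pmf_real[where A="{..Suc n}", THEN trans])
  have tight: "tight \<nu>"
    unfolding tight_def
  proof (intro conjI allI impI rd)
    fix \<epsilon> :: real assume "\<epsilon> > 0"
    have "measure (\<nu> n) {-1<..1} = 1" for n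
    proof -
      have "measure (\<nu> n) {-1<..1} = measure_pmf.prob (pm n) {k. real k / real (Suc n) \<in> {-1<..1}}"
        unfolding \<nu>_def by (subst measure_distr) (auto simp: vimage_def)
      also have "\<dots> = 1"
      proof (rule measure_pmf.prob_eq_1[THEN iffD2])
        show "AE k in measure_pmf (pm n). k \<in> {k. real k / real (Suc n) \<in> {-1<..1}}"
          using set_pm[of n] by (auto simp: AE_measure_pmf_iff divide_simps intro: less_le_trans[of "-1::real" 0])
      qed auto
      finally show ?thesis .
    qed
    then show "\<exists>a b. a < b \<and> (\<forall>n. 1 - \<epsilon> < measure (\<nu> n) {a<..b})"
      using \<open>\<epsilon> > 0\<close> by (intro exI[of _ "-1"] exI[of _ 1]) auto
  qed
  obtain r \<mu> where r: "strict_mono (r :: nat \<Rightarrow> nat)" and rd\<mu>: "real_distribution \<mu>" and conv: "weak_conv_m (\<nu> \<circ> r) \<mu>"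
    using tight_imp_convergent_subsubsequence[OF tight strict_mono_id] by auto
  have lim: "(\<lambda>n. integral\<^sup>L (\<nu> (r n)) \<phi>) \<longlonglongrightarrow> integral\<^sup>L \<mu> \<phi>"
    if "\<And>x. isCont \<phi> x" "\<And>x. norm (\<phi> x) \<le> B" for \<phi> :: "real \<Rightarrow> real" and B
  proof -
    have *: "weak_conv_m (\<lambda>n. \<nu> (r n)) \<mu>" using conv by (simp add: o_def)
    show ?thesis
      using weak_conv_imp_integral_bdd_continuous_conv[OF _ rd\<mu> *, of \<phi> B] rd that by blast
  qed
  interpret \<mu>: real_distribution \<mu> by (fact rd\<mu>)
  \<comment> \<open>A bounded continuous function whose zero set is the unit interval: it shows that the limit lives there.\<close>
  define \<psi> where "\<psi> x = min 1 (max 0 (max (-x) (x - 1)))" for x :: real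
  have \<psi>_meas: "\<psi> \<in> borel_measurable borel" unfolding \<psi>_def by measurable
  have "integral\<^sup>L \<mu> \<psi> = 0"
  proof -
    have "(\<lambda>n. integral\<^sup>L (\<nu> (r n)) \<psi>) \<longlonglongrightarrow> integral\<^sup>L \<mu> \<psi>"
    proof (rule lim[where B=1])
      show "isCont \<psi> x" for x unfolding \<psi>_def[abs_def] by (intro continuous_intros)
    qed (auto simp: \<psi>_def)
    moreover have "integral\<^sup>L (\<nu> n) \<psi> = 0" for n
      unfolding int_\<nu>[OF \<psi>_meas] by (intro sum.neutral) (auto simp: \<psi>_def divide_simps)
    ultimately show ?thesis by (simp add: LIMSEQ_const_iff)
  qed
  moreover have "integrable \<mu> \<psi>"
    using \<psi>_meas by (intro \<mu>.integrable_const_bound[where B=1]) (auto simp: \<psi>_def)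
  ultimately have "AE x in \<mu>. \<psi> x = 0"
    by (subst (asm) integral_nonneg_eq_0_iff_AE) (auto simp: \<psi>_def)
  then have AE01: "AE x in \<mu>. x \<in> {0..1}"
    by eventually_elim (auto simp: \<psi>_def min_def max_def split: if_splits)
  have "(\<integral>x. x ^ m \<partial>\<mu>) = mom m" for m
  proof -
    \<comment> \<open>Weak convergence needs bounded continuous test functions, hence the power is clamped outside the unit interval.\<close>
    define cl where "cl x = (max 0 (min 1 x)) ^ m" for x :: real
    define fm where "fm n = (\<Prod>i<m. 1 - real i / real (Suc n))" for n
    have cl_meas: "cl \<in> borel_measurable borel" unfolding cl_def by measurable
    have A: "(\<lambda>n. integral\<^sup>L (\<nu> (r n)) cl) \<longlonglongrightarrow> integral\<^sup>L \<mu> cl"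
    proof (rule lim[where B=1])
      show "isCont cl x" for x unfolding cl_def[abs_def] by (intro continuous_intros)
    qed (auto simp: cl_def intro!: power_le_one)
    have close: "\<bar>integral\<^sup>L (\<nu> n) cl - fm n * mom m\<bar> \<le> real m * real m / real (Suc n)" if "n \<ge> m" for n
    proof -
      let ?N = "real (Suc n)"
      have "fm n * mom m = (fact m * real (Suc n choose m) / ?N ^ m) * mom m"
        by (subst choose_scaled) (auto simp: fm_def simp del: of_nat_Suc)
      also have "\<dots> = fact m / ?N ^ m * (\<Sum>k\<le>Suc n. w (Suc n) k * real (k choose m))"
        using that by (subst factorial_moment) (auto simp: field_simps)
      also have "\<dots> = (\<Sum>k\<le>Suc n. W (Suc n) k * (fact m * real (k choose m) / ?N ^ m))"
        unfolding sum_distrib_left by (intro sum.cong) (auto simp: W_def)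
      also have "\<dots> = (\<Sum>k\<le>Suc n. W (Suc n) k * (\<Prod>i<m. real k / ?N - real i / ?N))"
        by (subst choose_scaled) auto
      finally have "integral\<^sup>L (\<nu> n) cl - fm n * mom m
          = (\<Sum>k\<le>Suc n. W (Suc n) k * (cl (real k / ?N) - (\<Prod>i<m. real k / ?N - real i / ?N)))"
        unfolding int_\<nu>[OF cl_meas] by (simp add: sum_subtractf right_diff_distrib del: of_nat_Suc)
      also have "\<bar>\<dots>\<bar> \<le> (\<Sum>k\<le>Suc n. W (Suc n) k * (real m * real m / ?N))"
      proof (rule order_trans[OF sum_abs sum_mono])
        fix k assume "k \<in> {..Suc n}"
        then have k: "real k / ?N \<le> 1" "0 \<le> real k / ?N" by (auto simp: divide_simps)
        have cl_k: "cl (real k / ?N) = (\<Prod>i<m. real k / ?N)" using k by (simp add: cl_def)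
        have "\<bar>cl (real k / ?N) - (\<Prod>i<m. real k / ?N - real i / ?N)\<bar> \<le> (\<Sum>i<m. \<bar>real k / ?N - (real k / ?N - real i / ?N)\<bar>)"
          unfolding cl_k real_norm_def[symmetric]
        proof (rule norm_prod_diff)
          fix i assume "i \<in> {..<m}"
          then have "real i \<le> ?N" using that by simp
          then have "0 \<le> real i / ?N" "real i / ?N \<le> 1" by (auto simp: divide_simps)
          then show "norm (real k / ?N - real i / ?N) \<le> 1" using k unfolding real_norm_def by linarith
        qed (use k in auto)
        also have "\<dots> \<le> (\<Sum>i<m. real m / ?N)"
          by (intro sum_mono) (auto simp: divide_simps)
        finally have *: "\<bar>cl (real k / ?N) - (\<Prod>i<m. real k / ?N - real i / ?N)\<bar> \<le> real m * real m / ?N" by simp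
        show "\<bar>W (Suc n) k * (cl (real k / ?N) - (\<Prod>i<m. real k / ?N - real i / ?N))\<bar> \<le> W (Suc n) k * (real m * real m / ?N)"
          unfolding abs_mult abs_of_nonneg[OF W0] by (rule mult_left_mono[OF * W0])
      qed
      also have "\<dots> = real m * real m / ?N"
        using W_sum[of "Suc n"] by (simp only: sum_distrib_right[symmetric] mult_1)
      finally show ?thesis .
    qed
    have e0: "(\<lambda>n. real m * real m / real (Suc n)) \<longlonglongrightarrow> 0"
      by real_asymp
    have "(\<lambda>n. integral\<^sup>L (\<nu> n) cl - fm n * mom m) \<longlonglongrightarrow> 0"
      by (rule Lim_null_comparison[OF _ e0]) (use close in \<open>auto intro!: eventually_sequentiallyI[of m]\<close>)
    moreover have "(\<lambda>n. fm n * mom m) \<longlonglongrightarrow> (\<Prod>i<m. 1) * mom m"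
      unfolding fm_def by (intro tendsto_mult tendsto_prod tendsto_const) real_asymp
    ultimately have "(\<lambda>n. (integral\<^sup>L (\<nu> n) cl - fm n * mom m) + fm n * mom m) \<longlonglongrightarrow> 0 + mom m"
      by (intro tendsto_add) auto
    then have "(\<lambda>n. integral\<^sup>L (\<nu> n) cl) \<longlonglongrightarrow> mom m" by simp
    then have "(\<lambda>n. integral\<^sup>L (\<nu> (r n)) cl) \<longlonglongrightarrow> mom m"
      using LIMSEQ_subseq_LIMSEQ[OF _ r] by (fastforce simp: o_def)
    with A have "integral\<^sup>L \<mu> cl = mom m" by (rule LIMSEQ_unique)
    moreover have "integral\<^sup>L \<mu> cl = (\<integral>x. x ^ m \<partial>\<mu>)"
      using AE01 cl_meas by (intro integral_cong_AE) (auto simp: cl_def)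
    ultimately show ?thesis by simp
  qed
  then show ?thesis
    using AE01 \<mu>.prob_space_axioms \<mu>.events_eq_borel by blast
qed

context bounded_selfadjoint
begin

text \<open>With \<open>a = (M + H)/2M\<close> and \<open>b = 1 - a\<close> the numbers \<open>(n choose k) \<langle>f, a ^ k b ^ (n - k) f\<rangle>\<close> solve the moment problem for
  \<open>a\<close> on the unit interval; an affine change of variable gives the measure of \<open>H\<close>.\<close>

theorem spectral_measure_exists:
  assumes "norm f = 1"
  shows "\<exists>\<mu>. spectral_measure f \<mu>"
proof -
  define a b where "a = [:1/2, 1/(2*M):]" and "b = [:1/2, -1/(2*M):]"
  have ab: "a + b = 1" by (simp add: a_def b_def one_pCons)
  define w where "w n k = real (n choose k) * inner f (opoly H (a ^ k * b ^ (n - k)) f)" for n k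
  define mom where "mom m = inner f (opoly H (a ^ m) f)" for m
  have "\<exists>\<nu>. prob_space \<nu> \<and> sets \<nu> = sets borel \<and> (AE x in \<nu>. x \<in> {0..1}) \<and> (\<forall>m. (\<integral>x. x ^ m \<partial>\<nu>) = mom m)"
  proof (rule Hausdorff_moment_measure[where w=w])
    show "0 \<le> w n k" for n k
      unfolding w_def using Bernstein_weight_nonneg[of f k "n-k"] by (simp add: a_def b_def)
    show "mom 0 = 1" using assms by (simp add: mom_def dot_square_norm)
    fix m n :: nat assume "m \<le> n"
    have of_nat_mult_smult: "of_nat c * p = Polynomial.smult (real c) p" for c and p :: "real poly"
      by (simp add: of_nat_poly)
    have "(\<Sum>k\<le>n. w n k * real (k choose m))
        = inner f (opoly H (\<Sum>k\<le>n. of_nat (n choose k) * of_nat (k choose m) * a ^ k * b ^ (n - k)) f)"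
      unfolding opoly_sum inner_sum_right w_def
      by (intro sum.cong refl) (simp add: mult.assoc of_nat_mult_smult opoly_smult)
    also have "\<dots> = inner f (opoly H (of_nat (n choose m) * a ^ m) f)"
      by (subst sum_binomial_factorial_moment[OF \<open>m \<le> n\<close>]) (simp add: ab)
    finally show "(\<Sum>k\<le>n. w n k * real (k choose m)) = real (n choose m) * mom m"
      by (simp add: of_nat_mult_smult opoly_smult mom_def)
  qed
  then obtain \<nu> where \<nu>: "prob_space \<nu>" and sets_\<nu>: "sets \<nu> = sets borel" and AE\<nu>: "AE x in \<nu>. x \<in> {0..1}"
    and mom\<nu>: "\<And>m. (\<integral>x. x ^ m \<partial>\<nu>) = mom m" by blast
  interpret \<nu>: prob_space \<nu> by (fact \<nu>)
  have meas\<nu>: "g \<in> borel_measurable \<nu>" if "g \<in> borel_measurable borel" for g :: "real \<Rightarrow> real"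
    using that sets_\<nu> measurable_cong_sets by blast
  have integrable_poly: "integrable \<nu> (\<lambda>y. y ^ m * poly q y)" for m q
  proof -
    have "bounded ((\<lambda>y::real. y ^ m * poly q y) ` {0..1})"
      by (intro compact_imp_bounded compact_continuous_image) (auto intro!: continuous_intros)
    then obtain B where B: "\<And>y. y \<in> {0..1} \<Longrightarrow> norm (y ^ m * poly q y) \<le> B"
      unfolding bounded_iff by blast
    have "(\<lambda>y::real. y ^ m * poly q y) \<in> borel_measurable borel"
      by (intro borel_measurable_continuous_onI continuous_intros)
    then show ?thesis
      using AE\<nu> B by (intro \<nu>.integrable_const_bound[where B=B] meas\<nu>) auto
  qed
  have poly_moment: "(\<integral>y. y ^ m * poly q y \<partial>\<nu>) = inner f (opoly H (a ^ m * pcompose q a) f)" for q m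
  proof (induction q arbitrary: m)
    case (pCons c q)
    have "(\<integral>y. y ^ m * poly (pCons c q) y \<partial>\<nu>) = (\<integral>y. c * (y ^ m * poly 1 y) + y ^ Suc m * poly q y \<partial>\<nu>)"
      by (intro Bochner_Integration.integral_cong) (auto simp: algebra_simps)
    also have "\<dots> = c * (\<integral>y. y ^ m * poly 1 y \<partial>\<nu>) + (\<integral>y. y ^ Suc m * poly q y \<partial>\<nu>)"
      by (subst Bochner_Integration.integral_add) (auto intro!: integrable_poly integrable_mult_right simp del: power_Suc poly_1)
    also have "\<dots> = c * mom m + inner f (opoly H (a ^ Suc m * pcompose q a) f)"
      by (simp only: pCons poly_1 mult_1_right mom\<nu>)
    also have "a ^ m * pcompose (pCons c q) a = Polynomial.smult c (a ^ m) + a ^ Suc m * pcompose q a"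
      by (simp add: pcompose_pCons algebra_simps)
    then have "c * mom m + inner f (opoly H (a ^ Suc m * pcompose q a) f)
       = inner f (opoly H (a ^ m * pcompose (pCons c q) a) f)"
      by (simp add: opoly_add opoly_smult inner_add_right mom_def del: power_Suc)
    finally show ?case .
  qed simp
  \<comment> \<open>The affine map from the unit interval onto the window, inverse to \<open>a\<close>.\<close>
  define c where "c = [:-M, 2*M:]"
  define \<mu> where "\<mu> = distr \<nu> borel (poly c)"
  have c_meas: "poly c \<in> borel_measurable \<nu>"
    by (intro meas\<nu> borel_measurable_continuous_onI continuous_intros)
  have ca: "pcompose c a = [:0, 1:]"
    using M_pos by (simp add: c_def a_def pcompose_pCons)
  have "(\<integral>x. poly p x \<partial>\<mu>) = inner f (opoly H p f)" for p
  proof -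
    have "(\<integral>x. poly p x \<partial>\<mu>) = (\<integral>y. y ^ 0 * poly (pcompose p c) y \<partial>\<nu>)"
      unfolding \<mu>_def by (subst integral_distr[OF c_meas])
        (auto simp: poly_pcompose intro!: borel_measurable_continuous_onI continuous_intros)
    also have "\<dots> = inner f (opoly H (pcompose p (pcompose c a)) f)"
      by (subst poly_moment) (simp add: pcompose_assoc)
    finally show ?thesis by (simp add: ca pcompose_idR)
  qed
  moreover have "AE x in \<mu>. \<bar>x\<bar> \<le> M"
    unfolding \<mu>_def
    by (subst AE_distr_iff[OF c_meas])
      (use AE\<nu> M_pos in \<open>auto simp: c_def abs_le_iff intro: mult_left_le\<close>)
  moreover have "prob_space \<mu>" unfolding \<mu>_def by (rule \<nu>.prob_space_distr[OF c_meas])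
  moreover have "sets \<mu> = sets borel" by (simp add: \<mu>_def)
  ultimately show ?thesis unfolding spectral_measure_def by blast
qed

end

section \<open>Functional calculus\<close>

lemma Weierstrass_poly:
  fixes g :: "real \<Rightarrow> real"
  assumes "continuous_on {a..b} g" "e > 0"
  shows "\<exists>p. \<forall>x\<in>{a..b}. \<bar>g x - poly p x\<bar> < e"
proof -
  obtain h where h: "real_polynomial_function h" "\<And>x. x \<in> {a..b} \<Longrightarrow> \<bar>g x - h x\<bar> < e"
    using Stone_Weierstrass_real_polynomial_function[of "{a..b}" g e] assms by auto
  then obtain c n where "h = (\<lambda>x. \<Sum>i\<le>n. c i * x ^ i)" unfolding real_polynomial_function_iff_sum by blast
  then have "h x = poly (\<Sum>i\<le>n. monom (c i) i) x" for x by (simp add: poly_sum poly_monom)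
  then show ?thesis using h(2) by metis
qed

context bounded_selfadjoint
begin

lemma
  assumes "spectral_measure f \<mu>"
  shows spectral_measure_prob: "prob_space \<mu>"
    and spectral_measure_sets: "sets \<mu> = sets borel"
    and spectral_measure_AE: "AE x in \<mu>. \<bar>x\<bar> \<le> M"
    and spectral_measure_poly: "(\<integral>x. poly p x \<partial>\<mu>) = inner f (opoly H p f)"
  using assms by (auto simp: spectral_measure_def)

lemma spectral_measure_measurable:
  "spectral_measure f \<mu> \<Longrightarrow> g \<in> borel_measurable borel \<Longrightarrow> g \<in> borel_measurable \<mu>"
  by (subst measurable_cong_sets[OF spectral_measure_sets refl])

lemma spectral_measure_norm_opoly:
  assumes "spectral_measure f \<mu>"
  shows "(norm (opoly H p f))\<^sup>2 = (\<integral>x. (poly p x)\<^sup>2 \<partial>\<mu>)"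
proof -
  have "(norm (opoly H p f))\<^sup>2 = inner f (opoly H (p * p) f)"
    by (simp only: power2_norm_eq_inner opoly_mult_inner)
  then show ?thesis using spectral_measure_poly[OF assms, of "p * p"] by (simp add: power2_eq_square)
qed

lemma poly_bounded_window: "\<exists>Q\<ge>0. \<forall>x. \<bar>x\<bar> \<le> M \<longrightarrow> \<bar>poly q x\<bar> \<le> Q"
proof -
  have "bounded (poly q ` {-M..M})"
    by (intro compact_imp_bounded compact_continuous_image) (auto intro!: continuous_intros)
  then obtain Q where "\<And>x. x \<in> {-M..M} \<Longrightarrow> norm (poly q x) \<le> Q" unfolding bounded_iff by blast
  then show ?thesis by (intro exI[of _ "max 0 Q"]) (auto simp: abs_le_iff le_max_iff_disj)
qed

lemma opoly_tendsto_0: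
  assumes sm: "spectral_measure f \<mu>"
    and b: "b \<in> borel_measurable borel" "integrable \<mu> (\<lambda>x. (b x)\<^sup>2)"
    and lim: "AE x in \<mu>. (\<lambda>k. poly (s k) x) \<longlonglongrightarrow> 0"
    and bound: "\<And>k. AE x in \<mu>. \<bar>poly (s k) x\<bar> \<le> b x"
  shows "(\<lambda>k. opoly H (s k) f) \<longlonglongrightarrow> 0"
proof -
  have [measurable]: "b \<in> borel_measurable \<mu>" by (rule spectral_measure_measurable[OF sm b(1)])
  have "(\<lambda>k. \<integral>x. (poly (s k) x)\<^sup>2 \<partial>\<mu>) \<longlonglongrightarrow> (\<integral>x. 0 \<partial>\<mu>)"
  proof (rule integral_dominated_convergence[where w="\<lambda>x. (b x)\<^sup>2"])
    show "(\<lambda>x. (poly (s k) x)\<^sup>2) \<in> borel_measurable \<mu>" for k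
      by (intro spectral_measure_measurable[OF sm] borel_measurable_continuous_onI continuous_intros)
    show "AE x in \<mu>. (\<lambda>k. (poly (s k) x)\<^sup>2) \<longlonglongrightarrow> 0"
      using lim by eventually_elim (auto intro: tendsto_eq_intros)
    show "AE x in \<mu>. norm ((poly (s k) x)\<^sup>2) \<le> (b x)\<^sup>2" for k
      using bound[of k] by eventually_elim (metis abs_ge_zero norm_power power_mono real_norm_def)
  qed (use b in auto)
  then have "(\<lambda>k. (norm (opoly H (s k) f))\<^sup>2) \<longlonglongrightarrow> 0"
    by (simp add: spectral_measure_norm_opoly[OF sm])
  then have "(\<lambda>k. sqrt ((norm (opoly H (s k) f))\<^sup>2)) \<longlonglongrightarrow> sqrt 0" by (rule tendsto_real_sqrt)
  then show ?thesis by (simp add: tendsto_norm_zero_iff)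
qed

text \<open>By \<open>spectral_measure_norm_opoly\<close> the map \<open>p \<mapsto> p(H) f\<close> is an isometry for the norm of \<open>L\<^sup>2(\<mu>)\<close>, so it extends to
  limits of polynomials that are dominated by a square integrable function.  The last conclusion transports the identity
  \<open>q g = r\<close> of functions to \<open>q(H) u = r(H) f\<close>; it is how solutions of operator equations are produced.\<close>

lemma functional_calculus:
  assumes sm: "spectral_measure f \<mu>"
    and g: "g \<in> borel_measurable borel"
    and b: "b \<in> borel_measurable borel" "integrable \<mu> (\<lambda>x. (b x)\<^sup>2)"
    and lim: "AE x in \<mu>. (\<lambda>k. poly (p k) x) \<longlonglongrightarrow> g x"
    and bound: "\<And>k. AE x in \<mu>. \<bar>poly (p k) x\<bar> \<le> b x"
  obtains u where "(\<lambda>k. opoly H (p k) f) \<longlonglongrightarrow> u"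
    and "inner u f = (\<integral>x. g x \<partial>\<mu>)" and "inner u u = (\<integral>x. (g x)\<^sup>2 \<partial>\<mu>)"
    and "\<And>q r. AE x in \<mu>. poly q x * g x = poly r x \<Longrightarrow> opoly H q u = opoly H r f"
proof -
  interpret prob_space \<mu> by (rule spectral_measure_prob[OF sm])
  note meas = spectral_measure_measurable[OF sm]
  have meas_poly: "poly q \<in> borel_measurable \<mu>" for q
    by (intro meas borel_measurable_continuous_onI continuous_intros)
  have [measurable]: "g \<in> borel_measurable \<mu>" "b \<in> borel_measurable \<mu>" "\<And>q. poly q \<in> borel_measurable \<mu>"
    by (intro meas g b meas_poly)+
  have gb: "AE x in \<mu>. \<bar>g x\<bar> \<le> b x"
  proof -
    have "AE x in \<mu>. \<forall>k. \<bar>poly (p k) x\<bar> \<le> b x" using bound by (simp add: AE_all_countable)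
    then show ?thesis using lim
    proof eventually_elim
      case (elim x)
      have "(\<lambda>k. \<bar>poly (p k) x\<bar>) \<longlonglongrightarrow> \<bar>g x\<bar>" using elim by (intro tendsto_rabs)
      then show ?case by (rule LIMSEQ_le_const2) (use elim in auto)
    qed
  qed
  have int_b: "integrable \<mu> b"
  proof (rule Bochner_Integration.integrable_bound[where f="\<lambda>x. 1 + (b x)\<^sup>2"])
    show "AE x in \<mu>. norm (b x) \<le> norm (1 + (b x)\<^sup>2)"
    proof (rule AE_I2)
      fix x
      have "0 \<le> (\<bar>b x\<bar> - 1)\<^sup>2" by simp
      then have "2 * \<bar>b x\<bar> \<le> 1 + (b x)\<^sup>2" unfolding power2_diff by simp
      then show "norm (b x) \<le> norm (1 + (b x)\<^sup>2)" by simp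
    qed
  qed (use b in auto)
  have "(\<lambda>k. \<integral>x. (poly (p k) x - g x)\<^sup>2 \<partial>\<mu>) \<longlonglongrightarrow> (\<integral>x. 0 \<partial>\<mu>)"
  proof (rule integral_dominated_convergence[where w="\<lambda>x. 4 * (b x)\<^sup>2"])
    show "AE x in \<mu>. (\<lambda>k. (poly (p k) x - g x)\<^sup>2) \<longlonglongrightarrow> 0"
      using lim by eventually_elim (auto intro!: tendsto_eq_intros)
    show "AE x in \<mu>. norm ((poly (p k) x - g x)\<^sup>2) \<le> 4 * (b x)\<^sup>2" for k
      using bound[of k] gb
    proof eventually_elim
      case (elim x)
      have "\<bar>poly (p k) x - g x\<bar> \<le> 2 * b x" using elim by linarith
      then have "\<bar>poly (p k) x - g x\<bar>\<^sup>2 \<le> (2 * b x)\<^sup>2" by (intro power_mono) auto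
      then show ?case by (simp add: power_mult_distrib)
    qed
  qed (use b in auto)
  then have err: "(\<lambda>k. \<integral>x. (poly (p k) x - g x)\<^sup>2 \<partial>\<mu>) \<longlonglongrightarrow> 0" by simp
  have int_err: "integrable \<mu> (\<lambda>x. (poly (p k) x - g x)\<^sup>2)" for k
  proof (rule Bochner_Integration.integrable_bound[where f="\<lambda>x. 4 * (b x)\<^sup>2"])
    show "AE x in \<mu>. norm ((poly (p k) x - g x)\<^sup>2) \<le> norm (4 * (b x)\<^sup>2)"
      using bound[of k] gb
    proof eventually_elim
      case (elim x)
      have "\<bar>poly (p k) x - g x\<bar> \<le> 2 * b x" using elim by linarith
      then have "\<bar>poly (p k) x - g x\<bar>\<^sup>2 \<le> (2 * b x)\<^sup>2" by (intro power_mono) auto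
      then show ?case by (simp add: power_mult_distrib)
    qed
  qed (use b in auto)
  have diff: "(norm (opoly H (p k) f - opoly H (p l) f))\<^sup>2
      \<le> 2 * (\<integral>x. (poly (p k) x - g x)\<^sup>2 \<partial>\<mu>) + 2 * (\<integral>x. (poly (p l) x - g x)\<^sup>2 \<partial>\<mu>)" for k l
  proof -
    have "(norm (opoly H (p k) f - opoly H (p l) f))\<^sup>2 = (\<integral>x. (poly (p k) x - poly (p l) x)\<^sup>2 \<partial>\<mu>)"
      using spectral_measure_norm_opoly[OF sm, of "p k - p l"] by (simp add: opoly_diff)
    also have "\<dots> \<le> (\<integral>x. 2 * (poly (p k) x - g x)\<^sup>2 + 2 * (poly (p l) x - g x)\<^sup>2 \<partial>\<mu>)"
    proof (rule integral_mono')
      show "(poly (p k) x - poly (p l) x)\<^sup>2 \<le> 2 * (poly (p k) x - g x)\<^sup>2 + 2 * (poly (p l) x - g x)\<^sup>2" for x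
      proof -
        have "0 \<le> ((poly (p k) x - g x) + (poly (p l) x - g x))\<^sup>2" by simp
        then show ?thesis by (simp add: power2_eq_square algebra_simps)
      qed
    qed (auto intro!: Bochner_Integration.integrable_add integrable_mult_right int_err)
    also have "\<dots> = 2 * (\<integral>x. (poly (p k) x - g x)\<^sup>2 \<partial>\<mu>) + 2 * (\<integral>x. (poly (p l) x - g x)\<^sup>2 \<partial>\<mu>)"
      using int_err by simp
    finally show ?thesis .
  qed
  have "Cauchy (\<lambda>k. opoly H (p k) f)"
  proof (rule CauchyI)
    fix e :: real assume "e > 0"
    then have "e\<^sup>2/4 > 0" by simp
    from LIMSEQ_D[OF err this] obtain N where N: "\<And>k. k \<ge> N \<Longrightarrow> (\<integral>x. (poly (p k) x - g x)\<^sup>2 \<partial>\<mu>) < e\<^sup>2/4"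
      by (auto simp: abs_less_iff)
    show "\<exists>N. \<forall>k\<ge>N. \<forall>l\<ge>N. norm (opoly H (p k) f - opoly H (p l) f) < e"
    proof (intro exI allI impI)
      fix k l assume "k \<ge> N" "l \<ge> N"
      then have "(norm (opoly H (p k) f - opoly H (p l) f))\<^sup>2 < e\<^sup>2"
        using diff[of k l] N[of k] N[of l] by linarith
      then show "norm (opoly H (p k) f - opoly H (p l) f) < e"
        using \<open>e > 0\<close> power2_less_imp_less by fastforce
    qed
  qed
  then obtain u where u: "(\<lambda>k. opoly H (p k) f) \<longlonglongrightarrow> u"
    using Cauchy_convergent_iff convergent_def by blast
  have "(\<lambda>k. inner (opoly H (p k) f) f) \<longlonglongrightarrow> inner u f"
    by (intro tendsto_inner u tendsto_const)
  moreover have "(\<lambda>k. inner (opoly H (p k) f) f) \<longlonglongrightarrow> (\<integral>x. g x \<partial>\<mu>)"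
  proof -
    have "(\<lambda>k. \<integral>x. poly (p k) x \<partial>\<mu>) \<longlonglongrightarrow> (\<integral>x. g x \<partial>\<mu>)"
      by (rule integral_dominated_convergence[where w=b]) (use int_b lim bound in auto)
    then show ?thesis by (simp add: spectral_measure_poly[OF sm] inner_commute)
  qed
  ultimately have 1: "inner u f = (\<integral>x. g x \<partial>\<mu>)" by (rule LIMSEQ_unique)
  have "(\<lambda>k. (norm (opoly H (p k) f))\<^sup>2) \<longlonglongrightarrow> (norm u)\<^sup>2"
    by (intro tendsto_intros u)
  moreover have "(\<lambda>k. (norm (opoly H (p k) f))\<^sup>2) \<longlonglongrightarrow> (\<integral>x. (g x)\<^sup>2 \<partial>\<mu>)"
    unfolding spectral_measure_norm_opoly[OF sm]
  proof (rule integral_dominated_convergence[where w="\<lambda>x. (b x)\<^sup>2"])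
    show "AE x in \<mu>. (\<lambda>k. (poly (p k) x)\<^sup>2) \<longlonglongrightarrow> (g x)\<^sup>2"
      using lim by eventually_elim (auto intro!: tendsto_eq_intros)
    show "AE x in \<mu>. norm ((poly (p k) x)\<^sup>2) \<le> (b x)\<^sup>2" for k
      using bound[of k] by eventually_elim (metis abs_ge_zero norm_power power_mono real_norm_def)
  qed (use b in auto)
  ultimately have 2: "inner u u = (\<integral>x. (g x)\<^sup>2 \<partial>\<mu>)"
    using LIMSEQ_unique by (auto simp: power2_norm_eq_inner)
  have 3: "opoly H q u = opoly H r f" if "AE x in \<mu>. poly q x * g x = poly r x" for q r
  proof -
    obtain Q R where Q: "Q \<ge> 0" "\<And>x. \<bar>x\<bar> \<le> M \<Longrightarrow> \<bar>poly q x\<bar> \<le> Q" and R: "R \<ge> 0" "\<And>x. \<bar>x\<bar> \<le> M \<Longrightarrow> \<bar>poly r x\<bar> \<le> R"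
      using poly_bounded_window by metis
    have "(\<lambda>k. opoly H (q * p k - r) f) \<longlonglongrightarrow> 0"
    proof (rule opoly_tendsto_0[OF sm, where b="\<lambda>x. Q * b x + R"])
      have "(\<lambda>x. (Q * b x + R)\<^sup>2) = (\<lambda>x. Q\<^sup>2 * (b x)\<^sup>2 + 2 * Q * R * b x + R\<^sup>2)"
        by (auto simp: power2_eq_square algebra_simps)
      then show "integrable \<mu> (\<lambda>x. (Q * b x + R)\<^sup>2)"
        using b int_b by simp
      show "AE x in \<mu>. (\<lambda>k. poly (q * p k - r) x) \<longlonglongrightarrow> 0"
        using lim that
      proof eventually_elim
        case (elim x)
        have "(\<lambda>k. poly q x * poly (p k) x - poly r x) \<longlonglongrightarrow> poly q x * g x - poly r x"
          by (intro tendsto_intros elim)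
        then show ?case using elim by simp
      qed
      show "AE x in \<mu>. \<bar>poly (q * p k - r) x\<bar> \<le> Q * b x + R" for k
        using bound[of k] spectral_measure_AE[OF sm]
      proof eventually_elim
        case (elim x)
        have "\<bar>poly (q * p k - r) x\<bar> \<le> \<bar>poly q x\<bar> * \<bar>poly (p k) x\<bar> + \<bar>poly r x\<bar>"
          by (simp add: abs_mult[symmetric])
        also have "\<dots> \<le> Q * b x + R"
          using elim Q R by (intro add_mono mult_mono) auto
        finally show ?case .
      qed
    qed (use b in measurable)
    moreover have "(\<lambda>k. opoly H (q * p k - r) f) \<longlonglongrightarrow> opoly H q u - opoly H r f"
      unfolding opoly_diff opoly_mult by (intro tendsto_intros tendsto_opoly u)
    ultimately show ?thesis using LIMSEQ_unique by fastforce
  qed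
  show ?thesis by (rule that[OF u 1 2 3])
qed

text \<open>The vector \<open>((H - E)\<^sup>2 + \<eta>\<^sup>2)\<^sup>-\<^sup>1 f\<close> takes the place of the resolvent at \<open>E + i \<eta>\<close>, which does not exist over the reals.\<close>

lemma resolvent_square_exists:
  assumes sm: "spectral_measure f \<mu>" and "\<eta> \<noteq> 0"
  obtains w where "opoly H [:E\<^sup>2 + \<eta>\<^sup>2, - 2 * E, 1:] w = f"
    and "inner w f = (\<integral>x. 1 / ((x - E)\<^sup>2 + \<eta>\<^sup>2) \<partial>\<mu>)"
proof -
  interpret prob_space \<mu> by (rule spectral_measure_prob[OF sm])
  define g where "g x = 1 / ((x - E)\<^sup>2 + \<eta>\<^sup>2)" for x
  have pos: "(x - E)\<^sup>2 + \<eta>\<^sup>2 > 0" for x using assms by (simp add: add_nonneg_pos)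
  have cont: "continuous_on S g" for S
    unfolding g_def using pos by (intro continuous_intros) (auto simp: less_le)
  have g_bound: "\<bar>g x\<bar> \<le> 1 / \<eta>\<^sup>2" for x
    using pos[of x] assms unfolding g_def by (auto simp: divide_simps)
  have "\<exists>p. \<forall>x\<in>{-M..M}. \<bar>g x - poly p x\<bar> < 1 / real (Suc k)" for k
    by (rule Weierstrass_poly[OF cont]) auto
  then obtain p where p: "\<And>k x. x \<in> {-M..M} \<Longrightarrow> \<bar>g x - poly (p k) x\<bar> < 1 / real (Suc k)"
    by metis
  show ?thesis
  proof (rule functional_calculus[OF sm, of g "\<lambda>x. 1 / \<eta>\<^sup>2 + 1" p])
    show "g \<in> borel_measurable borel" by (rule borel_measurable_continuous_onI[OF cont])
    show "AE x in \<mu>. (\<lambda>k. poly (p k) x) \<longlonglongrightarrow> g x"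
      using spectral_measure_AE[OF sm]
    proof eventually_elim
      case (elim x)
      have "(\<lambda>k. poly (p k) x - g x) \<longlonglongrightarrow> 0"
      proof (rule Lim_null_comparison)
        have "norm (poly (p k) x - g x) \<le> 1 / real (Suc k)" for k
          using p[of x k] elim by (simp add: abs_le_iff abs_minus_commute less_imp_le)
        then show "\<forall>\<^sub>F k in sequentially. norm (poly (p k) x - g x) \<le> 1 / real (Suc k)" by simp
      qed real_asymp
      then show ?case by (simp add: LIM_zero_iff)
    qed
    show "AE x in \<mu>. \<bar>poly (p k) x\<bar> \<le> 1 / \<eta>\<^sup>2 + 1" for k
      using spectral_measure_AE[OF sm]
    proof eventually_elim
      case (elim x)
      have "1 / real (Suc k) \<le> 1" by simp
      moreover have "\<bar>g x - poly (p k) x\<bar> < 1 / real (Suc k)" using elim by (intro p) auto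
      ultimately show ?case using g_bound[of x] by linarith
    qed
  next
    fix u assume u: "inner u f = (\<integral>x. g x \<partial>\<mu>)"
      "\<And>q r. AE x in \<mu>. poly q x * g x = poly r x \<Longrightarrow> opoly H q u = opoly H r f"
    have "opoly H [:E\<^sup>2 + \<eta>\<^sup>2, - 2 * E, 1:] u = opoly H 1 f"
    proof (rule u(2), rule AE_I2)
      fix x
      have "poly [:E\<^sup>2 + \<eta>\<^sup>2, - 2 * E, 1:] x = (x - E)\<^sup>2 + \<eta>\<^sup>2" by (simp add: power2_eq_square algebra_simps)
      then show "poly [:E\<^sup>2 + \<eta>\<^sup>2, - 2 * E, 1:] x * g x = poly 1 x" using pos[of x] assms(2) by (simp add: g_def)
    qed
    then show ?thesis using u(1) that by (simp add: g_def)
  qed auto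
qed

end

section \<open>Range of a shifted operator and inverse moments\<close>

text \<open>Since \<open>inverse 0\<close> is infinite in the extended reals, an atom at \<open>l\<close> makes the moment infinite.\<close>

definition inverse_square_moment :: "real measure \<Rightarrow> real \<Rightarrow> ennreal" where
  "inverse_square_moment \<mu> l = (\<integral>\<^sup>+x. inverse (ennreal ((x - l)\<^sup>2)) \<partial>\<mu>)"

context bounded_selfadjoint
begin

text \<open>For large \<open>c\<close> the polynomial \<open>1 - (x - l)\<^sup>2 / c\<close> is \<open>1\<close> at \<open>l\<close> and lies in \<open>[0, 1)\<close> elsewhere on the window, so its
  powers converge to the indicator function of \<open>{l}\<close>.\<close>

lemma eigenprojection:
  assumes sm: "spectral_measure f \<mu>"
  obtains \<phi> p where "H \<phi> = l *\<^sub>R \<phi>" and "inner \<phi> f = measure \<mu> {l}" and "inner \<phi> \<phi> = measure \<mu> {l}"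
    and "(\<lambda>k. opoly H (p k) f) \<longlonglongrightarrow> \<phi>"
proof -
  interpret prob_space \<mu> by (rule spectral_measure_prob[OF sm])
  define c where "c = (M + \<bar>l\<bar>)\<^sup>2"
  have "c > 0" using M_pos by (simp add: c_def)
  define q where "q = [:1 - l\<^sup>2 / c, 2 * l / c, - 1 / c:]"
  have q: "poly q x = 1 - (x - l)\<^sup>2 / c" for x
    using \<open>c > 0\<close> by (simp add: q_def power2_eq_square field_simps)
  have q01: "0 \<le> poly q x" "poly q x \<le> 1" if "\<bar>x\<bar> \<le> M" for x
  proof -
    have "\<bar>x - l\<bar>\<^sup>2 \<le> (M + \<bar>l\<bar>)\<^sup>2" using that by (intro power_mono) auto
    then show "0 \<le> poly q x" "poly q x \<le> 1" using \<open>c > 0\<close> by (auto simp: q c_def[symmetric])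
  qed
  have meas_l: "{l} \<in> sets \<mu>" using spectral_measure_sets[OF sm] by simp
  show ?thesis
  proof (rule functional_calculus[OF sm, of "indicator {l}" "\<lambda>_. 1" "\<lambda>k. q ^ k"])
    show "AE x in \<mu>. (\<lambda>k. poly (q ^ k) x) \<longlonglongrightarrow> indicator {l} x"
      using spectral_measure_AE[OF sm]
    proof eventually_elim
      case (elim x)
      show ?case
      proof (cases "x = l")
        case True then show ?thesis by (simp add: q poly_power)
      next
        case False
        then have "\<bar>poly q x\<bar> < 1" using q01[OF elim] \<open>c > 0\<close> by (simp add: q)
        then show ?thesis using False by (simp add: poly_power LIMSEQ_abs_realpow_zero2)
      qed
    qed
    show "AE x in \<mu>. \<bar>poly (q ^ k) x\<bar> \<le> 1" for k
      using spectral_measure_AE[OF sm]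
      by eventually_elim (use q01 in \<open>auto simp: poly_power power_le_one\<close>)
  next
    fix u assume u: "(\<lambda>k. opoly H (q ^ k) f) \<longlonglongrightarrow> u" "inner u f = (\<integral>x. indicator {l} x \<partial>\<mu>)"
      "inner u u = (\<integral>x. (indicator {l} x)\<^sup>2 \<partial>\<mu>)"
      "\<And>q r. AE x in \<mu>. poly q x * indicator {l} x = poly r x \<Longrightarrow> opoly H q u = opoly H r f"
    have "opoly H [:-l, 1:] u = opoly H 0 f"
      by (rule u(4)) (auto simp: indicator_def)
    moreover have "(\<integral>x. (indicator {l} x :: real)\<^sup>2 \<partial>\<mu>) = measure \<mu> {l}"
    proof -
      have "(\<lambda>x. (indicator {l} x :: real)\<^sup>2) = indicator {l}" by (auto simp: indicator_def fun_eq_iff)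
      then show ?thesis using meas_l by simp
    qed
    ultimately show ?thesis using u(1-3) meas_l by (intro that[of u "\<lambda>k. q ^ k"]) auto
  qed auto
qed

text \<open>Put \<open>w = ((H - l)\<^sup>2 + \<eta>\<^sup>2)\<^sup>-\<^sup>1 f\<close> and \<open>z = (H - l) w\<close>.  Testing the equations with \<open>w\<close> gives \<open>\<langle>w, f\<rangle> \<le> \<parallel>z\<parallel> B\<close>, while
  \<open>\<parallel>z\<parallel>\<^sup>2 \<le> \<langle>w, f\<rangle>\<close>; together \<open>\<langle>w, f\<rangle> \<le> B\<^sup>2\<close>.\<close>

lemma weak_range_resolvent_bound:
  assumes sm: "spectral_measure f \<mu>" and "\<eta> \<noteq> 0" and "B \<ge> 0"
    and bound: "\<And>n. norm (u n) \<le> B"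
    and weak: "\<And>y. (\<lambda>n. inner y (H (u n) - l *\<^sub>R u n)) \<longlonglongrightarrow> inner y f"
  shows "(\<integral>x. 1 / ((x - l)\<^sup>2 + \<eta>\<^sup>2) \<partial>\<mu>) \<le> B\<^sup>2"
proof -
  obtain w where w: "opoly H [:l\<^sup>2 + \<eta>\<^sup>2, - 2 * l, 1:] w = f" and J: "inner w f = (\<integral>x. 1 / ((x - l)\<^sup>2 + \<eta>\<^sup>2) \<partial>\<mu>)"
    by (rule resolvent_square_exists[OF sm assms(2)])
  define z where "z = H w - l *\<^sub>R w"
  have "inner z z = inner (H w - l *\<^sub>R w) z" by (simp add: z_def)
  also have "\<dots> = inner w (H z - l *\<^sub>R z)"
    by (simp add: inner_diff_left inner_diff_right sym)
  also have "H z - l *\<^sub>R z = f - \<eta>\<^sup>2 *\<^sub>R w"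
    unfolding z_def using w scaleR_left_distrib[of l l "H w"]
    by (simp add: linear_add[OF linear_H] linear_diff[OF linear_H] linear_cmul[OF linear_H] power2_eq_square algebra_simps)
  also have "inner w (f - \<eta>\<^sup>2 *\<^sub>R w) \<le> inner w f" by (simp add: inner_diff_right)
  finally have z2: "(norm z)\<^sup>2 \<le> inner w f" by (simp add: power2_norm_eq_inner)
  have "(\<lambda>n. inner z (u n)) \<longlonglongrightarrow> inner w f"
  proof -
    have "inner w (H (u n) - l *\<^sub>R u n) = inner z (u n)" for n
      by (simp add: z_def inner_diff_left inner_diff_right sym)
    then show ?thesis using weak[of w] by simp
  qed
  moreover have "inner z (u n) \<le> norm z * B" for n
    using norm_cauchy_schwarz[of z "u n"] bound[of n] by (meson mult_left_mono norm_ge_zero order_trans)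
  ultimately have "inner w f \<le> norm z * B" by (auto intro: LIMSEQ_le_const2)
  then have "(inner w f)\<^sup>2 \<le> (norm z * B)\<^sup>2"
    using z2 by (intro power_mono) (auto intro: order_trans[OF zero_le_power2])
  also have "\<dots> \<le> inner w f * B\<^sup>2" using z2 by (simp add: power_mult_distrib mult_right_mono)
  finally have "inner w f * inner w f \<le> inner w f * B\<^sup>2" by (simp add: power2_eq_square)
  moreover have "inner w f \<ge> 0" using z2 by (rule order_trans[OF zero_le_power2])
  ultimately have "inner w f \<le> B\<^sup>2" by (cases "inner w f = 0") auto
  then show ?thesis by (simp add: J)
qed

text \<open>Fatou's lemma for \<open>\<eta> \<longlonglongrightarrow> 0\<close> in \<open>weak_range_resolvent_bound\<close>.\<close>

lemma weak_range_moment_bound: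
  assumes sm: "spectral_measure f \<mu>" and "B \<ge> 0"
    and bound: "\<And>n. norm (u n) \<le> B"
    and weak: "\<And>y. (\<lambda>n. inner y (H (u n) - l *\<^sub>R u n)) \<longlonglongrightarrow> inner y f"
  shows "inverse_square_moment \<mu> l \<le> ennreal (B\<^sup>2)"
proof -
  interpret prob_space \<mu> by (rule spectral_measure_prob[OF sm])
  define h where "h k x = 1 / ((x - l)\<^sup>2 + (1 / real (Suc k))\<^sup>2)" for k x
  have pos: "(x - l)\<^sup>2 + (1 / real (Suc k))\<^sup>2 > 0" for x k by (simp add: add_nonneg_pos)
  have h_cont: "continuous_on UNIV (h k)" for k
    unfolding h_def using pos by (intro continuous_intros) (auto simp: less_le simp del: of_nat_Suc)
  have h_meas: "h k \<in> borel_measurable \<mu>" for k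
    by (intro spectral_measure_measurable[OF sm] borel_measurable_continuous_onI h_cont)
  have h0: "h k x \<ge> 0" for k x by (simp add: h_def)
  have h_int: "integrable \<mu> (h k)" for k
  proof (rule integrable_const_bound[where B="(real (Suc k))\<^sup>2"])
    have "h k x \<le> 1 / (1 / real (Suc k))\<^sup>2" for x
      unfolding h_def by (intro divide_left_mono mult_pos_pos pos) (auto simp del: of_nat_Suc)
    then show "AE x in \<mu>. norm (h k x) \<le> (real (Suc k))\<^sup>2" using h0 by (simp add: power_divide)
  qed (rule h_meas)
  have lim: "(\<lambda>k. ennreal (h k x)) \<longlonglongrightarrow> inverse (ennreal ((x - l)\<^sup>2))" for x
  proof (cases "x = l")
    case True
    have "(\<lambda>k. ennreal ((real (Suc k))\<^sup>2)) \<longlonglongrightarrow> top"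
      unfolding ennreal_tendsto_top_eq_at_top by real_asymp
    then show ?thesis using True by (simp add: h_def power_divide)
  next
    case False
    have "(\<lambda>k. h k x) \<longlonglongrightarrow> 1 / ((x - l)\<^sup>2 + 0\<^sup>2)"
      unfolding h_def using False by (intro tendsto_intros) (real_asymp | simp)+
    then have "(\<lambda>k. ennreal (h k x)) \<longlonglongrightarrow> ennreal (1 / (x - l)\<^sup>2)" by (intro tendsto_ennrealI) simp
    then show ?thesis using False by (simp add: inverse_ennreal divide_inverse)
  qed
  have "inverse_square_moment \<mu> l = (\<integral>\<^sup>+x. liminf (\<lambda>k. ennreal (h k x)) \<partial>\<mu>)"
    unfolding inverse_square_moment_def
    by (intro nn_integral_cong lim_imp_Liminf[OF _ lim, symmetric]) simp
  also have "\<dots> \<le> liminf (\<lambda>k. \<integral>\<^sup>+x. ennreal (h k x) \<partial>\<mu>)"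
    by (rule nn_integral_liminf) (use h_meas in measurable)
  also have "\<dots> \<le> ennreal (B\<^sup>2)"
  proof (rule order_trans[OF Liminf_le_Limsup Limsup_bounded])
    have "(\<integral>\<^sup>+x. ennreal (h k x) \<partial>\<mu>) \<le> ennreal (B\<^sup>2)" for k
    proof -
      have "(\<integral>x. h k x \<partial>\<mu>) \<le> B\<^sup>2"
        unfolding h_def by (rule weak_range_resolvent_bound[OF sm _ assms(2) bound weak]) simp
      then show ?thesis using h_int h0 by (subst nn_integral_eq_integral) (auto intro: ennreal_leI)
    qed
    then show "\<forall>\<^sub>F k in sequentially. (\<integral>\<^sup>+x. ennreal (h k x) \<partial>\<mu>) \<le> ennreal (B\<^sup>2)" by simp
  qed auto
  finally show ?thesis .
qed

text \<open>The solution is \<open>g(H) f\<close> for \<open>g x = 1 / (x - l)\<close>, which is square integrable by assumption and dominates its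
  regularisations \<open>(x - l) / ((x - l)\<^sup>2 + 1 / k)\<close>; these are continuous and hence limits of polynomials.\<close>

lemma range_if_moment_finite:
  assumes sm: "spectral_measure f \<mu>" and fin: "inverse_square_moment \<mu> l < \<infinity>"
  shows "\<exists>u. H u - l *\<^sub>R u = f"
proof -
  interpret prob_space \<mu> by (rule spectral_measure_prob[OF sm])
  define g where "g x = 1 / (x - l)" for x :: real
  define gk where "gk k x = (x - l) / ((x - l)\<^sup>2 + 1 / real (Suc k))" for k x
  note meas = spectral_measure_measurable[OF sm]
  have sq_meas: "(\<lambda>x. inverse (ennreal ((x - l)\<^sup>2))) \<in> borel_measurable \<mu>"
    using spectral_measure_sets[OF sm] by (subst measurable_cong_sets[OF _ refl]) auto
  have "AE x in \<mu>. inverse (ennreal ((x - l)\<^sup>2)) \<noteq> \<infinity>"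
    using fin unfolding inverse_square_moment_def by (intro nn_integral_PInf_AE sq_meas) auto
  then have ne: "AE x in \<mu>. x \<noteq> l" by eventually_elim auto
  have int_g2: "integrable \<mu> (\<lambda>x. (g x)\<^sup>2)"
  proof (rule integrableI_bounded)
    show "(\<lambda>x. (g x)\<^sup>2) \<in> borel_measurable \<mu>" by (rule meas) (simp add: g_def)
    have "(\<integral>\<^sup>+x. ennreal (norm ((g x)\<^sup>2)) \<partial>\<mu>) = inverse_square_moment \<mu> l"
      unfolding inverse_square_moment_def
    proof (rule nn_integral_cong_AE)
      show "AE x in \<mu>. ennreal (norm ((g x)\<^sup>2)) = inverse (ennreal ((x - l)\<^sup>2))"
        using ne by eventually_elim (simp add: g_def inverse_ennreal power_divide divide_inverse power_inverse)
    qed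
    then show "(\<integral>\<^sup>+x. ennreal (norm ((g x)\<^sup>2)) \<partial>\<mu>) < \<infinity>" using fin by simp
  qed
  have pos: "(x - l)\<^sup>2 + 1 / real (Suc k) > 0" for x k by (simp add: add_nonneg_pos)
  have cont: "continuous_on S (gk k)" for S k
    unfolding gk_def using pos by (intro continuous_intros) (auto simp: less_le simp del: of_nat_Suc)
  have "\<exists>p. \<forall>x\<in>{-M..M}. \<bar>gk k x - poly p x\<bar> < 1 / real (Suc k)" for k
    by (rule Weierstrass_poly[OF cont]) auto
  then obtain p where p: "\<And>k x. x \<in> {-M..M} \<Longrightarrow> \<bar>gk k x - poly (p k) x\<bar> < 1 / real (Suc k)"
    by metis
  define b where "b x = \<bar>g x\<bar> + 1" for x
  show ?thesis
  proof (rule functional_calculus[OF sm, of g b p])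
    show "g \<in> borel_measurable borel" "b \<in> borel_measurable borel" unfolding b_def g_def by measurable
    show "integrable \<mu> (\<lambda>x. (b x)\<^sup>2)"
    proof (rule Bochner_Integration.integrable_bound[where f="\<lambda>x. 2 * (g x)\<^sup>2 + 2"])
      show "(\<lambda>x. (b x)\<^sup>2) \<in> borel_measurable \<mu>" by (rule meas) (simp add: b_def g_def)
      show "AE x in \<mu>. norm ((b x)\<^sup>2) \<le> norm (2 * (g x)\<^sup>2 + 2)"
      proof (rule AE_I2)
        fix x
        have "0 \<le> (\<bar>g x\<bar> - 1)\<^sup>2" by simp
        then have "(\<bar>g x\<bar> + 1)\<^sup>2 \<le> 2 * (g x)\<^sup>2 + 2" by (simp add: power2_eq_square algebra_simps)
        then show "norm ((b x)\<^sup>2) \<le> norm (2 * (g x)\<^sup>2 + 2)" by (simp add: b_def)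
      qed
    qed (use int_g2 in auto)
    show "AE x in \<mu>. (\<lambda>k. poly (p k) x) \<longlonglongrightarrow> g x"
      using spectral_measure_AE[OF sm] ne
    proof eventually_elim
      case (elim x)
      have "(\<lambda>k. poly (p k) x - gk k x) \<longlonglongrightarrow> 0"
      proof (rule Lim_null_comparison)
        have "norm (poly (p k) x - gk k x) \<le> 1 / real (Suc k)" for k
          using p[of x k] elim by (simp add: abs_le_iff abs_minus_commute less_imp_le)
        then show "\<forall>\<^sub>F k in sequentially. norm (poly (p k) x - gk k x) \<le> 1 / real (Suc k)" by simp
      qed real_asymp
      moreover have "(\<lambda>k. gk k x) \<longlonglongrightarrow> (x - l) / ((x - l)\<^sup>2 + 0)"
        unfolding gk_def using elim by (intro tendsto_intros) (real_asymp | simp)+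
      ultimately have "(\<lambda>k. (poly (p k) x - gk k x) + gk k x) \<longlonglongrightarrow> 0 + (x - l) / ((x - l)\<^sup>2 + 0)"
        by (rule tendsto_add)
      then show ?case using elim by (simp add: g_def power2_eq_square)
    qed
    show "AE x in \<mu>. \<bar>poly (p k) x\<bar> \<le> b x" for k
      using spectral_measure_AE[OF sm] ne
    proof eventually_elim
      case (elim x)
      have "\<bar>gk k x\<bar> = \<bar>x - l\<bar> / ((x - l)\<^sup>2 + 1 / real (Suc k))"
        using pos[of x k] by (simp add: gk_def)
      also have "\<dots> \<le> \<bar>x - l\<bar> / (x - l)\<^sup>2"
        using elim pos[of x k] by (intro divide_left_mono) (auto intro!: mult_pos_pos simp del: of_nat_Suc)
      also have "\<dots> = \<bar>x - l\<bar> / (\<bar>x - l\<bar> * \<bar>x - l\<bar>)" by (simp add: power2_eq_square)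
      also have "\<dots> = \<bar>g x\<bar>" using elim by (simp add: g_def del: abs_mult_self_eq)
      finally have "\<bar>gk k x\<bar> \<le> \<bar>g x\<bar>" .
      moreover have "1 / real (Suc k) \<le> 1" by simp
      moreover have "\<bar>gk k x - poly (p k) x\<bar> < 1 / real (Suc k)" using elim by (intro p) auto
      ultimately show ?case unfolding b_def by linarith
    qed
  next
    fix u assume u: "\<And>q r. AE x in \<mu>. poly q x * g x = poly r x \<Longrightarrow> opoly H q u = opoly H r f"
    have "opoly H [:-l, 1:] u = opoly H 1 f"
      by (rule u) (use ne in \<open>eventually_elim, simp add: g_def\<close>)
    then show ?thesis by auto
  qed
qed

lemma measure_le_Poisson:
  assumes sm: "spectral_measure f \<mu>" and "\<epsilon> > 0"
  shows "measure \<mu> {l-\<epsilon>..l+\<epsilon>} \<le> 2 * \<epsilon>\<^sup>2 * (\<integral>x. 1 / ((x - l)\<^sup>2 + \<epsilon>\<^sup>2) \<partial>\<mu>)"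
proof -
  interpret prob_space \<mu> by (rule spectral_measure_prob[OF sm])
  have set: "{l-\<epsilon>..l+\<epsilon>} \<in> sets \<mu>" using spectral_measure_sets[OF sm] by simp
  define h where "h x = 1 / ((x - l)\<^sup>2 + \<epsilon>\<^sup>2)" for x
  have pos: "(x - l)\<^sup>2 + \<epsilon>\<^sup>2 > 0" for x using assms by (simp add: add_nonneg_pos)
  have h_meas: "h \<in> borel_measurable \<mu>" by (rule spectral_measure_measurable[OF sm]) (simp add: h_def[abs_def])
  have h_int: "integrable \<mu> h"
  proof (rule integrable_const_bound[where B="1 / \<epsilon>\<^sup>2"])
    have "h x \<le> 1 / \<epsilon>\<^sup>2" for x
      unfolding h_def using assms by (intro divide_left_mono mult_pos_pos pos) auto
    then show "AE x in \<mu>. norm (h x) \<le> 1 / \<epsilon>\<^sup>2" by (simp add: h_def)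
  qed (rule h_meas)
  have "measure \<mu> {l-\<epsilon>..l+\<epsilon>} = (\<integral>x. indicator {l-\<epsilon>..l+\<epsilon>} x \<partial>\<mu>)" using set by simp
  also have "\<dots> \<le> (\<integral>x. 2 * \<epsilon>\<^sup>2 * h x \<partial>\<mu>)"
  proof (rule integral_mono)
    show "integrable \<mu> (indicat_real {l-\<epsilon>..l+\<epsilon>})" using set by (simp add: emeasure_eq_measure)
    fix x
    show "indicator {l-\<epsilon>..l+\<epsilon>} x \<le> 2 * \<epsilon>\<^sup>2 * h x"
    proof (cases "x \<in> {l-\<epsilon>..l+\<epsilon>}")
      case True
      then have "\<bar>x - l\<bar>\<^sup>2 \<le> \<epsilon>\<^sup>2" by (intro power_mono) auto
      then show ?thesis using True pos[of x] by (simp add: h_def divide_simps)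
    qed (use pos[of x] in \<open>auto simp: h_def\<close>)
  qed (use h_int in auto)
  also have "\<dots> = 2 * \<epsilon>\<^sup>2 * (\<integral>x. h x \<partial>\<mu>)" by simp
  finally show ?thesis by (simp add: h_def)
qed

lemma range_measure_bound:
  assumes sm: "spectral_measure f \<mu>" and "H u - l *\<^sub>R u = f" and "\<epsilon> > 0"
  shows "measure \<mu> {l-\<epsilon>..l+\<epsilon>} \<le> 2 * \<epsilon>\<^sup>2 * inner u u"
proof -
  have "(\<integral>x. 1 / ((x - l)\<^sup>2 + \<epsilon>\<^sup>2) \<partial>\<mu>) \<le> (norm u)\<^sup>2"
    by (rule weak_range_resolvent_bound[OF sm, where u="\<lambda>_. u"]) (use assms in auto)
  then have "2 * \<epsilon>\<^sup>2 * (\<integral>x. 1 / ((x - l)\<^sup>2 + \<epsilon>\<^sup>2) \<partial>\<mu>) \<le> 2 * \<epsilon>\<^sup>2 * inner u u"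
    by (intro mult_left_mono) (auto simp: power2_norm_eq_inner)
  with measure_le_Poisson[OF sm \<open>\<epsilon> > 0\<close>] show ?thesis by (rule order_trans)
qed

text \<open>Around an energy \<open>l\<close> with \<open>H u - l u = f\<close> and \<open>\<parallel>u\<parallel>\<^sup>2 \<le> n\<close> an interval of length \<open>\<epsilon>\<close> has mass \<open>O(n \<epsilon>\<^sup>2)\<close> by
  \<open>range_measure_bound\<close>.  As \<open>O(1 / \<epsilon>)\<close> intervals cover the window, these energies have measure \<open>O(n \<epsilon>)\<close>.\<close>

lemma AE_not_in_range:
  assumes sm: "spectral_measure f \<mu>"
  shows "AE x in \<mu>. \<not> (\<exists>u. H u - x *\<^sub>R u = f)"
proof -
  interpret prob_space \<mu> by (rule spectral_measure_prob[OF sm])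
  note sets = spectral_measure_sets[OF sm]
  define A where "A n = {x. \<bar>x\<bar> \<le> M \<and> (\<exists>u. H u - x *\<^sub>R u = f \<and> inner u u \<le> real n)}" for n
  obtain K where K: "real K \<ge> M" using real_arch_simple by blast
  have "AE x in \<mu>. x \<notin> A n" for n
  proof -
    \<comment> \<open>A grid of mesh \<open>1 / (m + 1)\<close>; \<open>G\<close> collects the cells in the window that meet \<open>A n\<close>.\<close>
    define I where "I m i = {of_int i / real (Suc m)..(of_int i + 1) / real (Suc m)}" for m and i :: int
    define G where "G m = {i. -(int K * int (Suc m)) \<le> i \<and> i \<le> int K * int (Suc m) \<and> I m i \<inter> A n \<noteq> {}}" for m
    define U where "U m = (\<Union>i\<in>G m. I m i)" for m
    have finG: "finite (G m)" for m
      by (rule finite_subset[of _ "{-(int K * int (Suc m))..int K * int (Suc m)}"]) (auto simp: G_def)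
    have cardG: "real (card (G m)) \<le> 2 * real K * real (Suc m) + 1" for m
    proof -
      have "card (G m) \<le> card {-(int K * int (Suc m))..int K * int (Suc m)}"
        by (rule card_mono) (auto simp: G_def)
      also have "\<dots> = nat (2 * int K * int (Suc m) + 1)" by simp
      also have "\<dots> = 2 * K * Suc m + 1" by (simp add: nat_eq_iff algebra_simps)
      finally have "real (card (G m)) \<le> real (2 * K * Suc m + 1)" by (rule of_nat_mono)
      then show ?thesis by (simp add: algebra_simps)
    qed
    have U_sets: "U m \<in> sets \<mu>" for m using finG sets by (auto simp: U_def I_def)
    have A_U: "A n \<subseteq> U m" for m
    proof
      fix x assume x: "x \<in> A n"
      define i where "i = \<lfloor>x * real (Suc m)\<rfloor>"
      have "x \<in> I m i"
        unfolding I_def i_def by (auto simp: divide_simps simp del: of_nat_Suc)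
      moreover have "i \<in> G m"
      proof -
        have "\<bar>x\<bar> \<le> real K" using x K by (auto simp: A_def)
        then have "\<bar>x * real (Suc m)\<bar> \<le> real K * real (Suc m)"
          unfolding abs_mult by (simp add: mult_right_mono del: of_nat_Suc)
        then have "- (real K * real (Suc m)) \<le> x * real (Suc m)" "x * real (Suc m) \<le> real K * real (Suc m)"
          by (auto simp: abs_le_iff)
        moreover have KS: "real K * real (Suc m) = of_int (int K * int (Suc m))" by simp
        ultimately have "-(int K * int (Suc m)) \<le> i" "i \<le> \<lfloor>of_int (int K * int (Suc m)) :: real\<rfloor>"
          unfolding i_def KS by (simp only: le_floor_iff of_int_minus, simp only: floor_mono)
        then have "-(int K * int (Suc m)) \<le> i" "i \<le> int K * int (Suc m)"
          by (simp_all only: floor_of_int)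
        then show ?thesis using \<open>x \<in> I m i\<close> x by (auto simp: G_def)
      qed
      ultimately show "x \<in> U m" by (auto simp: U_def)
    qed
    have U_meas: "measure \<mu> (U m) \<le> (2 * real K * real (Suc m) + 1) * (2 * (1 / real (Suc m))\<^sup>2 * real n)" for m
    proof -
      have "measure \<mu> (U m) \<le> (\<Sum>i\<in>G m. measure \<mu> (I m i))"
        unfolding U_def using finG sets by (intro finite_measure_subadditive_finite) (auto simp: I_def)
      also have "\<dots> \<le> (\<Sum>i\<in>G m. 2 * (1 / real (Suc m))\<^sup>2 * real n)"
      proof (rule sum_mono)
        fix i assume "i \<in> G m"
        then obtain l u where l: "l \<in> I m i" "H u - l *\<^sub>R u = f" "inner u u \<le> real n"
          by (auto simp: G_def A_def)
        have "I m i \<subseteq> {l - 1 / real (Suc m)..l + 1 / real (Suc m)}"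
          using l(1) by (auto simp: I_def add_divide_distrib simp del: of_nat_Suc)
        then have "measure \<mu> (I m i) \<le> measure \<mu> {l - 1 / real (Suc m)..l + 1 / real (Suc m)}"
          using sets by (intro finite_measure_mono) auto
        also have "\<dots> \<le> 2 * (1 / real (Suc m))\<^sup>2 * inner u u"
          by (rule range_measure_bound[OF sm l(2)]) simp
        also have "\<dots> \<le> 2 * (1 / real (Suc m))\<^sup>2 * real n"
          using l(3) by (intro mult_left_mono) auto
        finally show "measure \<mu> (I m i) \<le> 2 * (1 / real (Suc m))\<^sup>2 * real n" .
      qed
      also have "\<dots> = real (card (G m)) * (2 * (1 / real (Suc m))\<^sup>2 * real n)" by simp
      also have "\<dots> \<le> (2 * real K * real (Suc m) + 1) * (2 * (1 / real (Suc m))\<^sup>2 * real n)"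
        using cardG by (intro mult_right_mono) auto
      finally show ?thesis .
    qed
    define V where "V = (\<Inter>m. U m)"
    have V_sets: "V \<in> sets \<mu>" unfolding V_def using U_sets by auto
    have "measure \<mu> V \<le> 0"
    proof (rule LIMSEQ_le_const)
      show "(\<lambda>m. (2 * real K * real (Suc m) + 1) * (2 * (1 / real (Suc m))\<^sup>2 * real n)) \<longlonglongrightarrow> 0"
        by real_asymp
      show "\<exists>N. \<forall>m\<ge>N. measure \<mu> V \<le> (2 * real K * real (Suc m) + 1) * (2 * (1 / real (Suc m))\<^sup>2 * real n)"
        using U_meas finite_measure_mono[OF _ U_sets, of V] unfolding V_def by (meson INT_lower UNIV_I order_trans)
    qed
    then have "V \<in> null_sets \<mu>"
      using V_sets measure_nonneg[of \<mu> V] by (intro null_setsI) (auto simp: emeasure_eq_measure)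
    then have "AE x in \<mu>. x \<notin> V" by (rule AE_not_in)
    then show ?thesis by eventually_elim (use A_U in \<open>auto simp: V_def\<close>)
  qed
  then have "AE x in \<mu>. \<forall>n. x \<notin> A n" by (simp add: AE_all_countable)
  then show ?thesis using spectral_measure_AE[OF sm]
  proof eventually_elim
    case (elim x)
    show ?case
    proof
      assume "\<exists>u. H u - x *\<^sub>R u = f"
      then obtain u where u: "H u - x *\<^sub>R u = f" ..
      obtain n where "inner u u \<le> real n" using real_arch_simple by blast
      then have "x \<in> A n" using u elim(2) unfolding A_def by blast
      then show False using elim(1) by blast
    qed
  qed
qed

end

section \<open>Point spectrum\<close>

text \<open>By the parallelogram identity a sequence in \<open>W\<close> that minimises the distance to \<open>x\<close> is Cauchy.\<close>

lemma projection_exists: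
  fixes W :: "'h::{real_inner,banach} set"
  assumes "closed W" "subspace W"
  shows "\<exists>y\<in>W. \<forall>w\<in>W. inner (x - y) w = 0"
proof -
  define d where "d = Inf ((\<lambda>w. (norm (x - w))\<^sup>2) ` W)"
  have W0: "0 \<in> W" using assms(2) by (rule subspace_0)
  have bdd: "bdd_below ((\<lambda>w. (norm (x - w))\<^sup>2) ` W)" by (rule bdd_belowI2[of _ 0]) auto
  have d_le: "d \<le> (norm (x - w))\<^sup>2" if "w \<in> W" for w
    unfolding d_def using bdd that by (intro cInf_lower) auto
  have "\<exists>w\<in>W. (norm (x - w))\<^sup>2 < d + 1 / real (Suc n)" for n
    using cInf_less_iff[of "(\<lambda>w. (norm (x - w))\<^sup>2) ` W" "d + 1 / real (Suc n)"] W0 bdd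
    unfolding d_def[symmetric] by auto
  then obtain w where w: "\<And>n. w n \<in> W" "\<And>n. (norm (x - w n))\<^sup>2 < d + 1 / real (Suc n)" by metis
  have diff: "(norm (w n - w m))\<^sup>2 \<le> 2 / real (Suc n) + 2 / real (Suc m)" for n m
  proof -
    define z where "z = (1/2) *\<^sub>R (w n + w m)"
    have "z \<in> W" unfolding z_def using assms(2) w(1) by (intro subspace_mul subspace_add) auto
    have "(norm (w n - w m))\<^sup>2 = 2 * (norm (x - w n))\<^sup>2 + 2 * (norm (x - w m))\<^sup>2 - 4 * (norm (x - z))\<^sup>2"
      unfolding power2_norm_eq_inner z_def
      by (simp add: inner_diff_left inner_diff_right inner_add_left inner_add_right inner_commute field_simps)
    also have "\<dots> \<le> 2 * (d + 1 / real (Suc n)) + 2 * (d + 1 / real (Suc m)) - 4 * d"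
    proof -
      have "2 * A + 2 * B - 4 * C \<le> 2 * (d + p) + 2 * (d + q) - 4 * d"
        if "A < d + p" "B < d + q" "d \<le> C" for A B C p q :: real
        using that by argo
      from this[OF w(2)[of n] w(2)[of m] d_le[OF \<open>z \<in> W\<close>]] show ?thesis .
    qed
    finally show ?thesis by simp
  qed
  have "Cauchy w"
  proof (rule CauchyI)
    fix e :: real assume "e > 0"
    then obtain N where N: "4 / e\<^sup>2 < real N" using reals_Archimedean2 by blast
    show "\<exists>N. \<forall>m\<ge>N. \<forall>n\<ge>N. norm (w m - w n) < e"
    proof (intro exI allI impI)
      fix m n assume mn: "m \<ge> N" "n \<ge> N"
      have *: "2 / real (Suc k) < e\<^sup>2 / 2" if "k \<ge> N" for k
      proof -
        have "4 / e\<^sup>2 < real (Suc k)" using N that by linarith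
        then show ?thesis using \<open>e > 0\<close> by (simp add: divide_simps mult_ac)
      qed
      have "(norm (w m - w n))\<^sup>2 < e\<^sup>2" using diff[of m n] *[OF mn(1)] *[OF mn(2)] by linarith
      then show "norm (w m - w n) < e" using \<open>e > 0\<close> power2_less_imp_less by fastforce
    qed
  qed
  then obtain y where y: "w \<longlonglongrightarrow> y" using Cauchy_convergent_iff convergent_def by blast
  then have yW: "y \<in> W" using assms(1) w(1) closed_sequentially by blast
  have "(\<lambda>n. (norm (x - w n))\<^sup>2) \<longlonglongrightarrow> (norm (x - y))\<^sup>2" by (intro tendsto_intros y)
  moreover have "(\<lambda>n. d + 1 / real (Suc n)) \<longlonglongrightarrow> d" by real_asymp
  ultimately have dist: "(norm (x - y))\<^sup>2 \<le> d"
    using w(2) by (intro LIMSEQ_le) (auto intro: less_imp_le)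
  have "inner (x - y) v = 0" if "v \<in> W" for v
  proof (cases "v = 0")
    case False
    define t where "t = inner (x - y) v / inner v v"
    have vv: "inner v v > 0" using False by simp
    have "y + t *\<^sub>R v \<in> W" using assms(2) yW that by (intro subspace_add subspace_mul)
    then have "(norm (x - y))\<^sup>2 \<le> (norm (x - (y + t *\<^sub>R v)))\<^sup>2" using dist d_le by (blast intro: order_trans)
    also have "\<dots> = (norm (x - y))\<^sup>2 - 2 * t * inner (x - y) v + t\<^sup>2 * inner v v"
      unfolding power2_norm_eq_inner
      by (simp add: inner_diff_left inner_diff_right inner_add_left inner_add_right inner_commute power2_eq_square algebra_simps)
    also have "\<dots> = (norm (x - y))\<^sup>2 - (inner (x - y) v)\<^sup>2 / inner v v"
      using vv by (simp add: t_def power2_eq_square)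
    finally have "(inner (x - y) v)\<^sup>2 / inner v v \<le> 0" by linarith
    then show ?thesis using vv by (simp add: divide_le_0_iff)
  qed simp
  then show ?thesis using yW by blast
qed

lemma countable_support_atom:
  assumes "prob_space \<mu>" "sets \<mu> = sets (borel :: real measure)" "countable Z" "AE x in \<mu>. x \<in> Z"
  shows "\<exists>l\<in>Z. measure \<mu> {l} > 0"
proof (rule ccontr)
  interpret prob_space \<mu> by fact
  assume nex: "\<not> ?thesis"
  have "{l} \<in> null_sets \<mu>" if "l \<in> Z" for l
  proof -
    have "measure \<mu> {l} = 0" using that nex by (auto simp: zero_less_measure_iff measure_eq_0_null_sets)
    then show ?thesis using assms(2) by (intro null_setsI) (auto simp: emeasure_eq_measure)
  qed
  then have "(\<Union>l\<in>Z. {l}) \<in> null_sets \<mu>" by (intro null_sets_UN' assms(3))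
  then have "AE x in \<mu>. x \<notin> Z" by (auto dest: AE_not_in)
  then have "AE x in \<mu>. False" using assms(4) by eventually_elim auto
  then show False by simp
qed

lemma countable_support_finite_approx:
  assumes "prob_space \<mu>" "sets \<mu> = sets (borel :: real measure)" "countable Z" "AE x in \<mu>. x \<in> Z" "e > 0"
  shows "\<exists>F. finite F \<and> F \<subseteq> Z \<and> (\<Sum>l\<in>F. measure \<mu> {l}) > 1 - e"
proof -
  interpret prob_space \<mu> by fact
  have Zne: "Z \<noteq> {}"
  proof
    assume "Z = {}"
    then have "AE x in \<mu>. False" using assms(4) by simp
    then show False by simp
  qed
  define F where "F n = from_nat_into Z ` {..n}" for n
  have F: "finite (F n)" "F n \<subseteq> Z" for n using Zne by (auto simp: F_def intro: from_nat_into[OF Zne])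
  have UF: "(\<Union>n. F n) = Z"
    by (simp only: F_def image_UN[symmetric] UN_atMost_UNIV range_from_nat_into[OF Zne assms(3)])
  have setsF: "F n \<in> sets \<mu>" for n using F assms(2) by (simp add: finite_imp_closed borel_closed)
  have "(\<lambda>n. measure \<mu> (F n)) \<longlonglongrightarrow> measure \<mu> (\<Union>n. F n)"
    using setsF by (intro finite_Lim_measure_incseq) (auto simp: F_def incseq_def)
  moreover have "measure \<mu> (\<Union>n. F n) = 1"
  proof -
    have "(\<Union>n. F n) \<in> sets \<mu>" using setsF by (intro sets.countable_UN) auto
    moreover have "AE x in \<mu>. x \<in> (\<Union>n. F n)" using assms(4) by (simp only: UF)
    ultimately show ?thesis by (simp only: prob_eq_1)
  qed
  ultimately have "(\<lambda>n. measure \<mu> (F n)) \<longlonglongrightarrow> 1" by simp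
  then have "\<forall>\<^sub>F n in sequentially. measure \<mu> (F n) > 1 - e"
    by (rule order_tendstoD(1)) (use assms(5) in simp)
  then obtain n where "measure \<mu> (F n) > 1 - e" by (auto simp: eventually_sequentially)
  moreover have "measure \<mu> (F n) = (\<Sum>l\<in>F n. measure \<mu> {l})"
    using assms(2) F by (intro finite_measure_eq_sum_singleton) auto
  ultimately show ?thesis using F by metis
qed

context bounded_selfadjoint
begin

lemma eigenvectors_orthogonal:
  assumes "H \<phi> = l *\<^sub>R \<phi>" "H \<psi> = m *\<^sub>R \<psi>" "l \<noteq> m"
  shows "inner \<phi> \<psi> = 0"
  using sym[of \<phi> \<psi>] assms by simp

text \<open>The projections of \<open>f\<close> onto the eigenspaces of finitely many atoms of total mass more than \<open>1 - e\<^sup>2\<close> add up to a vector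
  at distance less than \<open>e\<close> from \<open>f\<close>.\<close>

lemma pure_point_vector_in_closure:
  assumes sm: "spectral_measure f \<mu>" and "norm f = 1" and Z: "countable Z" "AE x in \<mu>. x \<in> Z"
  shows "f \<in> closure (span {\<phi>. \<exists>l. H \<phi> = l *\<^sub>R \<phi>})"
  unfolding closure_approachable
proof (intro allI impI)
  fix e :: real assume "e > 0"
  then have "e\<^sup>2 > 0" by simp
  obtain F where F: "finite F" "(\<Sum>l\<in>F. measure \<mu> {l}) > 1 - e\<^sup>2"
    using countable_support_finite_approx[OF spectral_measure_prob[OF sm] spectral_measure_sets[OF sm] Z \<open>e\<^sup>2 > 0\<close>] by blast
  have "\<exists>\<phi>. H \<phi> = l *\<^sub>R \<phi> \<and> inner \<phi> f = measure \<mu> {l} \<and> inner \<phi> \<phi> = measure \<mu> {l}" for l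
    by (rule eigenprojection[OF sm, of l]) blast
  then obtain \<phi> where \<phi>: "\<And>l. H (\<phi> l) = l *\<^sub>R \<phi> l" "\<And>l. inner (\<phi> l) f = measure \<mu> {l}"
    "\<And>l. inner (\<phi> l) (\<phi> l) = measure \<mu> {l}" by metis
  define y where "y = (\<Sum>l\<in>F. \<phi> l)"
  have yf: "inner y f = (\<Sum>l\<in>F. measure \<mu> {l})" by (simp add: y_def inner_sum_left \<phi>)
  have "inner y y = (\<Sum>l\<in>F. \<Sum>m\<in>F. inner (\<phi> l) (\<phi> m))"
    unfolding y_def inner_sum_left inner_sum_right by (rule sum.swap)
  also have "\<dots> = (\<Sum>l\<in>F. \<Sum>m\<in>F. if m = l then measure \<mu> {l} else 0)"
    using eigenvectors_orthogonal[OF \<phi>(1) \<phi>(1)] by (intro sum.cong) (auto simp: \<phi>(3))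
  also have "\<dots> = (\<Sum>l\<in>F. measure \<mu> {l})" using F(1) by simp
  finally have yy: "inner y y = (\<Sum>l\<in>F. measure \<mu> {l})" .
  have "(dist y f)\<^sup>2 = inner y y - 2 * inner y f + inner f f"
    by (simp add: dist_norm power2_norm_eq_inner inner_diff_left inner_diff_right inner_commute)
  also have "inner f f = 1" using assms(2) by (simp add: dot_square_norm)
  also have "inner y y - 2 * inner y f + 1 < e\<^sup>2" using F(2) by (simp add: yy yf)
  finally have "dist y f < e" using \<open>e > 0\<close> power2_less_imp_less by fastforce
  moreover have "y \<in> span {\<phi>. \<exists>l. H \<phi> = l *\<^sub>R \<phi>}"
    unfolding y_def by (intro span_sum span_base) (use \<phi>(1) in auto)
  ultimately show "\<exists>y\<in>span {\<phi>. \<exists>l. H \<phi> = l *\<^sub>R \<phi>}. dist y f < e" by blast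
qed

text \<open>Unit eigenvectors of distinct eigenvalues are orthonormal, so by Bessel's inequality each \<open>d \<in> D\<close> has a nonzero inner
  product with only countably many of them.\<close>

lemma countable_eigenvalues:
  fixes D :: "'h set"
  assumes D: "countable D" "\<And>x. (\<And>d. d \<in> D \<Longrightarrow> inner x d = 0) \<Longrightarrow> x = 0"
  shows "countable {l. \<exists>\<phi>. \<phi> \<noteq> 0 \<and> H \<phi> = l *\<^sub>R \<phi>}"
proof -
  define Eg where "Eg = {l. \<exists>\<phi>. \<phi> \<noteq> 0 \<and> H \<phi> = l *\<^sub>R \<phi>}"
  have "\<exists>\<phi>. norm \<phi> = 1 \<and> H \<phi> = l *\<^sub>R \<phi>" if l: "l \<in> Eg" for l
  proof -
    obtain \<phi> where "\<phi> \<noteq> 0" "H \<phi> = l *\<^sub>R \<phi>" using l by (auto simp: Eg_def)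
    then show ?thesis
      by (intro exI[of _ "(1 / norm \<phi>) *\<^sub>R \<phi>"]) (auto simp: linear_cmul[OF linear_H])
  qed
  then obtain \<phi> where \<phi>: "\<And>l. l \<in> Eg \<Longrightarrow> norm (\<phi> l) = 1" "\<And>l. l \<in> Eg \<Longrightarrow> H (\<phi> l) = l *\<^sub>R \<phi> l" by metis
  have Bessel: "(\<Sum>l\<in>F. (inner (\<phi> l) d)\<^sup>2) \<le> inner d d" if F: "finite F" "F \<subseteq> Eg" for F d
  proof -
    define y where "y = (\<Sum>l\<in>F. inner (\<phi> l) d *\<^sub>R \<phi> l)"
    have yd: "inner y d = (\<Sum>l\<in>F. (inner (\<phi> l) d)\<^sup>2)" by (simp add: y_def inner_sum_left power2_eq_square)
    have "inner y y = (\<Sum>l\<in>F. \<Sum>m\<in>F. inner (\<phi> l) d * inner (\<phi> m) d * inner (\<phi> l) (\<phi> m))"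
      unfolding y_def inner_sum_left inner_sum_right inner_scaleR_left inner_scaleR_right sum_distrib_left
      by (intro sum.cong refl) (simp add: inner_commute mult.assoc)
    also have "\<dots> = (\<Sum>l\<in>F. \<Sum>m\<in>F. if m = l then (inner (\<phi> l) d)\<^sup>2 else 0)"
    proof (intro sum.cong refl)
      fix l m assume "l \<in> F" "m \<in> F"
      then have "l \<in> Eg" "m \<in> Eg" using F by auto
      then show "inner (\<phi> l) d * inner (\<phi> m) d * inner (\<phi> l) (\<phi> m) = (if m = l then (inner (\<phi> l) d)\<^sup>2 else 0)"
        using eigenvectors_orthogonal[OF \<phi>(2) \<phi>(2), of l m] \<phi>(1)[of l]
        by (auto simp: dot_square_norm power2_eq_square)
    qed
    also have "\<dots> = (\<Sum>l\<in>F. (inner (\<phi> l) d)\<^sup>2)" using F(1) by simp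
    finally have yy: "inner y y = inner y d" by (simp add: yd)
    have "0 \<le> inner (d - y) (d - y)" by simp
    also have "inner (d - y) (d - y) = inner d d - inner y d"
      using yy by (simp add: inner_diff_left inner_diff_right inner_commute[of d y])
    finally show ?thesis by (simp add: yd)
  qed
  have "finite {l\<in>Eg. (inner (\<phi> l) d)\<^sup>2 > 1 / real (Suc n)}" for d n
  proof (rule ccontr)
    assume inf: "\<not> ?thesis"
    obtain k where k: "inner d d * real (Suc n) < real k" using reals_Archimedean2 by blast
    obtain F where F: "F \<subseteq> {l\<in>Eg. (inner (\<phi> l) d)\<^sup>2 > 1 / real (Suc n)}" "finite F" "card F = k"
      using infinite_arbitrarily_large[OF inf] by blast
    have "real k * (1 / real (Suc n)) = (\<Sum>l\<in>F. 1 / real (Suc n))" using F(3) by simp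
    also have "\<dots> \<le> (\<Sum>l\<in>F. (inner (\<phi> l) d)\<^sup>2)" using F(1) by (intro sum_mono) (auto intro: less_imp_le)
    also have "\<dots> \<le> inner d d" using F by (intro Bessel) auto
    finally show False using k by (simp add: divide_simps mult_ac)
  qed
  then have "countable (\<Union>d\<in>D. \<Union>n. {l\<in>Eg. (inner (\<phi> l) d)\<^sup>2 > 1 / real (Suc n)})"
    using D(1) by (intro countable_UN) (auto intro: countable_finite)
  moreover have "Eg \<subseteq> (\<Union>d\<in>D. \<Union>n. {l\<in>Eg. (inner (\<phi> l) d)\<^sup>2 > 1 / real (Suc n)})"
  proof
    fix l assume l: "l \<in> Eg"
    then have "\<phi> l \<noteq> 0" using \<phi>(1)[of l] by auto
    then obtain d where d: "d \<in> D" "inner (\<phi> l) d \<noteq> 0" using D(2) by blast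
    then have "(inner (\<phi> l) d)\<^sup>2 > 0" by simp
    from nat_approx_posE[OF this] obtain n where n: "1 / real (Suc n) < (inner (\<phi> l) d)\<^sup>2" .
    show "l \<in> (\<Union>d\<in>D. \<Union>n. {l\<in>Eg. (inner (\<phi> l) d)\<^sup>2 > 1 / real (Suc n)})"
      by (rule UN_I[OF d(1)], rule UN_I[of n, OF UNIV_I]) (use l n in simp)
  qed
  ultimately show ?thesis unfolding Eg_def using countable_subset by blast
qed

end

section \<open>Rank-one perturbations\<close>

text \<open>Let \<open>\<zeta>\<^sub>t\<close> be the diagonal entry at \<open>f\<close> of the resolvent of \<open>H - t f \<langle>f, \<cdot>\<rangle>\<close> at the energy \<open>E + i \<eta>\<close>.  The second resolvent
  identity \<open>\<zeta>\<^sub>0 = \<zeta>\<^sub>t - t \<zeta>\<^sub>0 \<zeta>\<^sub>t\<close> yields \<open>1 / \<zeta>\<^sub>t = 1 / \<zeta>\<^sub>0 - t\<close>, hence the imaginary part of \<open>\<zeta>\<^sub>t\<close>, which is \<open>\<eta>\<close> times the Poisson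
  integral of the spectral measure, is a Cauchy density in \<open>t\<close> with parameters \<open>p - i q = 1 / \<zeta>\<^sub>0\<close>.\<close>

lemma rank_one_Poisson:
  fixes H :: "'h::{real_inner,banach} \<Rightarrow> 'h"
  assumes H: "bounded_selfadjoint H M" and f: "norm f = 1" and \<eta>: "\<eta> > 0"
  obtains p q where "q > 0"
    and "\<And>t Mt \<mu>. bounded_selfadjoint (\<lambda>x. H x - (t * inner f x) *\<^sub>R f) Mt \<Longrightarrow>
      bounded_selfadjoint.spectral_measure (\<lambda>x. H x - (t * inner f x) *\<^sub>R f) Mt f \<mu> \<Longrightarrow>
      (\<integral>x. 1 / ((x - E)\<^sup>2 + \<eta>\<^sup>2) \<partial>\<mu>) = (1 / \<eta>) * (q / ((p - t)\<^sup>2 + q\<^sup>2))"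
proof -
  interpret H: bounded_selfadjoint H M by (rule H)
  obtain \<mu>0 where \<mu>0: "H.spectral_measure f \<mu>0" using H.spectral_measure_exists[OF f] by blast
  obtain w where w: "opoly H [:E\<^sup>2 + \<eta>\<^sup>2, - 2 * E, 1:] w = f"
    using H.resolvent_square_exists[OF \<mu>0, of \<eta> E] \<eta> by blast
  \<comment> \<open>\<open>u1 + i u2\<close> is the resolvent vector \<open>(H - E - i \<eta>)\<^sup>-\<^sup>1 f\<close> and \<open>a + i b\<close> is \<open>\<zeta>\<^sub>0\<close>.\<close>
  define u1 u2 where "u1 = H w - E *\<^sub>R w" and "u2 = \<eta> *\<^sub>R w"
  have u: "H u1 - E *\<^sub>R u1 + \<eta> *\<^sub>R u2 = f" "H u2 - E *\<^sub>R u2 = \<eta> *\<^sub>R u1"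
    using w scaleR_left_distrib[of E E "H w"] by (simp_all add: u1_def u2_def linear_add[OF H.linear_H] linear_diff[OF H.linear_H]
        linear_cmul[OF H.linear_H] power2_eq_square algebra_simps)
  define a b where "a = inner f u1" and "b = inner f u2"
  have b_pos: "b > 0"
  proof -
    have "b = inner (H u1 - E *\<^sub>R u1) u2 + \<eta> * inner u2 u2" unfolding b_def using u(1)
      by (metis inner_add_left inner_scaleR_left)
    also have "inner (H u1 - E *\<^sub>R u1) u2 = inner u1 (H u2 - E *\<^sub>R u2)"
      by (simp add: inner_diff_left inner_diff_right H.sym)
    also have "\<dots> = \<eta> * inner u1 u1" by (simp add: u(2))
    finally have b: "b = \<eta> * (inner u1 u1 + inner u2 u2)" by (simp add: algebra_simps)
    have "u1 \<noteq> 0 \<or> u2 \<noteq> 0" using u(1) f by auto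
    then have "inner u1 u1 + inner u2 u2 > 0"
      by (metis add_nonneg_pos add_pos_nonneg inner_ge_zero inner_gt_zero_iff)
    then show ?thesis using \<eta> unfolding b by simp
  qed
  define N where "N = a\<^sup>2 + b\<^sup>2"
  have N_pos: "N > 0" using b_pos by (simp add: N_def add_nonneg_pos)
  show ?thesis
  proof (rule that[of "b / N" "a / N"])
    show "b / N > 0" using b_pos N_pos by simp
  next
    fix t Mt \<mu>
    assume bs: "bounded_selfadjoint (\<lambda>x. H x - (t * inner f x) *\<^sub>R f) Mt"
      and sm: "bounded_selfadjoint.spectral_measure (\<lambda>x. H x - (t * inner f x) *\<^sub>R f) Mt f \<mu>"
    define Ht where "Ht = (\<lambda>x. H x - (t * inner f x) *\<^sub>R f)"
    interpret Ht: bounded_selfadjoint Ht Mt unfolding Ht_def by (rule bs)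
    obtain v where v: "opoly Ht [:E\<^sup>2 + \<eta>\<^sup>2, - 2 * E, 1:] v = f"
      and vf: "inner v f = (\<integral>x. 1 / ((x - E)\<^sup>2 + \<eta>\<^sup>2) \<partial>\<mu>)"
      using Ht.resolvent_square_exists[of f \<mu> \<eta> E] sm \<eta> unfolding Ht_def[symmetric] by blast
    \<comment> \<open>The same for the coupling \<open>t\<close>: \<open>a' + i b'\<close> is \<open>\<zeta>\<^sub>t\<close>.\<close>
    define v1 v2 where "v1 = Ht v - E *\<^sub>R v" and "v2 = \<eta> *\<^sub>R v"
    have vv: "Ht v1 - E *\<^sub>R v1 + \<eta> *\<^sub>R v2 = f" "Ht v2 - E *\<^sub>R v2 = \<eta> *\<^sub>R v1"
      using v scaleR_left_distrib[of E E "Ht v"] by (simp_all add: v1_def v2_def linear_add[OF Ht.linear_H] linear_diff[OF Ht.linear_H]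
          linear_cmul[OF Ht.linear_H] power2_eq_square algebra_simps)
    define a' b' where "a' = inner f v1" and "b' = inner f v2"
    have Ht_inner: "inner x (Ht y) = inner (H x) y - t * inner f x * inner f y" for x y
      unfolding Ht_def inner_diff_right inner_scaleR_right by (simp add: H.sym inner_commute[of x f])
    have Hu1: "H u1 = f - \<eta> *\<^sub>R u2 + E *\<^sub>R u1" and Hu2: "H u2 = \<eta> *\<^sub>R u1 + E *\<^sub>R u2"
      using u by (auto simp: algebra_simps)
    have Hv1: "Ht v1 = f - \<eta> *\<^sub>R v2 + E *\<^sub>R v1" and Hv2: "Ht v2 = \<eta> *\<^sub>R v1 + E *\<^sub>R v2"
      using vv by (auto simp: algebra_simps)
    have e11: "inner u1 (Ht v1) = inner (H u1) v1 - t * a * a'"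
      and e12: "inner u1 (Ht v2) = inner (H u1) v2 - t * a * b'"
      and e21: "inner u2 (Ht v1) = inner (H u2) v1 - t * b * a'"
      and e22: "inner u2 (Ht v2) = inner (H u2) v2 - t * b * b'"
      unfolding Ht_inner a_def b_def a'_def b'_def by auto
    have Re: "a = a' - t * (a * a' - b * b')"
      using e11 e22 unfolding Hu1 Hu2 Hv1 Hv2
      by (simp add: inner_add_left inner_add_right inner_diff_left inner_diff_right a_def[symmetric] b_def[symmetric]
          a'_def[symmetric] b'_def[symmetric] inner_commute[of _ f] algebra_simps)
    have Im: "b = b' - t * (a * b' + b * a')"
      using e12 e21 unfolding Hu1 Hu2 Hv1 Hv2
      by (simp add: inner_add_left inner_add_right inner_diff_left inner_diff_right a_def[symmetric] b_def[symmetric]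
          a'_def[symmetric] b'_def[symmetric] inner_commute[of _ f] algebra_simps)
    have den: "(1 - t * a)\<^sup>2 + (t * b)\<^sup>2 > 0"
    proof (cases "t = 0")
      case False then show ?thesis using b_pos by (simp add: add_nonneg_pos)
    qed simp
    have "b' * ((1 - t * a)\<^sup>2 + (t * b)\<^sup>2) = b"
    proof -
      have 1: "(1 - t * a) * a' + t * b * b' = a" using Re by (simp add: algebra_simps)
      have 2: "(1 - t * a) * b' - t * b * a' = b" using Im by (simp add: algebra_simps)
      have "b' * ((1 - t * a)\<^sup>2 + (t * b)\<^sup>2)
        = (1 - t * a) * ((1 - t * a) * b' - t * b * a') + t * b * ((1 - t * a) * a' + t * b * b')"
        by (simp add: power2_eq_square algebra_simps)
      also have "\<dots> = b" unfolding 1 2 by (simp add: algebra_simps)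
      finally show ?thesis .
    qed
    then have b': "b' = b / ((1 - t * a)\<^sup>2 + (t * b)\<^sup>2)" using den by (simp add: field_simps)
    have "(a / N - t)\<^sup>2 + (b / N)\<^sup>2 = ((1 - t * a)\<^sup>2 + (t * b)\<^sup>2) / N"
    proof -
      have "(a / N - t)\<^sup>2 + (b / N)\<^sup>2 = ((a - t * N)\<^sup>2 + b\<^sup>2) / N\<^sup>2"
        using N_pos by (simp add: diff_divide_distrib power_divide add_divide_distrib[symmetric])
          (simp add: field_simps power2_eq_square)
      also have "(a - t * N)\<^sup>2 + b\<^sup>2 = N * ((1 - t * a)\<^sup>2 + (t * b)\<^sup>2)"
        unfolding N_def by (simp add: power2_eq_square algebra_simps)
      finally show ?thesis using N_pos by (simp add: power2_eq_square)
    qed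
    moreover have "(b / N) / (X / N) = b / X" for X using N_pos by simp
    ultimately have "(b / N) / ((a / N - t)\<^sup>2 + (b / N)\<^sup>2) = b'" by (simp only: b')
    moreover have "b' = \<eta> * (\<integral>x. 1 / ((x - E)\<^sup>2 + \<eta>\<^sup>2) \<partial>\<mu>)"
      unfolding b'_def v2_def vf[symmetric] by (simp add: inner_commute)
    ultimately show "(\<integral>x. 1 / ((x - E)\<^sup>2 + \<eta>\<^sup>2) \<partial>\<mu>) = (1 / \<eta>) * ((b / N) / ((a / N - t)\<^sup>2 + (b / N)\<^sup>2))"
      using \<eta> by simp
  qed
qed

lemma nn_integral_Cauchy_density:
  assumes "q > 0"
  shows "(\<integral>\<^sup>+t. ennreal (q / ((p - t)\<^sup>2 + q\<^sup>2)) \<partial>lborel) = ennreal pi"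
proof -
  have 1: "(\<integral>\<^sup>+x. ennreal (inverse (1 + x\<^sup>2)) \<partial>lborel) = ennreal pi"
  proof -
    have "integrable lborel (\<lambda>x::real. inverse (1 + x\<^sup>2))"
      using integrable_inverse_1_plus_square by (simp add: set_integrable_def)
    moreover have "(\<integral>x. inverse (1 + x\<^sup>2) \<partial>lborel) = pi"
      using LBINT_inverse_1_plus_square by (simp add: interval_lebesgue_integral_def set_lebesgue_integral_def)
    ultimately show ?thesis by (subst nn_integral_eq_integral) (auto simp: add_nonneg_nonneg)
  qed
  have "(\<integral>\<^sup>+t. ennreal (q / ((p - t)\<^sup>2 + q\<^sup>2)) \<partial>lborel)
      = \<bar>q\<bar> * (\<integral>\<^sup>+x. ennreal (q / ((p - (p + q * x))\<^sup>2 + q\<^sup>2)) \<partial>lborel)"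
    using assms by (intro nn_integral_real_affine) auto
  also have "\<dots> = (\<integral>\<^sup>+x. ennreal q * ennreal (q / ((q * x)\<^sup>2 + q\<^sup>2)) \<partial>lborel)"
    using assms by (simp add: nn_integral_cmult)
  also have "\<dots> = (\<integral>\<^sup>+x. ennreal (inverse (1 + x\<^sup>2)) \<partial>lborel)"
  proof (rule nn_integral_cong)
    fix x :: real
    have "(q * x)\<^sup>2 + q\<^sup>2 = q\<^sup>2 * (1 + x\<^sup>2)" by (simp add: power2_eq_square algebra_simps)
    moreover have "1 + x\<^sup>2 > 0" by (simp add: add_pos_nonneg)
    ultimately have "q * (q / ((q * x)\<^sup>2 + q\<^sup>2)) = inverse (1 + x\<^sup>2)"
      using assms by (simp add: power2_eq_square divide_simps)
    then show "ennreal q * ennreal (q / ((q * x)\<^sup>2 + q\<^sup>2)) = ennreal (inverse (1 + x\<^sup>2))"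
      using assms by (simp add: ennreal_mult[symmetric])
  qed
  finally show ?thesis using 1 by simp
qed

text \<open>A bounded part of the null set is covered by countably many intervals with disjoint interiors, all inside an open set of
  small Lebesgue measure; the bound transfers the smallness to \<open>\<nu>\<close>.\<close>

lemma null_set_if_interval_bound:
  fixes \<nu> :: "real measure"
  assumes sets: "sets \<nu> = sets borel"
    and bound: "\<And>E \<eta>. \<eta> > 0 \<Longrightarrow> emeasure \<nu> {E - \<eta>..E + \<eta>} \<le> ennreal (c * (2 * \<eta>))"
    and c: "c \<ge> 0" and S: "S \<in> null_sets lborel"
  shows "S \<in> null_sets \<nu>"
proof -
  have S_borel: "S \<in> sets borel" using S by auto
  have "S \<inter> {-real n..real n} \<in> null_sets \<nu>" for n
  proof (cases "n = 0")
    case True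
    have "emeasure \<nu> {0} \<le> 0"
    proof (rule ennreal_le_epsilon)
      fix e :: real assume "e > 0"
      define \<eta> where "\<eta> = e / (2 * (c + 1))"
      have "\<eta> > 0" using \<open>e > 0\<close> c by (simp add: \<eta>_def)
      have "emeasure \<nu> {0} \<le> emeasure \<nu> {0 - \<eta>..0 + \<eta>}"
        using \<open>\<eta> > 0\<close> sets by (intro emeasure_mono) auto
      also have "\<dots> \<le> ennreal (c * (2 * \<eta>))" by (rule bound[OF \<open>\<eta> > 0\<close>])
      also have "\<dots> \<le> ennreal e" using \<open>e > 0\<close> c by (intro ennreal_leI) (simp add: \<eta>_def field_simps)
      finally show "emeasure \<nu> {0} \<le> 0 + ennreal e" by simp
    qed
    then have "{0} \<in> null_sets \<nu>" using sets by (intro null_setsI) auto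
    then show ?thesis by (rule null_sets_subset) (use True sets S_borel in auto)
  next
    case False
    define T where "T = S \<inter> {-real n..real n}"
    have T: "T \<in> sets borel" "T \<in> null_sets lborel" "T \<subseteq> cbox (-real n) (real n)"
      using S S_borel unfolding T_def by (auto intro: null_set_Int2)
    have "emeasure \<nu> T \<le> 0"
    proof (rule ennreal_le_epsilon)
      fix e :: real assume "e > 0"
      have e': "e / (c + 1) > 0" using \<open>e > 0\<close> c by simp
      obtain U where U: "open U" "T \<subseteq> U" "emeasure lborel (U - T) < e / (c + 1)"
        by (rule outer_regular_lborel[OF T(1) e'])
      have "emeasure lborel U \<le> emeasure lborel (U - T) + emeasure lborel T"
        using U T by (intro order_trans[OF _ emeasure_subadditive] emeasure_mono) auto
      then have U_small: "emeasure lborel U \<le> e / (c + 1)" using U(3) T(2) by (auto simp: null_sets_def)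
      have g: "gauge (\<lambda>x. if x \<in> U then U else UNIV)" using U(1) by (auto simp: gauge_def)
      have box: "box (-real n) (real n) \<noteq> {}" using False by simp
      have "\<exists>\<D>. countable \<D> \<and> (\<forall>K\<in>\<D>. interior K \<noteq> {} \<and> (\<exists>c d. K = cbox c d)) \<and>
        pairwise (\<lambda>A B. interior A \<inter> interior B = {}) \<D> \<and>
        (\<forall>K\<in>\<D>. \<exists>x\<in>T \<inter> K. K \<subseteq> (if x \<in> U then U else UNIV)) \<and> T \<subseteq> \<Union>\<D>"
      proof (rule covering_lemma[OF T(3) box g])
        fix \<D> :: "real set set"
        assume "countable \<D>" "\<And>K. K \<in> \<D> \<Longrightarrow> interior K \<noteq> {} \<and> (\<exists>c d. K = cbox c d)"
          "pairwise (\<lambda>A B. interior A \<inter> interior B = {}) \<D>"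
          "\<And>K. K \<in> \<D> \<Longrightarrow> \<exists>x\<in>T \<inter> K. K \<subseteq> (if x \<in> U then U else UNIV)" "T \<subseteq> \<Union>\<D>"
        then show ?thesis by (intro exI[of _ \<D>] conjI ballI) blast+
      qed
      then obtain \<D> where \<D>: "countable \<D>" "\<And>K. K \<in> \<D> \<Longrightarrow> interior K \<noteq> {} \<and> (\<exists>c d. K = cbox c d)"
        "pairwise (\<lambda>A B. interior A \<inter> interior B = {}) \<D>"
        "\<And>K. K \<in> \<D> \<Longrightarrow> \<exists>x\<in>T \<inter> K. K \<subseteq> (if x \<in> U then U else UNIV)" "T \<subseteq> \<Union>\<D>"
        by (elim exE conjE) (rule that, auto)
      have \<D>_sets: "K \<in> sets borel" if "K \<in> \<D>" for K using \<D>(2)[OF that] by auto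
      have int_sets: "interior K \<in> sets borel" for K :: "real set" by (simp add: borel_open)
      have K_bound: "emeasure \<nu> K \<le> ennreal c * emeasure lborel (interior K)" if KD: "K \<in> \<D>" for K
      proof -
        obtain u v where K: "K = {u..v}" using \<D>(2)[OF KD] by auto
        have "interior K = {u<..<v}" by (simp add: K)
        then have "u < v" using \<D>(2)[OF KD] by auto
        have "emeasure \<nu> K = emeasure \<nu> {(u + v) / 2 - (v - u) / 2..(u + v) / 2 + (v - u) / 2}"
          by (simp add: K field_simps)
        also have "\<dots> \<le> ennreal (c * (2 * ((v - u) / 2)))" using \<open>u < v\<close> by (intro bound) simp
        also have "2 * ((v - u) / 2) = v - u" by simp
        also have "ennreal (c * (v - u)) = ennreal c * emeasure lborel (interior K)"
          using \<open>u < v\<close> c by (simp add: K ennreal_mult)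
        finally show ?thesis .
      qed
      define A where "A n = (if n \<in> to_nat_on \<D> ` \<D> then from_nat_into \<D> n else {})" for n
      have A: "A n = {} \<or> A n \<in> \<D>" for n
        using \<D>(1) by (auto simp: A_def)
      have A_sets: "A n \<in> sets borel" for n using A[of n] \<D>_sets by auto
      have UA: "\<Union>\<D> = (\<Union>n. A n)"
      proof
        show "\<Union>\<D> \<subseteq> (\<Union>n. A n)"
        proof
          fix z assume "z \<in> \<Union>\<D>"
          then obtain K where "K \<in> \<D>" "z \<in> K" by blast
          then have "z \<in> A (to_nat_on \<D> K)" using \<D>(1) by (simp add: A_def)
          then show "z \<in> (\<Union>n. A n)" by blast
        qed
        show "(\<Union>n. A n) \<subseteq> \<Union>\<D>" using A by blast
      qed
      have disj: "disjoint_family (\<lambda>n. interior (A n))"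
        unfolding disjoint_family_on_def
      proof (intro ballI impI)
        fix m n :: nat assume "m \<noteq> n"
        show "interior (A m) \<inter> interior (A n) = {}"
        proof (cases "m \<in> to_nat_on \<D> ` \<D> \<and> n \<in> to_nat_on \<D> ` \<D>")
          case True
          then obtain K L where KL: "K \<in> \<D>" "L \<in> \<D>" "m = to_nat_on \<D> K" "n = to_nat_on \<D> L" by blast
          then have "A m = K" "A n = L" "K \<noteq> L" using \<D>(1) \<open>m \<noteq> n\<close> by (auto simp: A_def)
          then show ?thesis using \<D>(3) KL by (simp add: pairwise_def)
        qed (auto simp: A_def)
      qed
      have "emeasure \<nu> T \<le> emeasure \<nu> (\<Union>n. A n)"
        using \<D>(5) A_sets sets unfolding UA by (intro emeasure_mono) auto
      also have "\<dots> \<le> (\<Sum>n. emeasure \<nu> (A n))"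
        using A_sets sets by (intro emeasure_subadditive_countably) auto
      also have "\<dots> \<le> (\<Sum>n. ennreal c * emeasure lborel (interior (A n)))"
      proof (intro suminf_le)
        show "emeasure \<nu> (A n) \<le> ennreal c * emeasure lborel (interior (A n))" for n
          using A[of n] K_bound by auto
      qed auto
      also have "\<dots> = ennreal c * (\<Sum>n. emeasure lborel (interior (A n)))"
        by (rule ennreal_suminf_cmult)
      also have "(\<Sum>n. emeasure lborel (interior (A n))) = emeasure lborel (\<Union>n. interior (A n))"
        by (rule suminf_emeasure) (use disj in auto)
      also have "\<dots> \<le> emeasure lborel U"
      proof (rule emeasure_mono)
        show "(\<Union>n. interior (A n)) \<subseteq> U"
        proof
          fix z assume "z \<in> (\<Union>n. interior (A n))"
          then obtain n where "z \<in> interior (A n)" by blast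
          then have "z \<in> A n" using interior_subset by blast
          then obtain K where "K \<in> \<D>" "z \<in> K" using A[of n] by auto
          moreover from \<open>K \<in> \<D>\<close> obtain x where "x \<in> T" "K \<subseteq> (if x \<in> U then U else UNIV)" using \<D>(4) by blast
          moreover have "x \<in> U" using \<open>x \<in> T\<close> U(2) by (rule subsetD[rotated])
          ultimately show "z \<in> U" by (simp only: if_True) (erule subsetD)
        qed
      qed (use U(1) in simp)
      also have "ennreal c * emeasure lborel U \<le> ennreal c * ennreal (e / (c + 1))"
        using U_small by (intro mult_left_mono) auto
      also have "\<dots> \<le> ennreal e"
        using \<open>e > 0\<close> c by (simp add: ennreal_mult[symmetric] field_simps)
      finally show "emeasure \<nu> T \<le> 0 + ennreal e" by (simp add: mult_left_mono)
    qed
    then show ?thesis using T(1) sets unfolding T_def[symmetric] by (intro null_setsI) auto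
  qed
  then have "(\<Union>n. S \<inter> {-real n..real n}) \<in> null_sets \<nu>" by (rule null_sets_UN)
  moreover have "(\<Union>n. S \<inter> {-real n..real n}) = S"
  proof -
    have "\<exists>n. x \<in> {-real n..real n}" for x :: real
    proof -
      obtain n where "\<bar>x\<bar> \<le> real n" using real_arch_simple by blast
      then show ?thesis by (intro exI[of _ n]) auto
    qed
    then show ?thesis by blast
  qed
  ultimately show ?thesis by simp
qed

section \<open>Measurable families of measures\<close>

text \<open>Integrals of continuous functions are limits of integrals of polynomials by Weierstrass approximation on the window, and
  masses of half-lines, which generate the Borel sets, are limits of integrals of continuous functions.\<close>

lemma measurable_kernel_if_poly_moments:
  fixes \<kappa> :: "'w \<Rightarrow> real measure"
  assumes prob: "\<And>w. w \<in> space N \<Longrightarrow> prob_space (\<kappa> w)"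
    and sets: "\<And>w. w \<in> space N \<Longrightarrow> sets (\<kappa> w) = sets borel"
    and window: "\<And>w. w \<in> space N \<Longrightarrow> AE x in \<kappa> w. \<bar>x\<bar> \<le> M"
    and poly: "\<And>p. (\<lambda>w. \<integral>x. poly p x \<partial>\<kappa> w) \<in> borel_measurable N"
  shows "\<kappa> \<in> measurable N (prob_algebra borel)"
proof (rule measurable_prob_algebra_generated[where G="range (\<lambda>a::real. {..a})" and \<Omega>=UNIV])
  show "sets borel = sigma_sets UNIV (range (\<lambda>a::real. {..a}))"
    by (subst borel_eq_atMost) auto
  show "Int_stable (range (\<lambda>a::real. {..a}))"
    by (auto simp: Int_stable_def)
  show "range (\<lambda>a::real. {..a}) \<subseteq> Pow UNIV" by simp
  fix A assume "A \<in> range (\<lambda>a::real. {..a})"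
  then obtain a where A: "A = {..a}" by auto
  have meas: "g \<in> borel_measurable (\<kappa> w)" if "w \<in> space N" "continuous_on UNIV g" for w and g :: "real \<Rightarrow> real"
    using borel_measurable_continuous_onI[OF that(2)] measurable_cong_sets[OF sets[OF that(1)] refl, of borel] by auto
  have cont: "(\<lambda>w. \<integral>x. g x \<partial>\<kappa> w) \<in> borel_measurable N" if g: "continuous_on UNIV g" for g :: "real \<Rightarrow> real"
  proof -
    have "\<exists>p. \<forall>x\<in>{-M..M}. \<bar>g x - poly p x\<bar> < 1 / real (Suc k)" for k
      by (rule Weierstrass_poly[OF continuous_on_subset[OF g]]) auto
    then obtain p where p: "\<And>k x. x \<in> {-M..M} \<Longrightarrow> \<bar>g x - poly (p k) x\<bar> < 1 / real (Suc k)" by metis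
    have "bounded (g ` {-M..M})"
      by (intro compact_imp_bounded compact_continuous_image continuous_on_subset[OF g]) auto
    then obtain B where B: "\<And>x. x \<in> {-M..M} \<Longrightarrow> \<bar>g x\<bar> \<le> B" unfolding bounded_iff real_norm_def by blast
    show ?thesis
    proof (rule borel_measurable_LIMSEQ_real)
      show "(\<lambda>w. \<integral>x. poly (p k) x \<partial>\<kappa> w) \<in> borel_measurable N" for k by (rule poly)
      fix w assume w: "w \<in> space N"
      interpret prob_space "\<kappa> w" by (rule prob[OF w])
      show "(\<lambda>k. \<integral>x. poly (p k) x \<partial>\<kappa> w) \<longlonglongrightarrow> (\<integral>x. g x \<partial>\<kappa> w)"
      proof (rule integral_dominated_convergence[where w="\<lambda>_. B + 1"])
        show "AE x in \<kappa> w. (\<lambda>k. poly (p k) x) \<longlonglongrightarrow> g x"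
          using window[OF w]
        proof eventually_elim
          case (elim x)
          have "(\<lambda>k. poly (p k) x - g x) \<longlonglongrightarrow> 0"
          proof (rule Lim_null_comparison)
            have "norm (poly (p k) x - g x) \<le> 1 / real (Suc k)" for k
              using p[of x k] elim by (simp add: abs_le_iff abs_minus_commute less_imp_le)
            then show "\<forall>\<^sub>F k in sequentially. norm (poly (p k) x - g x) \<le> 1 / real (Suc k)" by simp
          qed real_asymp
          then show ?case by (simp add: LIM_zero_iff)
        qed
        show "AE x in \<kappa> w. norm (poly (p k) x) \<le> B + 1" for k
          using window[OF w]
        proof eventually_elim
          case (elim x)
          have "1 / real (Suc k) \<le> 1" by simp
          moreover have "\<bar>g x - poly (p k) x\<bar> < 1 / real (Suc k)" using elim by (intro p) auto
          moreover have "\<bar>g x\<bar> \<le> B" using elim by (intro B) auto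
          ultimately show ?case unfolding real_norm_def by linarith
        qed
      qed (auto intro!: meas w g continuous_intros)
    qed
  qed
  \<comment> \<open>Piecewise linear functions that decrease to the indicator function of the half-line.\<close>
  define \<phi> where "\<phi> k x = max 0 (min 1 (1 + real k * (a - x)))" for k x
  have \<phi>_cont: "continuous_on UNIV (\<phi> k)" for k unfolding \<phi>_def by (intro continuous_intros)
  have "(\<lambda>w. measure (\<kappa> w) A) \<in> borel_measurable N"
  proof (rule borel_measurable_LIMSEQ_real)
    show "(\<lambda>w. \<integral>x. \<phi> k x \<partial>\<kappa> w) \<in> borel_measurable N" for k by (rule cont[OF \<phi>_cont])
    fix w assume w: "w \<in> space N"
    interpret prob_space "\<kappa> w" by (rule prob[OF w])
    have "(\<lambda>k. \<integral>x. \<phi> k x \<partial>\<kappa> w) \<longlonglongrightarrow> (\<integral>x. indicator A x \<partial>\<kappa> w)"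
    proof (rule integral_dominated_convergence[where w="\<lambda>_. 1"])
      show "AE x in \<kappa> w. (\<lambda>k. \<phi> k x) \<longlonglongrightarrow> indicator A x"
      proof (rule AE_I2)
        fix x
        show "(\<lambda>k. \<phi> k x) \<longlonglongrightarrow> indicator A x"
        proof (cases "x \<le> a")
          case True
          then show ?thesis by (simp add: \<phi>_def A min_def)
        next
          case False
          obtain K where K: "1 / (x - a) < real K" using reals_Archimedean2 by blast
          have "\<phi> k x = 0" if "k \<ge> K" for k
          proof -
            have "1 / (x - a) < real k" using K that by linarith
            then have "1 < real k * (x - a)" using False by (simp add: divide_simps)
            then show ?thesis by (simp add: \<phi>_def algebra_simps)
          qed
          then have "\<forall>\<^sub>F k in sequentially. \<phi> k x = 0" by (auto simp: eventually_sequentially)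
          then show ?thesis using False by (simp add: A tendsto_eventually)
        qed
      qed
      show "indicat_real A \<in> borel_measurable (\<kappa> w)" using sets[OF w] by (simp add: A)
      show "\<phi> k \<in> borel_measurable (\<kappa> w)" for k by (rule meas[OF w \<phi>_cont])
      show "AE x in \<kappa> w. norm (\<phi> k x) \<le> 1" for k by (simp add: \<phi>_def)
    qed auto
    then show "(\<lambda>k. \<integral>x. \<phi> k x \<partial>\<kappa> w) \<longlonglongrightarrow> measure (\<kappa> w) A"
      using sets[OF w] by (simp add: A)
  qed
  then have "(\<lambda>w. ennreal (measure (\<kappa> w) A)) \<in> borel_measurable N" by simp
  also have "?this \<longleftrightarrow> (\<lambda>w. emeasure (\<kappa> w) A) \<in> borel_measurable N"
    using prob by (intro measurable_cong) (simp add: finite_measure.emeasure_eq_measure prob_space.finite_measure)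
  finally show "(\<lambda>w. emeasure (\<kappa> w) A) \<in> borel_measurable N" .
qed (use prob sets in auto)

section \<open>The Hilbert space of square summable functions\<close>

text \<open>Real scalars are enough for an operator that maps real functions to real functions; the passage to complex functions is
  \<open>orthonormal_basis_embed_complex\<close>.\<close>

typedef 'a ell2 = "{f::'a \<Rightarrow> real. (\<lambda>x. (f x)\<^sup>2) summable_on UNIV}"
  morphisms ell2_app Abs_ell2
  by (rule exI[of _ "\<lambda>_. 0"]) simp

setup_lifting type_definition_ell2

lemma ell2_app_summable: "(\<lambda>x. (ell2_app v x)\<^sup>2) summable_on UNIV"
  using ell2_app[of v] by simp

lemma ell2_eqI: "(\<And>x. ell2_app v x = ell2_app w x) \<Longrightarrow> v = w"
  by (simp add: ell2_app_inject[symmetric] fun_eq_iff)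

lemma summable_on_sq_comparison:
  fixes f g :: "'a \<Rightarrow> real"
  assumes "g summable_on UNIV" "\<And>x. (f x)\<^sup>2 \<le> g x"
  shows "(\<lambda>x. (f x)\<^sup>2) summable_on UNIV"
  using assms(1) by (rule summable_on_comparison_test) (use assms in auto)

lemma summable_on_sq_add:
  fixes f g :: "'a \<Rightarrow> real"
  assumes "(\<lambda>x. (f x)\<^sup>2) summable_on UNIV" "(\<lambda>x. (g x)\<^sup>2) summable_on UNIV"
  shows "(\<lambda>x. (f x + g x)\<^sup>2) summable_on UNIV"
proof (rule summable_on_sq_comparison)
  show "(\<lambda>x. 2 * (f x)\<^sup>2 + 2 * (g x)\<^sup>2) summable_on UNIV"
    using assms by (intro summable_on_add summable_on_cmult_right)
  show "(f x + g x)\<^sup>2 \<le> 2 * (f x)\<^sup>2 + 2 * (g x)\<^sup>2" for x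
    using zero_le_power2[of "f x - g x"] by (simp add: power2_eq_square algebra_simps)
qed

lemma summable_on_sq_diff:
  fixes f g :: "'a \<Rightarrow> real"
  assumes "(\<lambda>x. (f x)\<^sup>2) summable_on UNIV" "(\<lambda>x. (g x)\<^sup>2) summable_on UNIV"
  shows "(\<lambda>x. (f x - g x)\<^sup>2) summable_on UNIV"
  using summable_on_sq_add[of f "\<lambda>x. - g x"] assms by simp

lemma summable_on_sq_mult:
  fixes f g :: "'a \<Rightarrow> real"
  assumes "(\<lambda>x. (f x)\<^sup>2) summable_on UNIV" "(\<lambda>x. (g x)\<^sup>2) summable_on UNIV"
  shows "(\<lambda>x. f x * g x) summable_on UNIV"
proof -
  have "(\<lambda>x. norm (f x * g x)) summable_on UNIV"
  proof (rule summable_on_comparison_test)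
    show "(\<lambda>x. (f x)\<^sup>2 + (g x)\<^sup>2) summable_on UNIV"
      using assms by (intro summable_on_add)
    fix x
    have "2 * (\<bar>f x\<bar> * \<bar>g x\<bar>) \<le> (f x)\<^sup>2 + (g x)\<^sup>2"
      using zero_le_power2[of "\<bar>f x\<bar> - \<bar>g x\<bar>"] by (simp add: power2_eq_square algebra_simps)
    moreover have "0 \<le> \<bar>f x\<bar> * \<bar>g x\<bar>" by simp
    ultimately show "norm (f x * g x) \<le> (f x)\<^sup>2 + (g x)\<^sup>2" unfolding real_norm_def abs_mult by linarith
  qed auto
  then show ?thesis by (rule abs_summable_summable)
qed

instantiation ell2 :: (type) real_vector
begin

lift_definition zero_ell2 :: "'a ell2" is "\<lambda>_. 0" by simp
lift_definition plus_ell2 :: "'a ell2 \<Rightarrow> 'a ell2 \<Rightarrow> 'a ell2" is "\<lambda>f g x. f x + g x"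
  by (simp add: summable_on_sq_add)
lift_definition uminus_ell2 :: "'a ell2 \<Rightarrow> 'a ell2" is "\<lambda>f x. - f x" by simp
lift_definition minus_ell2 :: "'a ell2 \<Rightarrow> 'a ell2 \<Rightarrow> 'a ell2" is "\<lambda>f g x. f x - g x"
  by (simp add: summable_on_sq_diff)
lift_definition scaleR_ell2 :: "real \<Rightarrow> 'a ell2 \<Rightarrow> 'a ell2" is "\<lambda>c f x. c * f x"
  by (simp add: power_mult_distrib summable_on_cmult_right)
instance
proof
  fix a b :: real and u v w :: "'a ell2"
  show "u + v + w = u + (v + w)" by transfer (simp add: algebra_simps)
  show "u + v = v + u" by transfer (simp add: algebra_simps)
  show "0 + u = u" by transfer simp
  show "- u + u = 0" by transfer simp
  show "u - v = u + - v" by transfer simp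
  show "a *\<^sub>R (u + v) = a *\<^sub>R u + a *\<^sub>R v" by transfer (simp add: algebra_simps)
  show "(a + b) *\<^sub>R u = a *\<^sub>R u + b *\<^sub>R u" by transfer (simp add: algebra_simps)
  show "a *\<^sub>R b *\<^sub>R u = (a * b) *\<^sub>R u" by transfer (simp add: algebra_simps)
  show "1 *\<^sub>R u = u" by transfer simp
qed

end

instantiation ell2 :: (type) real_inner
begin

lift_definition inner_ell2 :: "'a ell2 \<Rightarrow> 'a ell2 \<Rightarrow> real" is "\<lambda>f g. \<Sum>\<^sub>\<infinity>x. f x * g x" .

definition norm_ell2 :: "'a ell2 \<Rightarrow> real" where "norm_ell2 v = sqrt (inner v v)"
definition dist_ell2 :: "'a ell2 \<Rightarrow> 'a ell2 \<Rightarrow> real" where "dist_ell2 v w = norm (v - w)"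
definition sgn_ell2 :: "'a ell2 \<Rightarrow> 'a ell2" where "sgn_ell2 v = v /\<^sub>R norm v"
definition uniformity_ell2 :: "('a ell2 \<times> 'a ell2) filter"
  where "uniformity_ell2 = (INF e\<in>{0<..}. principal {(x, y). dist x y < e})"
definition open_ell2 :: "'a ell2 set \<Rightarrow> bool"
  where "open_ell2 U = (\<forall>x\<in>U. \<forall>\<^sub>F (x', y) in uniformity. x' = x \<longrightarrow> y \<in> U)"

instance
proof
  fix a :: real and u v w :: "'a ell2"
  show "dist u v = norm (u - v)" "norm u = sqrt (inner u u)" "sgn u = u /\<^sub>R norm u"
    by (simp_all add: dist_ell2_def norm_ell2_def sgn_ell2_def)
  show "(uniformity :: ('a ell2 \<times> 'a ell2) filter) = (INF e\<in>{0<..}. principal {(x, y). dist x y < e})"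
    by (rule uniformity_ell2_def)
  show "open U = (\<forall>x\<in>U. \<forall>\<^sub>F (x', y) in uniformity. x' = x \<longrightarrow> y \<in> U)" for U :: "'a ell2 set"
    by (rule open_ell2_def)
  show "inner u v = inner v u" by transfer (simp add: mult.commute)
  show "inner (u + v) w = inner u w + inner v w"
    by transfer (simp add: distrib_right infsum_add summable_on_sq_mult)
  show "inner (a *\<^sub>R u) v = a * inner u v"
    by transfer (simp add: mult.assoc infsum_cmult_right')
  show "0 \<le> inner u u" by transfer (simp add: infsum_nonneg)
  show "(inner u u = 0) = (u = 0)"
  proof
    assume "inner u u = 0"
    then have "(\<Sum>\<^sub>\<infinity>x. (ell2_app u x)\<^sup>2) \<le> 0" by (simp add: inner_ell2.rep_eq power2_eq_square)
    then have "(ell2_app u x)\<^sup>2 = 0" for x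
      by (rule nonneg_infsum_le_0D[OF _ ell2_app_summable]) auto
    then show "u = 0" by (intro ell2_eqI) (simp add: zero_ell2.rep_eq)
  qed (simp add: inner_ell2.rep_eq zero_ell2.rep_eq)
qed

end

lemma ell2_app_simps [simp]:
  "ell2_app 0 x = 0" "ell2_app (v + w) x = ell2_app v x + ell2_app w x"
  "ell2_app (- v) x = - ell2_app v x" "ell2_app (v - w) x = ell2_app v x - ell2_app w x"
  "ell2_app (c *\<^sub>R v) x = c * ell2_app v x"
  by (transfer; simp)+

lemma ell2_app_sum [simp]: "ell2_app (\<Sum>i\<in>A. v i) x = (\<Sum>i\<in>A. ell2_app (v i) x)"
  by (induction A rule: infinite_finite_induct) auto

lemma ell2_inner: "inner v w = (\<Sum>\<^sub>\<infinity>x. ell2_app v x * ell2_app w x)"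
  by transfer simp

lemma ell2_norm_sq: "(norm v)\<^sup>2 = (\<Sum>\<^sub>\<infinity>x. (ell2_app v x)\<^sup>2)"
  unfolding power2_norm_eq_inner ell2_inner by (simp add: power2_eq_square)

lemma ell2_finite_sum_le: "finite F \<Longrightarrow> (\<Sum>x\<in>F. (ell2_app v x)\<^sup>2) \<le> (norm v)\<^sup>2"
  unfolding ell2_norm_sq by (rule finite_sum_le_infsum[OF ell2_app_summable]) auto

lemma ell2_from_finite_sums:
  fixes f :: "'a \<Rightarrow> real"
  assumes "\<And>F. finite F \<Longrightarrow> (\<Sum>x\<in>F. (f x)\<^sup>2) \<le> b\<^sup>2" "b \<ge> 0"
  obtains v where "ell2_app v = f" "norm v \<le> b"
proof -
  have s: "(\<lambda>x. (f x)\<^sup>2) summable_on UNIV"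
    by (rule nonneg_bdd_above_summable_on) (use assms in \<open>auto intro!: bdd_aboveI2[of _ _ "b\<^sup>2"]\<close>)
  then have 1: "ell2_app (Abs_ell2 f) = f" by (simp add: Abs_ell2_inverse)
  have "(norm (Abs_ell2 f))\<^sup>2 \<le> b\<^sup>2"
    unfolding ell2_norm_sq 1 by (rule infsum_le_finite_sums[OF s]) (use assms in auto)
  then have "norm (Abs_ell2 f) \<le> b" using assms(2) by (rule power2_le_imp_le)
  with 1 that show ?thesis by blast
qed

lemma ell2_app_le_norm: "\<bar>ell2_app v x\<bar> \<le> norm v"
  using ell2_finite_sum_le[of "{x}" v] by (simp add: abs_le_square_iff[symmetric])

instance ell2 :: (type) banach
proof
  fix X :: "nat \<Rightarrow> 'a ell2"
  assume C: "Cauchy X"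
  have "Cauchy (\<lambda>n. ell2_app (X n) x)" for x
  proof (rule CauchyI)
    fix e :: real assume "e > 0"
    from CauchyD[OF C this] obtain N where N: "\<forall>m\<ge>N. \<forall>n\<ge>N. norm (X m - X n) < e" ..
    have "norm (ell2_app (X m) x - ell2_app (X n) x) < e" if "m \<ge> N" "n \<ge> N" for m n
    proof -
      have "norm (X m - X n) < e" using N that by simp
      then show ?thesis using ell2_app_le_norm[of "X m - X n" x] by simp
    qed
    then show "\<exists>M. \<forall>m\<ge>M. \<forall>n\<ge>M. norm (ell2_app (X m) x - ell2_app (X n) x) < e" by (intro exI[of _ N]) simp
  qed
  then have C_conv: "convergent (\<lambda>n. ell2_app (X n) x)" for x by (simp add: Cauchy_convergent_iff)
  define f where "f x = lim (\<lambda>n. ell2_app (X n) x)" for x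
  have f: "(\<lambda>n. ell2_app (X n) x) \<longlonglongrightarrow> f x" for x
    using C_conv[of x] unfolding f_def convergent_LIMSEQ_iff .
  have close: "(\<Sum>x\<in>F. (ell2_app (X n) x - f x)\<^sup>2) \<le> e\<^sup>2"
    if F: "finite F" and N: "\<And>m. m \<ge> N \<Longrightarrow> norm (X n - X m) \<le> e" for F n N e
  proof (rule LIMSEQ_le_const2)
    show "(\<lambda>m. \<Sum>x\<in>F. (ell2_app (X n) x - ell2_app (X m) x)\<^sup>2) \<longlonglongrightarrow> (\<Sum>x\<in>F. (ell2_app (X n) x - f x)\<^sup>2)"
      by (intro tendsto_sum tendsto_power tendsto_diff tendsto_const f)
    have "(\<Sum>x\<in>F. (ell2_app (X n) x - ell2_app (X m) x)\<^sup>2) \<le> e\<^sup>2" if "m \<ge> N" for m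
    proof -
      have "(\<Sum>x\<in>F. (ell2_app (X n - X m) x)\<^sup>2) \<le> (norm (X n - X m))\<^sup>2" by (rule ell2_finite_sum_le[OF F])
      also have "\<dots> \<le> e\<^sup>2" using N[OF that] by (intro power_mono) auto
      finally show ?thesis by simp
    qed
    then show "\<exists>N. \<forall>m\<ge>N. (\<Sum>x\<in>F. (ell2_app (X n) x - ell2_app (X m) x)\<^sup>2) \<le> e\<^sup>2" by (intro exI[of _ N]) simp
  qed
  from CauchyD[OF C zero_less_one] obtain N1 where N1: "\<forall>m\<ge>N1. \<forall>n\<ge>N1. norm (X m - X n) < 1" ..
  have d_fin: "(\<Sum>x\<in>F. (ell2_app (X N1) x - f x)\<^sup>2) \<le> 1\<^sup>2" if "finite F" for F
    by (rule close[OF that, of N1]) (use N1 in \<open>simp add: less_imp_le\<close>)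
  obtain d where d: "ell2_app d = (\<lambda>x. ell2_app (X N1) x - f x)" and "norm d \<le> 1"
    by (rule ell2_from_finite_sums[OF d_fin zero_le_one])
  define L where "L = X N1 - d"
  have L: "ell2_app L x = f x" for x by (simp add: L_def d)
  have "X \<longlonglongrightarrow> L"
  proof (rule LIMSEQ_I)
    fix e :: real assume "e > 0"
    then have "e / 2 > 0" by simp
    from CauchyD[OF C this] obtain N where N: "\<forall>m\<ge>N. \<forall>n\<ge>N. norm (X m - X n) < e / 2" ..
    have "norm (X n - L) < e" if "n \<ge> N" for n
    proof -
      have "(\<Sum>x\<in>F. (ell2_app (X n - L) x)\<^sup>2) \<le> (e/2)\<^sup>2" if "finite F" for F
        using close[OF that, of N n "e/2"] N \<open>n \<ge> N\<close> by (simp add: L less_imp_le)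
      then have "(norm (X n - L))\<^sup>2 \<le> (e/2)\<^sup>2"
        unfolding ell2_norm_sq by (intro infsum_le_finite_sums[OF ell2_app_summable])
      then have "norm (X n - L) \<le> e/2" by (rule power2_le_imp_le) (use \<open>e > 0\<close> in simp)
      then show ?thesis using \<open>e > 0\<close> by linarith
    qed
    then show "\<exists>no. \<forall>n\<ge>no. norm (X n - L) < e" by (intro exI[of _ N]) simp
  qed
  then show "convergent X" by (auto simp: convergent_def)
qed

definition point_mass :: "'a \<Rightarrow> 'a ell2" where
  "point_mass x = Abs_ell2 (\<lambda>y. if y = x then 1 else 0)"

lemma point_mass_app [simp]: "ell2_app (point_mass x) y = (if y = x then 1 else 0)"
proof -
  have "(\<lambda>y. (if y = x then 1 else 0 :: real)\<^sup>2) summable_on UNIV"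
    by (subst summable_on_cong_neutral[where T="{x}"]) auto
  then show ?thesis unfolding point_mass_def by (simp add: Abs_ell2_inverse)
qed

lemma inner_point_mass [simp]: "inner (point_mass x) v = ell2_app v x" "inner v (point_mass x) = ell2_app v x"
proof -
  have "inner (point_mass x) v = (\<Sum>\<^sub>\<infinity>y\<in>{x}. ell2_app (point_mass x) y * ell2_app v y)"
    unfolding ell2_inner by (rule infsum_cong_neutral) auto
  then show "inner (point_mass x) v = ell2_app v x" by simp
  then show "inner v (point_mass x) = ell2_app v x" by (simp add: inner_commute)
qed

lemma norm_point_mass [simp]: "norm (point_mass x) = 1"
  by (simp add: norm_eq_sqrt_inner)

lemma ell2_finite_approx: "((\<lambda>F. \<Sum>x\<in>F. ell2_app v x *\<^sub>R point_mass x) \<longlongrightarrow> v) (finite_subsets_at_top UNIV)"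
proof -
  have eq: "(norm ((\<Sum>x\<in>F. ell2_app v x *\<^sub>R point_mass x) - v))\<^sup>2 = (norm v)\<^sup>2 - (\<Sum>x\<in>F. (ell2_app v x)\<^sup>2)" if "finite F" for F
  proof -
    define w where "w = (\<Sum>x\<in>F. ell2_app v x *\<^sub>R point_mass x)"
    have wv: "inner w v = (\<Sum>x\<in>F. (ell2_app v x)\<^sup>2)" by (simp add: w_def inner_sum_left power2_eq_square)
    have "inner w w = (\<Sum>x\<in>F. ell2_app v x * ell2_app w x)"
      by (subst (1) w_def) (simp add: inner_sum_left)
    also have "\<dots> = (\<Sum>x\<in>F. (ell2_app v x)\<^sup>2)"
    proof (rule sum.cong[OF refl])
      fix x assume "x \<in> F"
      have "ell2_app w x = (\<Sum>y\<in>F. if y = x then ell2_app v y else 0)"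
        unfolding w_def ell2_app_sum by (intro sum.cong) auto
      then show "ell2_app v x * ell2_app w x = (ell2_app v x)\<^sup>2"
        using \<open>x \<in> F\<close> that by (simp add: power2_eq_square)
    qed
    finally have ww: "inner w w = (\<Sum>x\<in>F. (ell2_app v x)\<^sup>2)" .
    show ?thesis unfolding w_def[symmetric] power2_norm_eq_inner
      by (simp add: inner_diff_left inner_diff_right wv ww inner_commute[of v w])
  qed
  have "((\<lambda>F. \<Sum>x\<in>F. (ell2_app v x)\<^sup>2) \<longlongrightarrow> (norm v)\<^sup>2) (finite_subsets_at_top UNIV)"
    unfolding ell2_norm_sq by (rule infsum_tendsto[OF ell2_app_summable])
  then have "((\<lambda>F. (norm v)\<^sup>2 - (\<Sum>x\<in>F. (ell2_app v x)\<^sup>2)) \<longlongrightarrow> (norm v)\<^sup>2 - (norm v)\<^sup>2) (finite_subsets_at_top UNIV)"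
    by (intro tendsto_intros)
  then have "((\<lambda>F. (norm v)\<^sup>2 - (\<Sum>x\<in>F. (ell2_app v x)\<^sup>2)) \<longlongrightarrow> 0) (finite_subsets_at_top UNIV)" by simp
  then have "((\<lambda>F. (norm ((\<Sum>x\<in>F. ell2_app v x *\<^sub>R point_mass x) - v))\<^sup>2) \<longlongrightarrow> 0) (finite_subsets_at_top UNIV)"
    by (rule Lim_transform_eventually) (auto simp: eq intro!: eventually_finite_subsets_at_top_weakI)
  then have "((\<lambda>F. sqrt ((norm ((\<Sum>x\<in>F. ell2_app v x *\<^sub>R point_mass x) - v))\<^sup>2)) \<longlongrightarrow> sqrt 0) (finite_subsets_at_top UNIV)"
    by (rule tendsto_real_sqrt)
  then have "((\<lambda>F. (\<Sum>x\<in>F. ell2_app v x *\<^sub>R point_mass x) - v) \<longlongrightarrow> 0) (finite_subsets_at_top UNIV)"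
    by (simp add: tendsto_norm_zero_iff)
  then show ?thesis by (simp add: LIM_zero_iff)
qed

lemma ell2_finite_approx_eps:
  assumes "e > 0"
  obtains F where "finite F" "norm ((\<Sum>x\<in>F. ell2_app v x *\<^sub>R point_mass x) - v) < e"
proof -
  have "\<forall>\<^sub>F F in finite_subsets_at_top UNIV. dist (\<Sum>x\<in>F. ell2_app v x *\<^sub>R point_mass x) v < e"
    using tendstoD[OF ell2_finite_approx assms] .
  then have "\<exists>F. finite F \<and> dist (\<Sum>x\<in>F. ell2_app v x *\<^sub>R point_mass x) v < e"
    unfolding eventually_finite_subsets_at_top by blast
  then show ?thesis using that by (auto simp: dist_norm)
qed

text \<open>Finitely supported test vectors are dense, and for them weak convergence is pointwise convergence.\<close>

lemma bounded_pointwise_imp_weak: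
  fixes u :: "nat \<Rightarrow> 'a ell2"
  assumes bound: "\<And>n. norm (u n) \<le> B" and lim: "\<And>x. (\<lambda>n. ell2_app (u n) x) \<longlonglongrightarrow> ell2_app v x"
  shows "(\<lambda>n. inner y (u n)) \<longlonglongrightarrow> inner y v"
proof -
  define B' where "B' = B + norm v + 1"
  have "B' > 0" using bound[of 0] norm_ge_zero[of "u 0"] norm_ge_zero[of v] unfolding B'_def by linarith
  have "(\<lambda>n. inner y (u n - v)) \<longlonglongrightarrow> 0"
  proof (rule LIMSEQ_I)
    fix e :: real assume "e > 0"
    obtain F where F: "finite F" "norm ((\<Sum>x\<in>F. ell2_app y x *\<^sub>R point_mass x) - y) < e / (2 * B')"
      using ell2_finite_approx_eps[of "e / (2 * B')" y] \<open>e > 0\<close> \<open>B' > 0\<close> by auto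
    define yF where "yF = (\<Sum>x\<in>F. ell2_app y x *\<^sub>R point_mass x)"
    have "(\<lambda>n. \<Sum>x\<in>F. ell2_app y x * (ell2_app (u n) x - ell2_app v x)) \<longlonglongrightarrow> (\<Sum>x\<in>F. ell2_app y x * (ell2_app v x - ell2_app v x))"
      by (intro tendsto_sum tendsto_mult tendsto_diff tendsto_const lim)
    moreover have "inner yF (u n - v) = (\<Sum>x\<in>F. ell2_app y x * (ell2_app (u n) x - ell2_app v x))" for n
      by (simp add: yF_def inner_sum_left)
    ultimately have "(\<lambda>n. inner yF (u n - v)) \<longlonglongrightarrow> 0" by simp
    from LIMSEQ_D[OF this, of "e/2"] \<open>e > 0\<close> obtain N where N: "\<And>n. n \<ge> N \<Longrightarrow> \<bar>inner yF (u n - v)\<bar> < e/2" by auto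
    have "norm (inner y (u n - v) - 0) < e" if "n \<ge> N" for n
    proof -
      have "inner y (u n - v) = inner yF (u n - v) - inner (yF - y) (u n - v)" by (simp add: inner_diff_left)
      moreover have "\<bar>inner (yF - y) (u n - v)\<bar> \<le> norm (yF - y) * norm (u n - v)" by (rule Cauchy_Schwarz_ineq2)
      moreover have "norm (yF - y) * norm (u n - v) \<le> e / (2 * B') * B'"
      proof (rule mult_mono)
        show "norm (yF - y) \<le> e / (2 * B')" using F(2) by (simp add: yF_def)
        show "norm (u n - v) \<le> B'" using norm_triangle_ineq4[of "u n" v] bound[of n] unfolding B'_def by linarith
      qed (use \<open>e > 0\<close> \<open>B' > 0\<close> in auto)
      moreover have "e / (2 * B') * B' = e / 2" using \<open>B' > 0\<close> by simp
      ultimately show ?thesis using N[OF that] unfolding real_norm_def by linarith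
    qed
    then show "\<exists>no. \<forall>n\<ge>no. norm (inner y (u n - v) - 0) < e" by blast
  qed
  then have "(\<lambda>n. inner y (u n) - inner y v) \<longlonglongrightarrow> 0" by (simp add: inner_diff_right)
  then show ?thesis by (simp add: LIM_zero_iff)
qed

text \<open>The symmetry of the kernel is symmetry on point masses; finite combinations of them are dense.\<close>

lemma ell2_symmetric_if_kernel_symmetric:
  assumes T: "bounded_linear T" and kernel: "\<And>x y. ell2_app (T (point_mass x)) y = ell2_app (T (point_mass y)) x"
  shows "inner (T v) w = inner v (T w)"
proof -
  let ?F = "finite_subsets_at_top UNIV"
  let ?s = "\<lambda>v F. \<Sum>x\<in>F. ell2_app v x *\<^sub>R point_mass x"
  have T_lim: "((\<lambda>F. T (?s v F)) \<longlongrightarrow> T v) ?F" for v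
    by (rule bounded_linear.tendsto[OF T ell2_finite_approx])
  have T_sum: "T (?s v F) = (\<Sum>x\<in>F. ell2_app v x *\<^sub>R T (point_mass x))" for v F
    by (simp add: linear_sum[OF bounded_linear.linear[OF T]] linear_cmul[OF bounded_linear.linear[OF T]])
  have nt: "?F \<noteq> bot" by simp
  have 1: "ell2_app (T v) y = inner v (T (point_mass y))" for v y
  proof (rule tendsto_unique[OF nt])
    show "((\<lambda>F. inner (point_mass y) (T (?s v F))) \<longlongrightarrow> ell2_app (T v) y) ?F"
      using tendsto_inner[OF tendsto_const T_lim, of "point_mass y" v] by simp
    have "inner (point_mass y) (T (?s v F)) = inner (?s v F) (T (point_mass y))" for F
      by (simp add: T_sum inner_sum_left kernel[of _ y])
    then show "((\<lambda>F. inner (point_mass y) (T (?s v F))) \<longlongrightarrow> inner v (T (point_mass y))) ?F"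
      using tendsto_inner[OF ell2_finite_approx tendsto_const, of v "T (point_mass y)"] by simp
  qed
  show ?thesis
  proof (rule tendsto_unique[OF nt])
    show "((\<lambda>F. inner (T v) (?s w F)) \<longlongrightarrow> inner (T v) w) ?F"
      by (rule tendsto_inner[OF tendsto_const ell2_finite_approx])
    have "inner (T v) (?s w F) = inner v (T (?s w F))" for F
      by (simp add: T_sum inner_sum_right 1)
    then show "((\<lambda>F. inner (T v) (?s w F)) \<longlongrightarrow> inner v (T w)) ?F"
      using tendsto_inner[OF tendsto_const T_lim, of v w] by simp
  qed
qed

section \<open>Balls of a homogeneous ultrametric space\<close>

definition ball_average :: "nat \<Rightarrow> ('a::metric_space \<Rightarrow> real) \<Rightarrow> 'a \<Rightarrow> real" where
  "ball_average n f x = (\<Sum>y\<in>cball x (real n). f y) / real (card (cball x (real n)))"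

text \<open>The ball average of a square summable function is square summable by \<open>average_op_bounded\<close>, so that \<open>Abs_ell2\<close> is applied
  within its domain.\<close>

definition average_op :: "nat \<Rightarrow> 'a::metric_space ell2 \<Rightarrow> 'a ell2" where
  "average_op n v = Abs_ell2 (ball_average n (ell2_app v))"

locale hierarchical_structure =
  fixes C :: "'a::metric_space set \<Rightarrow> real"
  assumes space: "homogeneous_ultrametric_measure_space TYPE('a)"
    and choice: "homogeneous_choice_function C"
begin

lemma ultrametric: "dist x y \<le> max (dist x z) (dist z y)" for x y z :: 'a
  using space unfolding homogeneous_ultrametric_measure_space_def by blast

lemma finite_cball [simp]: "finite (cball x r)" for x :: 'a
  using space unfolding homogeneous_ultrametric_measure_space_def by blast

lemma cball_eq: "y \<in> cball x r \<Longrightarrow> cball y r = cball x r" for x y :: 'a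
proof -
  assume y: "y \<in> cball x r"
  have "dist x z \<le> r" if "dist y z \<le> r" for z
    using ultrametric[of x z y] y that by auto
  moreover have "dist y z \<le> r" if "dist x z \<le> r" for z
    using ultrametric[of y z x] y that by (auto simp: dist_commute)
  ultimately show ?thesis by auto
qed

lemma diameter_cball: "x \<noteq> y \<Longrightarrow> diameter (cball x (dist x y)) = dist x y" for x y :: 'a
proof (rule antisym)
  show "diameter (cball x (dist x y)) \<le> dist x y"
    unfolding diameter_def
  proof (simp, intro cSUP_least)
    fix p assume "p \<in> cball x (dist x y) \<times> cball x (dist x y)"
    then show "(case p of (u, v) \<Rightarrow> dist u v) \<le> dist x y"
      using ultrametric[of "fst p" "snd p" x] by (auto simp: dist_commute)
  qed auto
  show "dist x y \<le> diameter (cball x (dist x y))"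
    by (rule diameter_bounded_bound) auto
qed

lemma card_cball_dist: "x \<noteq> y \<Longrightarrow> real (card (cball x (dist x y))) = dist x y" for x y :: 'a
proof -
  assume "x \<noteq> y"
  have "cball x (dist x y) \<in> balls"
    unfolding balls_def by (rule CollectI, rule exI[of _ x], rule exI[of _ "dist x y"]) (use \<open>x \<noteq> y\<close> in simp)
  moreover have "\<not> is_singleton (cball x (dist x y))"
    using \<open>x \<noteq> y\<close> by (metis centre_in_cball dist_self is_singletonE mem_cball order_refl singletonD zero_le_dist)
  ultimately have "real (card (cball x (dist x y))) = diameter (cball x (dist x y))"
    using space unfolding homogeneous_ultrametric_measure_space_def by blast
  then show ?thesis using diameter_cball[OF \<open>x \<noteq> y\<close>] by simp
qed

text \<open>A positive distance is the cardinality of a ball, hence a natural number.  By homogeneity every point sees the same set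
  of distances (\<open>level_at\<close>), so the nontrivial balls around each point are enumerated by the levels.\<close>

definition level :: "nat \<Rightarrow> bool" where
  "level n \<longleftrightarrow> (\<exists>x y :: 'a. x \<noteq> y \<and> dist x y = real n)"

lemma level_dist: "x \<noteq> y \<Longrightarrow> \<exists>n. level n \<and> dist x y = real n" for x y :: 'a
  using card_cball_dist[of x y] unfolding level_def by metis

lemma level_at: "level n \<Longrightarrow> \<exists>y. x \<noteq> y \<and> dist x y = real n" for x :: 'a
proof -
  assume "level n"
  then obtain u v :: 'a where uv: "u \<noteq> v" "dist u v = real n" unfolding level_def by blast
  obtain \<phi> where \<phi>: "\<phi> \<in> isometry_group" "\<phi> u = x"
    using space unfolding homogeneous_ultrametric_measure_space_def by blast
  then have "dist x (\<phi> v) = real n" using uv unfolding isometry_group_def by auto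
  moreover have "real n > 0" using uv by (metis zero_less_dist_iff)
  ultimately show ?thesis by (intro exI[of _ "\<phi> v"]) auto
qed

lemma dist_ge_1: "x \<noteq> y \<Longrightarrow> dist x y \<ge> 1" for x y :: 'a
proof -
  assume "x \<noteq> y"
  obtain n where "dist x y = real n" using level_dist[OF \<open>x \<noteq> y\<close>] by blast
  moreover have "dist x y > 0" using \<open>x \<noteq> y\<close> by simp
  ultimately show ?thesis by simp
qed

lemma card_cball_ge: "x \<noteq> y \<Longrightarrow> dist x y \<le> r \<Longrightarrow> dist x y \<le> real (card (cball x r))" for x y :: 'a
proof -
  assume "x \<noteq> y" "dist x y \<le> r"
  have "card (cball x (dist x y)) \<le> card (cball x r)"
    using \<open>dist x y \<le> r\<close> by (intro card_mono) auto
  then show ?thesis using card_cball_dist[OF \<open>x \<noteq> y\<close>] by linarith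
qed

lemma card_cball_pos: "r \<ge> 0 \<Longrightarrow> card (cball x r) > 0" for x :: 'a
  by (auto simp: card_gt_0_iff)

section \<open>Averaging operators\<close>

text \<open>By Jensen's inequality the square of an average is at most the average of the squares.  Balls of a fixed radius partition
  the space, so in the sum over all \<open>x\<close> each \<open>(f y)\<^sup>2\<close> is counted with total weight one.\<close>

lemma average_op_bounded:
  "ell2_app (average_op n v) = ball_average n (ell2_app v) \<and> norm (average_op n v) \<le> norm v" for v :: "'a ell2"
proof -
  let ?f = "ell2_app v" and ?B = "\<lambda>x::'a. cball x (real n)"
  have "(\<Sum>x\<in>F. (ball_average n ?f x)\<^sup>2) \<le> (norm v)\<^sup>2" if F: "finite F" for F
  proof -
    define G where "G = (\<Union>x\<in>F. ?B x)"
    have finG: "finite G" using F by (simp add: G_def)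
    have FG: "F \<subseteq> G" unfolding G_def by force
    have BG: "?B x \<subseteq> G" if x: "x \<in> G" for x
    proof -
      obtain z where "z \<in> F" "x \<in> ?B z" using x unfolding G_def by blast
      then show ?thesis using cball_eq[of x z "real n"] unfolding G_def by blast
    qed
    have jensen: "(ball_average n ?f x)\<^sup>2 \<le> (\<Sum>y\<in>?B x. (?f y)\<^sup>2) / real (card (?B x))" for x
    proof -
      let ?N = "real (card (?B x))"
      have N: "?N > 0" using card_cball_pos[of "real n" x] by simp
      have "(\<Sum>y\<in>?B x. ?f y)\<^sup>2 \<le> (\<Sum>y\<in>?B x. (?f y)\<^sup>2) * ?N"
        by (rule sum_squared_le_sum_of_squares)
      then show ?thesis using N unfolding ball_average_def
        by (simp add: power_divide divide_simps power2_eq_square mult_ac)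
    qed
    have "(\<Sum>x\<in>F. (ball_average n ?f x)\<^sup>2) \<le> (\<Sum>x\<in>G. (ball_average n ?f x)\<^sup>2)"
      using finG FG by (intro sum_mono2) auto
    also have "\<dots> \<le> (\<Sum>x\<in>G. (\<Sum>y\<in>?B x. (?f y)\<^sup>2) / real (card (?B x)))"
      by (intro sum_mono jensen)
    also have "\<dots> = (\<Sum>x\<in>G. \<Sum>y\<in>G. if y \<in> ?B x then (?f y)\<^sup>2 / real (card (?B x)) else 0)"
    proof (rule sum.cong[OF refl])
      fix x assume "x \<in> G"
      have "(\<Sum>y\<in>?B x. (?f y)\<^sup>2) / real (card (?B x)) = (\<Sum>y\<in>?B x. (?f y)\<^sup>2 / real (card (?B x)))"
        by (simp add: sum_divide_distrib)
      also have "\<dots> = (\<Sum>y\<in>G. if y \<in> ?B x then (?f y)\<^sup>2 / real (card (?B x)) else 0)"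
        using BG[OF \<open>x \<in> G\<close>] finG by (intro sum.mono_neutral_cong_left) auto
      finally show "(\<Sum>y\<in>?B x. (?f y)\<^sup>2) / real (card (?B x)) = (\<Sum>y\<in>G. if y \<in> ?B x then (?f y)\<^sup>2 / real (card (?B x)) else 0)" .
    qed
    also have "\<dots> = (\<Sum>y\<in>G. \<Sum>x\<in>G. if y \<in> ?B x then (?f y)\<^sup>2 / real (card (?B x)) else 0)"
      by (rule sum.swap)
    also have "\<dots> = (\<Sum>y\<in>G. (?f y)\<^sup>2)"
    proof (rule sum.cong[OF refl])
      fix y assume "y \<in> G"
      have "(\<Sum>x\<in>G. if y \<in> ?B x then (?f y)\<^sup>2 / real (card (?B x)) else 0) = (\<Sum>x\<in>?B y. (?f y)\<^sup>2 / real (card (?B y)))"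
      proof (intro sum.mono_neutral_cong_right)
        fix x assume "x \<in> ?B y"
        then have "?B x = ?B y" by (rule cball_eq)
        moreover have "y \<in> ?B x" using \<open>x \<in> ?B y\<close> by (simp add: dist_commute)
        ultimately show "(if y \<in> ?B x then (?f y)\<^sup>2 / real (card (?B x)) else 0) = (?f y)\<^sup>2 / real (card (?B y))" by simp
      qed (use BG[OF \<open>y \<in> G\<close>] finG in \<open>auto simp: dist_commute\<close>)
      also have "\<dots> = (?f y)\<^sup>2" using card_cball_pos[of "real n" y] by simp
      finally show "(\<Sum>x\<in>G. if y \<in> ?B x then (?f y)\<^sup>2 / real (card (?B x)) else 0) = (?f y)\<^sup>2" .
    qed
    also have "\<dots> \<le> (norm v)\<^sup>2" by (rule ell2_finite_sum_le[OF finG])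
    finally show ?thesis .
  qed
  then obtain w where w: "ell2_app w = ball_average n ?f" and norm_w: "norm w \<le> norm v"
    by (rule ell2_from_finite_sums[OF _ norm_ge_zero])
  then have "average_op n v = w" unfolding average_op_def by (metis ell2_app_inverse)
  with w norm_w show ?thesis by simp
qed

lemma average_op_app [simp]: "ell2_app (average_op n v) x = ball_average n (ell2_app v) x" for x :: 'a
  using average_op_bounded by metis

lemma norm_average_op: "norm (average_op n v) \<le> norm v" for v :: "'a ell2"
  using average_op_bounded by blast

lemma linear_average_op: "linear (average_op n :: 'a ell2 \<Rightarrow> 'a ell2)"
  by (rule linearI; rule ell2_eqI) (simp_all add: ball_average_def sum.distrib add_divide_distrib sum_distrib_left[symmetric])

lemma bounded_linear_average_op: "bounded_linear (average_op n :: 'a ell2 \<Rightarrow> 'a ell2)"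
  by (rule bounded_linear_intro[where K=1])
    (auto simp: linear_add[OF linear_average_op] linear_cmul[OF linear_average_op] norm_average_op)

lemma average_kernel: "ell2_app (average_op n (point_mass y)) x
    = (if dist x y \<le> real n then 1 / real (card (cball x (real n))) else 0)" for x y :: 'a
  by (simp add: ball_average_def)

lemma average_kernel_sym: "ell2_app (average_op n (point_mass x)) y = ell2_app (average_op n (point_mass y)) x" for x y :: 'a
  using cball_eq[of x y "real n"] unfolding average_kernel by (auto simp: dist_commute)

lemma average_op_sym: "inner (average_op n v) w = inner v (average_op n w)" for v w :: "'a ell2"
  by (rule ell2_symmetric_if_kernel_symmetric[OF bounded_linear_average_op average_kernel_sym])

text \<open>An average over balls of radius \<open>m\<close> is constant on balls of radius \<open>n \<le> m\<close>.  The other order follows by symmetry.\<close>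

lemma average_op_average_op:
  fixes v :: "'a ell2"
  assumes "n \<le> m"
  shows "average_op n (average_op m v) = average_op m v" "average_op m (average_op n v) = average_op m v"
proof -
  show 1: "average_op n (average_op m v) = average_op m v" for v :: "'a ell2"
  proof (rule ell2_eqI)
    fix x :: 'a
    have const: "ball_average m (ell2_app v) y = ball_average m (ell2_app v) x" if "y \<in> cball x (real n)" for y
    proof -
      have "y \<in> cball x (real m)" using that assms by auto
      then show ?thesis unfolding ball_average_def by (simp add: cball_eq)
    qed
    have "(\<Sum>y\<in>cball x (real n). ball_average m (ell2_app v) y) = (\<Sum>y\<in>cball x (real n). ball_average m (ell2_app v) x)"
      by (intro sum.cong refl const)
    also have "\<dots> = real (card (cball x (real n))) * ball_average m (ell2_app v) x" by simp
    finally have "(\<Sum>y\<in>cball x (real n). ball_average m (ell2_app v) y) = real (card (cball x (real n))) * ball_average m (ell2_app v) x" .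
    then have "ball_average n (ball_average m (ell2_app v)) x = ball_average m (ell2_app v) x"
      using card_cball_pos[of "real n" x] unfolding ball_average_def[of n] by simp
    then show "ell2_app (average_op n (average_op m v)) x = ell2_app (average_op m v) x"
      by (simp add: average_op_app[abs_def])
  qed
  have "inner (average_op m (average_op n v) - average_op m v) w = 0" for w
    by (simp add: inner_diff_left average_op_sym 1)
  then show "average_op m (average_op n v) = average_op m v"
    using inner_eq_zero_iff[of "average_op m (average_op n v) - average_op m v"] by simp
qed

section \<open>The hierarchical Laplacian\<close>

text \<open>As \<open>C\<close> depends on the diameter only, the centre \<open>undefined\<close> stands for any point (\<open>C_level\<close>).\<close>

definition level_weight :: "nat \<Rightarrow> real" where
  "level_weight n = (if level n then C (cball undefined (real n)) else 0)"

lemma cball_level: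
  fixes x :: 'a
  assumes "level n"
  shows "cball x (real n) \<in> balls" "diameter (cball x (real n)) = real n" "card (cball x (real n)) = n"
proof -
  obtain y where y: "x \<noteq> y" "dist x y = real n" using level_at[OF assms] by blast
  then have "real n > 0" by (metis zero_less_dist_iff)
  then show "cball x (real n) \<in> balls" unfolding balls_def by blast
  show "diameter (cball x (real n)) = real n" using diameter_cball[OF y(1)] y(2) by simp
  have "real (card (cball x (real n))) = real n" using card_cball_dist[OF y(1)] y(2) by simp
  then show "card (cball x (real n)) = n" by simp
qed

lemma C_level: "level n \<Longrightarrow> C (cball x (real n)) = level_weight n" for x :: 'a
proof -
  assume n: "level n"
  have "C (cball x (real n)) = C (cball undefined (real n))"
    using choice cball_level(1,2)[OF n] unfolding homogeneous_choice_function_def by simp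
  then show ?thesis using n by (simp add: level_weight_def)
qed

lemma level_weight_nonneg: "level_weight n \<ge> 0"
  using choice cball_level(1) unfolding level_weight_def homogeneous_choice_function_def by (auto intro: less_imp_le)

lemma inj_cball_level: "inj_on (\<lambda>n. cball (x::'a) (real n)) {n. level n}"
  by (rule inj_on_inverseI[where g=card]) (simp add: cball_level)

lemma balls_containing: "{B \<in> balls. x \<in> B} = insert {x} ((\<lambda>n. cball x (real n)) ` {n. level n})" for x :: 'a
proof (intro equalityI subsetI)
  fix B assume "B \<in> {B \<in> balls. x \<in> B}"
  then obtain z r where "B = cball z r" "r > 0" "x \<in> cball z r" by (auto simp: balls_def)
  then have B: "B = cball x r" and xB: "x \<in> B" using cball_eq[of x z r] by auto
  have finB: "finite B" using B by simp
  \<comment> \<open>The radius of a ball may be lowered to the largest distance that it attains.\<close>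
  define d where "d = Max (dist x ` B)"
  have d: "dist x y \<le> d" if "y \<in> B" for y using that finB unfolding d_def by simp
  have "d \<in> dist x ` B" unfolding d_def using finB xB by (intro Max_in) auto
  then obtain z where z: "z \<in> B" "d = dist x z" by blast
  show "B \<in> insert {x} ((\<lambda>n. cball x (real n)) ` {n. level n})"
  proof (cases "x = z")
    case True
    then have "d = 0" using z by simp
    then have "B \<subseteq> {x}" using d by (auto simp: order_antisym_conv)
    then show ?thesis using xB by blast
  next
    case False
    obtain n where n: "level n" "dist x z = real n" using level_dist[OF False] by blast
    have "B = cball x (real n)" using d z n B by force
    then show ?thesis using n by blast
  qed
next
  fix B assume "B \<in> insert {x} ((\<lambda>n. cball x (real n)) ` {n. level n})"
  moreover have "{x} \<in> balls"
  proof -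
    have "cball x (1/2) = {x}"
    proof -
      have "y = x" if "dist x y \<le> 1/2" for y using dist_ge_1[of x y] that by (cases "x = y") auto
      then show ?thesis by auto
    qed
    then show ?thesis unfolding balls_def by (metis (mono_tags, lifting) half_gt_zero_iff mem_Collect_eq zero_less_one)
  qed
  ultimately show "B \<in> {B \<in> balls. x \<in> B}" using cball_level(1) by auto
qed

lemma summable_level_weight: "summable level_weight"
proof -
  have "{undefined :: 'a} \<in> balls" using balls_containing[of undefined] by blast
  then have "C summable_on {T \<in> balls. {undefined} \<subseteq> T}"
    using choice unfolding homogeneous_choice_function_def by blast
  then have "C summable_on ((\<lambda>n. cball (undefined::'a) (real n)) ` {n. level n})"
    by (rule summable_on_subset_banach) (use balls_containing[of undefined] in auto)
  then have "(C \<circ> (\<lambda>n. cball (undefined::'a) (real n))) summable_on {n. level n}"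
    by (subst (asm) summable_on_reindex[OF inj_cball_level])
  then have "level_weight summable_on {n. level n}"
    by (subst (asm) summable_on_cong[where g=level_weight]) (auto simp: C_level)
  then have "level_weight summable_on UNIV"
    by (subst summable_on_cong_neutral[where T="{n. level n}" and g=level_weight]) (auto simp: level_weight_def)
  then show ?thesis by (rule summable_on_UNIV_nonneg_real_iff[THEN iffD1, rotated]) (rule level_weight_nonneg)
qed

definition laplacian_op :: "'a ell2 \<Rightarrow> 'a ell2" where
  "laplacian_op v = (\<Sum>n. level_weight n *\<^sub>R (v - average_op n v))"

definition total_weight :: real where "total_weight = (\<Sum>n. level_weight n)"

lemma total_weight_nonneg: "total_weight \<ge> 0"
  unfolding total_weight_def by (intro suminf_nonneg summable_level_weight level_weight_nonneg)

lemma norm_laplacian_term: "norm (level_weight n *\<^sub>R (v - average_op n v)) \<le> level_weight n * (2 * norm v)" for v :: "'a ell2"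
proof -
  have "norm (v - average_op n v) \<le> 2 * norm v"
    using norm_triangle_ineq4[of v "average_op n v"] norm_average_op[of n v] by linarith
  then show ?thesis using level_weight_nonneg[of n] by (simp add: mult_left_mono)
qed

lemma laplacian_sums: "(\<lambda>n. level_weight n *\<^sub>R (v - average_op n v)) sums laplacian_op v"
  unfolding laplacian_op_def
  by (intro summable_sums summable_comparison_test'[OF summable_mult2[OF summable_level_weight] norm_laplacian_term])

lemma norm_laplacian_op: "norm (laplacian_op v) \<le> 2 * total_weight * norm v"
proof -
  have s: "summable (\<lambda>n. level_weight n * (2 * norm v))" by (rule summable_mult2[OF summable_level_weight])
  have "norm (laplacian_op v) \<le> (\<Sum>n. level_weight n * (2 * norm v))"
    unfolding laplacian_op_def by (rule norm_suminf_le[OF norm_laplacian_term s])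
  also have "\<dots> = 2 * total_weight * norm v"
    unfolding total_weight_def by (subst suminf_mult2[OF summable_level_weight, symmetric]) simp
  finally show ?thesis .
qed

lemma linear_laplacian_op: "linear laplacian_op"
proof (rule linearI)
  fix v w :: "'a ell2" and c :: real
  have "(\<lambda>n. level_weight n *\<^sub>R (v - average_op n v) + level_weight n *\<^sub>R (w - average_op n w)) sums (laplacian_op v + laplacian_op w)"
    by (intro sums_add laplacian_sums)
  then have "(\<lambda>n. level_weight n *\<^sub>R ((v + w) - average_op n (v + w))) sums (laplacian_op v + laplacian_op w)"
    by (simp add: linear_add[OF linear_average_op] algebra_simps)
  then show "laplacian_op (v + w) = laplacian_op v + laplacian_op w"
    using laplacian_sums[of "v + w"] by (rule sums_unique2[symmetric])
  have "(\<lambda>n. c *\<^sub>R (level_weight n *\<^sub>R (v - average_op n v))) sums (c *\<^sub>R laplacian_op v)"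
    by (intro sums_scaleR_right laplacian_sums)
  then have "(\<lambda>n. level_weight n *\<^sub>R (c *\<^sub>R v - average_op n (c *\<^sub>R v))) sums (c *\<^sub>R laplacian_op v)"
    by (simp add: linear_cmul[OF linear_average_op] algebra_simps)
  then show "laplacian_op (c *\<^sub>R v) = c *\<^sub>R laplacian_op v"
    using laplacian_sums[of "c *\<^sub>R v"] by (rule sums_unique2[symmetric])
qed

lemma laplacian_op_sym: "inner (laplacian_op v) w = inner v (laplacian_op w)"
proof -
  have "(\<lambda>n. inner (level_weight n *\<^sub>R (v - average_op n v)) w) sums inner (laplacian_op v) w"
    by (rule bounded_linear.sums[OF bounded_linear_inner_left laplacian_sums])
  moreover have "inner (level_weight n *\<^sub>R (v - average_op n v)) w = inner v (level_weight n *\<^sub>R (w - average_op n w))" for n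
    by (simp add: inner_diff_left inner_diff_right average_op_sym)
  ultimately have "(\<lambda>n. inner v (level_weight n *\<^sub>R (w - average_op n w))) sums inner (laplacian_op v) w"
    by (simp only:)
  moreover have "(\<lambda>n. inner v (level_weight n *\<^sub>R (w - average_op n w))) sums inner v (laplacian_op w)"
    by (rule bounded_linear.sums[OF bounded_linear_inner_right laplacian_sums])
  ultimately show ?thesis by (rule sums_unique2)
qed

lemma laplacian_op_app_sums:
  "(\<lambda>n. level_weight n * (ell2_app v x - ball_average n (ell2_app v) x)) sums ell2_app (laplacian_op v) x"
  using bounded_linear.sums[OF bounded_linear_inner_right laplacian_sums, of "point_mass x" v] by simp

text \<open>The singleton ball contributes nothing, and the other balls around \<open>x\<close> correspond to the levels.\<close>

lemma hierarchical_laplacian_of_real: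
  "hierarchical_laplacian C (\<lambda>x. of_real (ell2_app v x)) x = of_real (ell2_app (laplacian_op v) x)"
proof -
  let ?f = "\<lambda>x. complex_of_real (ell2_app v x)"
  define g where "g B = of_real (C B) * (?f x - 1 / of_nat (card B) * (\<Sum>y\<in>B. ?f y))" for B
  define h where "h n = complex_of_real (level_weight n * (ell2_app v x - ball_average n (ell2_app v) x))" for n
  have "hierarchical_laplacian C ?f x = infsum g (insert {x} ((\<lambda>n. cball x (real n)) ` {n. level n}))"
    unfolding hierarchical_laplacian_def g_def balls_containing ..
  also have "\<dots> = infsum g ((\<lambda>n. cball x (real n)) ` {n. level n})"
  proof (rule infsum_cong_neutral)
    fix B assume "B \<in> insert {x} ((\<lambda>n. cball x (real n)) ` {n. level n}) - (\<lambda>n. cball x (real n)) ` {n. level n}"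
    then show "g B = 0" by (auto simp: g_def)
  qed auto
  also have "\<dots> = infsum (g \<circ> (\<lambda>n. cball x (real n))) {n. level n}"
    by (rule infsum_reindex[OF inj_cball_level])
  also have "\<dots> = infsum h UNIV"
  proof (rule infsum_cong_neutral)
    fix n assume "n \<in> {n. level n} \<inter> UNIV"
    then show "(g \<circ> (\<lambda>n. cball x (real n))) n = h n"
      by (simp add: g_def h_def C_level ball_average_def divide_inverse mult.commute)
  qed (auto simp: h_def level_weight_def)
  also have "\<dots> = of_real (ell2_app (laplacian_op v) x)"
  proof (rule infsumI, rule norm_summable_imp_has_sum)
    show "h sums of_real (ell2_app (laplacian_op v) x)"
      unfolding h_def by (rule sums_of_real[OF laplacian_op_app_sums])
    show "summable (\<lambda>n. norm (h n))"
    proof (rule summable_comparison_test'[OF summable_mult2[OF summable_level_weight]])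
      fix n
      have "ell2_app (level_weight n *\<^sub>R (v - average_op n v)) x = level_weight n * (ell2_app v x - ball_average n (ell2_app v) x)"
        by simp
      then have "norm (h n) = \<bar>ell2_app (level_weight n *\<^sub>R (v - average_op n v)) x\<bar>" by (simp only: h_def norm_of_real)
      also have "\<dots> \<le> level_weight n * (2 * norm v)"
        by (rule order_trans[OF ell2_app_le_norm norm_laplacian_term])
      finally show "norm (norm (h n)) \<le> level_weight n * (2 * norm v)" by simp
    qed
  qed
  finally show ?thesis .
qed

section \<open>The free resolvent\<close>

text \<open>With \<open>P\<^sub>n\<close> the average over balls of radius \<open>n\<close>, the Laplacian \<open>\<Sum>\<^sub>k c\<^sub>k (1 - P\<^sub>k)\<close> acts on the range of
  \<open>P\<^sub>n\<^sub>-\<^sub>1 - P\<^sub>n\<close> as the number \<open>\<Sum>\<^sub>k\<^sub>\<ge>\<^sub>n c\<^sub>k\<close>.\<close>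

definition level_eigenvalue :: "nat \<Rightarrow> real" where
  "level_eigenvalue n = total_weight - (\<Sum>k<n. level_weight k)"

definition laplacian_spectrum :: "real set" where
  "laplacian_spectrum = insert 0 (range level_eigenvalue)"

lemma countable_laplacian_spectrum: "countable laplacian_spectrum"
  by (simp add: laplacian_spectrum_def)

lemma level_eigenvalue_tendsto_0: "level_eigenvalue \<longlonglongrightarrow> 0"
proof -
  have "(\<lambda>n. \<Sum>k<n. level_weight k) \<longlonglongrightarrow> total_weight"
    unfolding total_weight_def by (rule summable_LIMSEQ[OF summable_level_weight])
  then have "(\<lambda>n. total_weight - (\<Sum>k<n. level_weight k)) \<longlonglongrightarrow> total_weight - total_weight"
    by (intro tendsto_diff tendsto_const)
  then show ?thesis by (simp add: level_eigenvalue_def[abs_def])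
qed

lemma spectral_gap:
  assumes "l \<notin> laplacian_spectrum"
  shows "\<exists>N. \<forall>n. 1 / real (Suc N) \<le> \<bar>level_eigenvalue n - l\<bar>"
proof -
  have "l \<noteq> 0" using assms by (auto simp: laplacian_spectrum_def)
  have "(\<lambda>n. \<bar>level_eigenvalue n - l\<bar>) \<longlonglongrightarrow> \<bar>0 - l\<bar>"
    by (intro tendsto_rabs tendsto_diff tendsto_const level_eigenvalue_tendsto_0)
  then have "\<forall>\<^sub>F n in sequentially. \<bar>l\<bar> / 2 < \<bar>level_eigenvalue n - l\<bar>"
    by (rule order_tendstoD(1)) (use \<open>l \<noteq> 0\<close> in simp)
  then obtain n0 where n0: "\<And>n. n \<ge> n0 \<Longrightarrow> \<bar>l\<bar> / 2 < \<bar>level_eigenvalue n - l\<bar>"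
    unfolding eventually_sequentially by blast
  define d where "d = Min (insert (\<bar>l\<bar> / 2) ((\<lambda>n. \<bar>level_eigenvalue n - l\<bar>) ` {..n0}))"
  have "d > 0"
    unfolding d_def using \<open>l \<noteq> 0\<close> assms by (subst Min_gr_iff) (auto simp: laplacian_spectrum_def)
  have "d \<le> \<bar>level_eigenvalue n - l\<bar>" for n
  proof (cases "n \<le> n0")
    case True then show ?thesis unfolding d_def by (intro Min_le) auto
  next
    case False
    have "d \<le> \<bar>l\<bar> / 2" unfolding d_def by (intro Min_le) auto
    also have "\<dots> < \<bar>level_eigenvalue n - l\<bar>" by (rule n0) (use False in simp)
    finally show ?thesis by simp
  qed
  moreover obtain N where "1 / real (Suc N) < d" using nat_approx_posE[OF \<open>d > 0\<close>] .
  ultimately show ?thesis by (meson less_imp_le order_trans)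
qed

text \<open>Summation by parts turns \<open>(L - l)\<^sup>-\<^sup>1 = \<Sum>\<^sub>n r\<^sub>n (P\<^sub>n\<^sub>-\<^sub>1 - P\<^sub>n)\<close>, where \<open>r\<^sub>n = 1 / (\<lambda>\<^sub>n - l)\<close> and \<open>P\<^sub>-\<^sub>1 = 1\<close>, into the series
  \<open>r\<^sub>0 + \<Sum>\<^sub>n (r\<^sub>n\<^sub>+\<^sub>1 - r\<^sub>n) P\<^sub>n\<close>, which converges absolutely because \<open>r\<^sub>n\<^sub>+\<^sub>1 - r\<^sub>n = O(c\<^sub>n)\<close>.\<close>

definition resolvent_coeff :: "real \<Rightarrow> nat \<Rightarrow> real" where
  "resolvent_coeff l n = 1 / (level_eigenvalue (Suc n) - l) - 1 / (level_eigenvalue n - l)"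

definition free_resolvent :: "real \<Rightarrow> 'a ell2 \<Rightarrow> 'a ell2" where
  "free_resolvent l v = (1 / (total_weight - l)) *\<^sub>R v + (\<Sum>n. resolvent_coeff l n *\<^sub>R average_op n v)"

context
  fixes l g :: real
  assumes g_pos: "g > 0" and gap: "\<And>n. g \<le> \<bar>level_eigenvalue n - l\<bar>"
begin

lemma resolvent_coeff_bound: "\<bar>resolvent_coeff l n\<bar> \<le> level_weight n * (1 / g\<^sup>2)"
proof -
  define p q where "p = level_eigenvalue n - l" and "q = level_eigenvalue (Suc n) - l"
  have pq: "g \<le> \<bar>p\<bar>" "g \<le> \<bar>q\<bar>" unfolding p_def q_def by (rule gap)+
  then have ne: "p \<noteq> 0" "q \<noteq> 0" using g_pos by auto
  have "p - q = level_weight n" by (simp add: p_def q_def level_eigenvalue_def)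
  then have "resolvent_coeff l n = level_weight n / (p * q)"
    unfolding resolvent_coeff_def p_def[symmetric] q_def[symmetric] using ne by (simp add: field_simps)
  then have "\<bar>resolvent_coeff l n\<bar> = level_weight n / (\<bar>p\<bar> * \<bar>q\<bar>)"
    using level_weight_nonneg[of n] by (simp add: abs_mult)
  also have "\<dots> \<le> level_weight n / (g * g)"
    using pq g_pos level_weight_nonneg[of n] by (intro divide_left_mono mult_mono mult_pos_pos) auto
  finally show ?thesis by (simp add: power2_eq_square)
qed

lemma summable_resolvent_coeff: "summable (\<lambda>n. \<bar>resolvent_coeff l n\<bar>)"
  by (rule summable_comparison_test'[OF summable_mult2[OF summable_level_weight, of "1 / g\<^sup>2"], of 0])
    (simp only: real_norm_def abs_abs resolvent_coeff_bound)

lemma suminf_resolvent_coeff_le: "(\<Sum>n. \<bar>resolvent_coeff l n\<bar>) \<le> total_weight / g\<^sup>2"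
proof -
  have "(\<Sum>n. \<bar>resolvent_coeff l n\<bar>) \<le> (\<Sum>n. level_weight n * (1 / g\<^sup>2))"
    by (rule suminf_le[OF resolvent_coeff_bound summable_resolvent_coeff summable_mult2[OF summable_level_weight]])
  also have "\<dots> = total_weight / g\<^sup>2"
    unfolding total_weight_def by (subst suminf_mult2[OF summable_level_weight, symmetric]) simp
  finally show ?thesis .
qed

lemma norm_resolvent_term: "norm (resolvent_coeff l n *\<^sub>R average_op n v) \<le> \<bar>resolvent_coeff l n\<bar> * norm v" for v :: "'a ell2"
  by (simp add: mult_left_mono norm_average_op)

lemma free_resolvent_sums:
  "(\<lambda>n. resolvent_coeff l n *\<^sub>R average_op n v) sums (free_resolvent l v - (1 / (total_weight - l)) *\<^sub>R v)"
  unfolding free_resolvent_def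
  by simp (intro summable_sums summable_comparison_test'[OF summable_mult2[OF summable_resolvent_coeff] norm_resolvent_term])

lemma linear_free_resolvent: "linear (free_resolvent l)"
proof (rule linearI)
  fix v w :: "'a ell2" and c :: real
  let ?t = "1 / (total_weight - l)"
  have "(\<lambda>n. resolvent_coeff l n *\<^sub>R average_op n v + resolvent_coeff l n *\<^sub>R average_op n w)
    sums ((free_resolvent l v - ?t *\<^sub>R v) + (free_resolvent l w - ?t *\<^sub>R w))"
    by (intro sums_add free_resolvent_sums)
  then have "(\<lambda>n. resolvent_coeff l n *\<^sub>R average_op n (v + w))
    sums ((free_resolvent l v - ?t *\<^sub>R v) + (free_resolvent l w - ?t *\<^sub>R w))"
    by (simp only: linear_add[OF linear_average_op] scaleR_add_right)
  from sums_unique2[OF this free_resolvent_sums[of "v + w"]]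
  show "free_resolvent l (v + w) = free_resolvent l v + free_resolvent l w" by (simp add: algebra_simps)
  have "(\<lambda>n. c *\<^sub>R (resolvent_coeff l n *\<^sub>R average_op n v)) sums (c *\<^sub>R (free_resolvent l v - ?t *\<^sub>R v))"
    by (intro sums_scaleR_right free_resolvent_sums)
  then have "(\<lambda>n. resolvent_coeff l n *\<^sub>R average_op n (c *\<^sub>R v)) sums (c *\<^sub>R (free_resolvent l v - ?t *\<^sub>R v))"
    by (simp add: linear_cmul[OF linear_average_op] mult.commute)
  from sums_unique2[OF this free_resolvent_sums[of "c *\<^sub>R v"]]
  show "free_resolvent l (c *\<^sub>R v) = c *\<^sub>R free_resolvent l v" by (simp add: algebra_simps)
qed

lemma norm_free_resolvent: "norm (free_resolvent l v) \<le> (\<bar>1 / (total_weight - l)\<bar> + total_weight / g\<^sup>2) * norm v"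
proof -
  have s: "summable (\<lambda>n. \<bar>resolvent_coeff l n\<bar> * norm v)" by (rule summable_mult2[OF summable_resolvent_coeff])
  have "norm (\<Sum>n. resolvent_coeff l n *\<^sub>R average_op n v) \<le> (\<Sum>n. \<bar>resolvent_coeff l n\<bar> * norm v)"
    by (rule norm_suminf_le[OF norm_resolvent_term s])
  also have "\<dots> = (\<Sum>n. \<bar>resolvent_coeff l n\<bar>) * norm v"
    by (rule suminf_mult2[OF summable_resolvent_coeff, symmetric])
  also have "\<dots> \<le> total_weight / g\<^sup>2 * norm v"
    by (intro mult_right_mono suminf_resolvent_coeff_le) auto
  finally have "norm (\<Sum>n. resolvent_coeff l n *\<^sub>R average_op n v) \<le> total_weight / g\<^sup>2 * norm v" .
  then show ?thesis unfolding free_resolvent_def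
    by (intro order_trans[OF norm_triangle_ineq]) (simp add: algebra_simps)
qed

text \<open>The partial sums \<open>A N\<close> of \<open>L - l\<close> and \<open>B N\<close> of the resolvent, applied to \<open>v\<close>, satisfy \<open>A N (B N) = v\<close> exactly, because both act as numbers
  on each range of \<open>P\<^sub>n\<^sub>-\<^sub>1 - P\<^sub>n\<close>; then \<open>N\<close> tends to infinity.\<close>

lemma laplacian_free_resolvent: "laplacian_op (free_resolvent l v) - l *\<^sub>R free_resolvent l v = v"
proof -
  define A where "A N w = (total_weight - l) *\<^sub>R w - (\<Sum>n<N. level_weight n *\<^sub>R average_op n w)" for N and w :: "'a ell2"
  define B where "B N = (1 / (total_weight - l)) *\<^sub>R v + (\<Sum>n<N. resolvent_coeff l n *\<^sub>R average_op n v)" for N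
  have ne: "level_eigenvalue n - l \<noteq> 0" for n using gap[of n] g_pos by auto
  have ev0: "level_eigenvalue 0 = total_weight" by (simp add: level_eigenvalue_def)
  have A_P: "A N (average_op N w) = (level_eigenvalue N - l) *\<^sub>R average_op N w" for N and w :: "'a ell2"
  proof -
    have "(\<Sum>n<N. level_weight n *\<^sub>R average_op n (average_op N w)) = (\<Sum>n<N. level_weight n *\<^sub>R average_op N w)"
      by (intro sum.cong) (auto simp: average_op_average_op)
    then show ?thesis by (simp add: A_def level_eigenvalue_def scaleR_sum_left[symmetric] algebra_simps)
  qed
  have P_B: "average_op N (B N) = (1 / (level_eigenvalue N - l)) *\<^sub>R average_op N v" for N
  proof -
    have "average_op N (B N) = (1 / (total_weight - l)) *\<^sub>R average_op N v + (\<Sum>n<N. resolvent_coeff l n *\<^sub>R average_op N (average_op n v))"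
      by (simp add: B_def linear_add[OF linear_average_op] linear_cmul[OF linear_average_op] linear_sum[OF linear_average_op])
    also have "(\<Sum>n<N. resolvent_coeff l n *\<^sub>R average_op N (average_op n v)) = (\<Sum>n<N. resolvent_coeff l n *\<^sub>R average_op N v)"
      by (intro sum.cong) (auto simp: average_op_average_op)
    also have "\<dots> = (\<Sum>n<N. resolvent_coeff l n) *\<^sub>R average_op N v" by (simp add: scaleR_sum_left)
    also have "(\<Sum>n<N. resolvent_coeff l n) = 1 / (level_eigenvalue N - l) - 1 / (level_eigenvalue 0 - l)"
      unfolding resolvent_coeff_def by (rule sum_lessThan_telescope)
    finally show ?thesis by (simp add: ev0 algebra_simps)
  qed
  have linA: "linear (A N)" for N
    unfolding A_def by (auto intro!: linearI simp: linear_add[OF linear_average_op] linear_cmul[OF linear_average_op]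
      sum.distrib scaleR_sum_right algebra_simps)
  have AB: "A N (B N) = v" for N
  proof (induction N)
    case 0
    show ?case using ne[of 0] by (simp add: A_def B_def ev0)
  next
    case (Suc N)
    let ?P = "average_op N v" and ?s = "resolvent_coeff l N" and ?c = "level_weight N"
    have BS: "B (Suc N) = B N + ?s *\<^sub>R ?P" by (simp add: B_def)
    have PBS: "average_op N (B (Suc N)) = (1 / (level_eigenvalue N - l) + ?s) *\<^sub>R ?P"
      by (simp add: BS P_B linear_add[OF linear_average_op] linear_cmul[OF linear_average_op]
          average_op_average_op scaleR_add_left)
    have "A (Suc N) (B (Suc N)) = A N (B (Suc N)) - ?c *\<^sub>R average_op N (B (Suc N))" by (simp add: A_def)
    also have "\<dots> = v + (?s * (level_eigenvalue N - l) - ?c * (1 / (level_eigenvalue N - l) + ?s)) *\<^sub>R ?P"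
      unfolding PBS by (simp add: BS linear_add[OF linA] linear_cmul[OF linA] Suc A_P algebra_simps)
    also have "?s * (level_eigenvalue N - l) - ?c * (1 / (level_eigenvalue N - l) + ?s) = 0"
    proof -
      define p q where "p = level_eigenvalue N - l" and "q = level_eigenvalue (Suc N) - l"
      have pq: "p \<noteq> 0" "q \<noteq> 0" "?c = p - q"
        unfolding p_def q_def using ne[of N] apply blast using ne[of "Suc N"] apply blast
        by (simp add: level_eigenvalue_def)
      show ?thesis unfolding resolvent_coeff_def p_def[symmetric] q_def[symmetric] pq(3)
        using pq(1,2) by (simp add: field_simps)
    qed
    finally show ?case by simp
  qed
  have A_lim: "(\<lambda>N. A N w) \<longlonglongrightarrow> laplacian_op w - l *\<^sub>R w" for w
  proof -
    have "(\<lambda>N. (\<Sum>n<N. level_weight n *\<^sub>R (w - average_op n w))) \<longlonglongrightarrow> laplacian_op w"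
      using laplacian_sums[of w] unfolding sums_def .
    moreover have "(\<lambda>N. (total_weight - (\<Sum>n<N. level_weight n)) *\<^sub>R w) \<longlonglongrightarrow> 0 *\<^sub>R w"
      using level_eigenvalue_tendsto_0 unfolding level_eigenvalue_def[abs_def] by (intro tendsto_scaleR tendsto_const)
    ultimately have "(\<lambda>N. (\<Sum>n<N. level_weight n *\<^sub>R (w - average_op n w)) + (total_weight - (\<Sum>n<N. level_weight n)) *\<^sub>R w - l *\<^sub>R w)
      \<longlonglongrightarrow> laplacian_op w + 0 *\<^sub>R w - l *\<^sub>R w"
      by (intro tendsto_diff tendsto_add tendsto_const)
    moreover have "(\<Sum>n<N. level_weight n *\<^sub>R (w - average_op n w)) + (total_weight - (\<Sum>n<N. level_weight n)) *\<^sub>R w - l *\<^sub>R w = A N w" for N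
      by (simp add: A_def scaleR_diff_right sum_subtractf scaleR_sum_left algebra_simps)
    ultimately show ?thesis by simp
  qed
  have B_lim: "B \<longlonglongrightarrow> free_resolvent l v"
  proof -
    have "(\<lambda>N. (1 / (total_weight - l)) *\<^sub>R v + (\<Sum>n<N. resolvent_coeff l n *\<^sub>R average_op n v))
      \<longlonglongrightarrow> (1 / (total_weight - l)) *\<^sub>R v + (free_resolvent l v - (1 / (total_weight - l)) *\<^sub>R v)"
      using free_resolvent_sums[of v] unfolding sums_def by (intro tendsto_add tendsto_const)
    then show ?thesis by (simp add: B_def[abs_def])
  qed
  define K where "K = \<bar>total_weight - l\<bar> + total_weight"
  have A_bound: "norm (A N w) \<le> K * norm w" for N w
  proof -
    have "norm (\<Sum>n<N. level_weight n *\<^sub>R average_op n w) \<le> (\<Sum>n<N. level_weight n * norm w)"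
      by (intro sum_norm_le) (simp add: level_weight_nonneg mult_left_mono norm_average_op)
    also have "\<dots> = (\<Sum>n<N. level_weight n) * norm w" by (simp add: sum_distrib_right)
    also have "\<dots> \<le> total_weight * norm w"
      unfolding total_weight_def
      by (intro mult_right_mono sum_le_suminf summable_level_weight) (auto simp: level_weight_nonneg)
    finally have *: "norm (\<Sum>n<N. level_weight n *\<^sub>R average_op n w) \<le> total_weight * norm w" .
    have "norm (A N w) \<le> norm ((total_weight - l) *\<^sub>R w) + norm (\<Sum>n<N. level_weight n *\<^sub>R average_op n w)"
      unfolding A_def by (rule norm_triangle_ineq4)
    also have "\<dots> \<le> \<bar>total_weight - l\<bar> * norm w + total_weight * norm w" using * by simp
    finally show ?thesis by (simp add: K_def distrib_right)
  qed
  let ?b = "free_resolvent l v"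
  have "(\<lambda>N. A N (B N - ?b)) \<longlonglongrightarrow> 0"
  proof (rule Lim_null_comparison)
    show "\<forall>\<^sub>F N in sequentially. norm (A N (B N - ?b)) \<le> K * norm (B N - ?b)" using A_bound by simp
    have "(\<lambda>N. K * norm (B N - ?b)) \<longlonglongrightarrow> K * norm (?b - ?b)"
      by (intro tendsto_mult tendsto_const tendsto_norm tendsto_diff B_lim)
    then show "(\<lambda>N. K * norm (B N - ?b)) \<longlonglongrightarrow> 0" by simp
  qed
  then have "(\<lambda>N. A N (B N - ?b) + A N ?b) \<longlonglongrightarrow> 0 + (laplacian_op ?b - l *\<^sub>R ?b)"
    by (intro tendsto_add A_lim)
  moreover have "A N (B N - ?b) + A N ?b = v" for N
    using AB[of N] by (simp add: linear_diff[OF linA])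
  ultimately show ?thesis by (simp add: LIMSEQ_const_iff)
qed

lemma free_resolvent_app_sums:
  "(\<lambda>n. resolvent_coeff l n * ell2_app (average_op n v) x) sums
    (ell2_app (free_resolvent l v) x - 1 / (total_weight - l) * ell2_app v x)"
  using bounded_linear.sums[OF bounded_linear_inner_right free_resolvent_sums, of "point_mass x" v] by simp

lemma free_resolvent_kernel_sym:
  "ell2_app (free_resolvent l (point_mass x)) y = ell2_app (free_resolvent l (point_mass y)) x"
proof -
  have "(\<lambda>n. resolvent_coeff l n * ell2_app (average_op n (point_mass y)) x) sums
    (ell2_app (free_resolvent l (point_mass x)) y - 1 / (total_weight - l) * ell2_app (point_mass x) y)"
    using free_resolvent_app_sums[of "point_mass x" y] unfolding average_kernel_sym[of _ x y] .
  from sums_unique2[OF this free_resolvent_app_sums[of "point_mass y" x]]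
  show ?thesis by (simp split: if_splits)
qed

text \<open>A ball containing both \<open>x\<close> and \<open>y\<close> has at least \<open>dist x y\<close> points, so the kernel of each ball average is at most
  \<open>1 / dist x y\<close> there.\<close>

lemma free_resolvent_kernel_decay:
  assumes "x \<noteq> y"
  shows "\<bar>ell2_app (free_resolvent l (point_mass y)) x\<bar> \<le> (total_weight / g\<^sup>2) / dist x y"
proof -
  have d: "dist x y > 0" using assms by simp
  have trm: "\<bar>resolvent_coeff l n * ell2_app (average_op n (point_mass y)) x\<bar> \<le> \<bar>resolvent_coeff l n\<bar> * (1 / dist x y)" for n
  proof -
    have "\<bar>ell2_app (average_op n (point_mass y)) x\<bar> \<le> 1 / dist x y"
      unfolding average_kernel using card_cball_ge[OF assms, of "real n"] d by (auto simp: divide_simps)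
    then show ?thesis unfolding abs_mult by (rule mult_left_mono) simp
  qed
  have s: "summable (\<lambda>n. \<bar>resolvent_coeff l n\<bar> * (1 / dist x y))" by (rule summable_mult2[OF summable_resolvent_coeff])
  have "ell2_app (free_resolvent l (point_mass y)) x = (\<Sum>n. resolvent_coeff l n * ell2_app (average_op n (point_mass y)) x)"
    using sums_unique[OF free_resolvent_app_sums[of "point_mass y" x]] assms by simp
  then have "norm (ell2_app (free_resolvent l (point_mass y)) x) \<le> (\<Sum>n. \<bar>resolvent_coeff l n\<bar> * (1 / dist x y))"
    using norm_suminf_le[OF _ s, of "\<lambda>n. resolvent_coeff l n * ell2_app (average_op n (point_mass y)) x"] trm by simp
  also have "\<dots> = (\<Sum>n. \<bar>resolvent_coeff l n\<bar>) * (1 / dist x y)"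
    by (rule suminf_mult2[OF summable_resolvent_coeff, symmetric])
  also have "\<dots> \<le> total_weight / g\<^sup>2 * (1 / dist x y)"
    by (intro mult_right_mono suminf_resolvent_coeff_le) auto
  finally show ?thesis by simp
qed

end

end

section \<open>Linear systems with random diagonal\<close>

lemma powr_subadditive:
  fixes x y s :: real
  assumes "x \<ge> 0" "y \<ge> 0" "0 < s" "s \<le> 1"
  shows "(x + y) powr s \<le> x powr s + y powr s"
proof (cases "x + y = 0")
  case False
  define z where "z = x + y"
  have z: "z > 0" using False assms by (simp add: z_def)
  have le: "u / z \<le> (u / z) powr s" if "0 \<le> u" "u \<le> z" for u
  proof (cases "u = 0")
    case False
    have "(u / z) powr 1 \<le> (u / z) powr s"
      using that z False assms by (intro powr_mono') (auto simp: divide_simps)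
    then show ?thesis using that z False by simp
  qed simp
  have "1 = x / z + y / z" using z by (simp add: z_def add_divide_distrib[symmetric])
  also have "\<dots> \<le> (x / z) powr s + (y / z) powr s"
    using assms by (intro add_mono le) (auto simp: z_def)
  also have "\<dots> = (x powr s + y powr s) / z powr s"
    using assms z by (simp add: powr_divide add_divide_distrib)
  finally show ?thesis using z by (simp add: z_def[symmetric] divide_simps)
qed (use assms in auto)

lemma powr_sum_subadditive:
  fixes f :: "'i \<Rightarrow> real"
  assumes "finite A" "0 < s" "s \<le> 1"
  shows "\<bar>\<Sum>i\<in>A. f i\<bar> powr s \<le> (\<Sum>i\<in>A. \<bar>f i\<bar> powr s)"
  using assms(1)
proof induction
  case (insert i A)
  have "\<bar>\<Sum>i\<in>insert i A. f i\<bar> powr s \<le> (\<bar>f i\<bar> + \<bar>\<Sum>i\<in>A. f i\<bar>) powr s"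
    using insert assms by (intro powr_mono2) auto
  also have "\<dots> \<le> \<bar>f i\<bar> powr s + \<bar>\<Sum>i\<in>A. f i\<bar> powr s"
    using assms by (intro powr_subadditive) auto
  finally show ?case using insert by simp
qed simp

text \<open>Solution of the symmetric system \<open>d\<^sub>i v\<^sub>i - \<Sum>\<^sub>l K\<^sub>i\<^sub>l v\<^sub>l = h\<^sub>i\<close> on a finite set \<open>S\<close> of \<open>m\<close> sites.  Each entry is computed with
  its own order of elimination, in which its site comes last: then neither the numerator nor the sum in the denominator
  involves \<open>d k\<close>.\<close>

primrec elim_solution :: "nat \<Rightarrow> (nat \<Rightarrow> real) \<Rightarrow> (nat \<Rightarrow> nat \<Rightarrow> real) \<Rightarrow> nat set \<Rightarrow> (nat \<Rightarrow> real) \<Rightarrow> nat \<Rightarrow> real" where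
  "elim_solution 0 d K S h k = 0"
| "elim_solution (Suc m) d K S h k =
     (h k + (\<Sum>l\<in>S - {k}. K k l * elim_solution m d K (S - {k}) h l)) /
     (d k - (\<Sum>l\<in>S - {k}. K k l * elim_solution m d K (S - {k}) (\<lambda>i. K i k) l))"

definition elim_pivot :: "nat \<Rightarrow> (nat \<Rightarrow> real) \<Rightarrow> (nat \<Rightarrow> nat \<Rightarrow> real) \<Rightarrow> nat set \<Rightarrow> nat \<Rightarrow> real" where
  "elim_pivot m d K S k = d k - (\<Sum>l\<in>S - {k}. K k l * elim_solution m d K (S - {k}) (\<lambda>i. K i k) l)"

lemma elim_solution_cong:
  "card S = m \<Longrightarrow> finite S \<Longrightarrow> (\<And>i. i \<in> S \<Longrightarrow> d i = d' i) \<Longrightarrow> k \<in> S \<Longrightarrow>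
    elim_solution m d K S h k = elim_solution m d' K S h k"
proof (induction m arbitrary: S h k)
  case (Suc m)
  have "card (S - {k}) = m" using Suc.prems by simp
  then have "elim_solution m d K (S - {k}) h' l = elim_solution m d' K (S - {k}) h' l" if "l \<in> S - {k}" for h' l
    using Suc.prems that by (intro Suc.IH) auto
  then show ?case using Suc.prems by simp
qed simp

definition system_op :: "(nat \<Rightarrow> real) \<Rightarrow> (nat \<Rightarrow> nat \<Rightarrow> real) \<Rightarrow> nat set \<Rightarrow> (nat \<Rightarrow> real) \<Rightarrow> nat \<Rightarrow> real" where
  "system_op d K S x i = d i * x i - (\<Sum>l\<in>S. K i l * x l)"

lemma system_op_symmetric:
  assumes "\<And>i l. K i l = K l i"
  shows "(\<Sum>i\<in>S. x i * system_op d K S y i) = (\<Sum>i\<in>S. system_op d K S x i * y i)"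
proof -
  have "(\<Sum>i\<in>S. \<Sum>l\<in>S. x i * (K i l * y l)) = (\<Sum>l\<in>S. \<Sum>i\<in>S. x i * (K i l * y l))" by (rule sum.swap)
  also have "\<dots> = (\<Sum>i\<in>S. \<Sum>l\<in>S. K i l * x l * y i)"
    by (intro sum.cong refl) (simp add: assms mult_ac)
  finally have swap: "(\<Sum>i\<in>S. \<Sum>l\<in>S. x i * (K i l * y l)) = (\<Sum>i\<in>S. \<Sum>l\<in>S. K i l * x l * y i)" .
  have "(\<Sum>i\<in>S. x i * system_op d K S y i) = (\<Sum>i\<in>S. x i * (d i * y i)) - (\<Sum>i\<in>S. \<Sum>l\<in>S. x i * (K i l * y l))"
    by (simp add: system_op_def right_diff_distrib sum_subtractf sum_distrib_left)
  also have "\<dots> = (\<Sum>i\<in>S. d i * x i * y i) - (\<Sum>i\<in>S. \<Sum>l\<in>S. K i l * x l * y i)"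
    unfolding swap by (simp add: mult_ac)
  also have "\<dots> = (\<Sum>i\<in>S. system_op d K S x i * y i)"
    by (simp add: system_op_def left_diff_distrib sum_subtractf sum_distrib_right)
  finally show ?thesis .
qed

text \<open>For each site \<open>k\<close> the vector \<open>w h k\<close>, obtained by eliminating \<open>k\<close> and substituting back, solves the system, but only its
  entry at \<open>k\<close> is \<open>elim_solution\<close>.  The vectors for different \<open>k\<close> coincide because solutions are unique: if \<open>A x = 0\<close> for the
  symmetric matrix \<open>A\<close> of the system, then \<open>x\<^sub>j = \<langle>x, A w\<rangle> = \<langle>A x, w\<rangle> = 0\<close>, where \<open>w\<close> solves the system with right-hand side
  \<open>e\<^sub>j\<close>.\<close>

lemma elim_solution_solves:
  assumes sym: "\<And>i l. K i l = K l i" and diag: "\<And>i. K i i = 0"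
  shows "card S = m \<Longrightarrow> finite S \<Longrightarrow>
    (\<And>R k. R \<subseteq> S \<Longrightarrow> k \<in> R \<Longrightarrow> elim_pivot (card R - 1) d K R k \<noteq> 0) \<Longrightarrow>
    i \<in> S \<Longrightarrow> system_op d K S (elim_solution m d K S h) i = h i"
proof (induction m arbitrary: S h i)
  case (Suc m)
  define w where "w h k l = (if l = k then elim_solution (Suc m) d K S h k else
    elim_solution m d K (S - {k}) h l + elim_solution m d K (S - {k}) (\<lambda>i. K i k) l * elim_solution (Suc m) d K S h k)" for h k l
  have w_solves: "system_op d K S (w h k) i = h i" if k: "k \<in> S" and i: "i \<in> S" for h k i
  proof -
    let ?R = "S - {k}" and ?wk = "elim_solution (Suc m) d K S h k"
    let ?v = "elim_solution m d K (S - {k}) h" and ?g = "elim_solution m d K (S - {k}) (\<lambda>i. K i k)"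
    have cardR: "card ?R = m" and finR: "finite ?R" using Suc.prems k by auto
    have IH: "system_op d K ?R (elim_solution m d K ?R h') j = h' j" if "j \<in> ?R" for h' j
      by (rule Suc.IH[OF cardR finR _ that]) (use Suc.prems(3) in blast)
    have split: "(\<Sum>l\<in>S. K j l * w h k l) = K j k * ?wk + ((\<Sum>l\<in>?R. K j l * ?v l) + (\<Sum>l\<in>?R. K j l * ?g l) * ?wk)" for j
    proof -
      have "(\<Sum>l\<in>S. K j l * w h k l) = K j k * w h k k + (\<Sum>l\<in>?R. K j l * w h k l)"
        using Suc.prems(2) k by (rule sum.remove)
      also have "(\<Sum>l\<in>?R. K j l * w h k l) = (\<Sum>l\<in>?R. K j l * ?v l + K j l * ?g l * ?wk)"
        by (intro sum.cong refl) (simp add: w_def algebra_simps del: elim_solution.simps)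
      finally show ?thesis by (simp add: w_def sum.distrib sum_distrib_right del: elim_solution.simps)
    qed
    show ?thesis
    proof (cases "i = k")
      case True
      define P where "P = elim_pivot m d K S k"
      have P: "P \<noteq> 0" using Suc.prems(3)[of S k] Suc.prems(1) k by (simp add: P_def)
      have wkP: "?wk * P = h k + (\<Sum>l\<in>?R. K k l * ?v l)"
        using P unfolding P_def elim_pivot_def by simp
      have dk: "d k = P + (\<Sum>l\<in>?R. K k l * ?g l)" by (simp add: P_def elim_pivot_def)
      have "system_op d K S (w h k) i = d k * ?wk - (K k k * ?wk + ((\<Sum>l\<in>?R. K k l * ?v l) + (\<Sum>l\<in>?R. K k l * ?g l) * ?wk))"
        unfolding system_op_def split using True by (simp add: w_def del: elim_solution.simps)
      also have "\<dots> = ?wk * P - (\<Sum>l\<in>?R. K k l * ?v l)"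
        unfolding dk diag by (simp add: algebra_simps del: elim_solution.simps)
      also have "\<dots> = h i" unfolding wkP using True by simp
      finally show ?thesis .
    next
      case False
      then have iR: "i \<in> ?R" using i by simp
      have "system_op d K S (w h k) i = system_op d K ?R ?v i + system_op d K ?R ?g i * ?wk - K i k * ?wk"
        unfolding system_op_def split using False
        by (simp add: w_def algebra_simps del: elim_solution.simps)
      then show ?thesis by (simp add: IH[OF iR] del: elim_solution.simps)
    qed
  qed
  have inj: "x j = 0" if x: "\<And>i. i \<in> S \<Longrightarrow> system_op d K S x i = 0" and j: "j \<in> S" for x j
  proof -
    define e where "e i = (if i = j then 1 else 0 :: real)" for i
    have "x j = (\<Sum>i\<in>S. if i = j then x i else 0)" using j Suc.prems(2) by simp
    also have "\<dots> = (\<Sum>i\<in>S. x i * e i)" by (intro sum.cong) (auto simp: e_def)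
    also have "\<dots> = (\<Sum>i\<in>S. x i * system_op d K S (w e j) i)"
      by (intro sum.cong refl) (simp add: w_solves[OF j])
    also have "\<dots> = (\<Sum>i\<in>S. system_op d K S x i * w e j i)" by (rule system_op_symmetric[OF sym])
    also have "\<dots> = 0" using x by simp
    finally show ?thesis .
  qed
  have entry: "elim_solution (Suc m) d K S h k = w h i k" if k: "k \<in> S" for k
  proof -
    have "w h k k - w h i k = 0"
    proof (rule inj[of "\<lambda>l. w h k l - w h i l", OF _ k])
      fix j assume j: "j \<in> S"
      have "system_op d K S (\<lambda>l. w h k l - w h i l) j = system_op d K S (w h k) j - system_op d K S (w h i) j"
        by (simp add: system_op_def right_diff_distrib sum_subtractf)
      then show "system_op d K S (\<lambda>l. w h k l - w h i l) j = 0"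
        using w_solves[OF k j] w_solves[OF Suc.prems(4) j] by simp
    qed
    then show ?thesis by (simp add: w_def[of h k k] del: elim_solution.simps)
  qed
  have "system_op d K S (elim_solution (Suc m) d K S h) i = system_op d K S (w h i) i"
    unfolding system_op_def using entry Suc.prems(4) by (simp del: elim_solution.simps cong: sum.cong)
  then show ?case using w_solves[OF Suc.prems(4) Suc.prems(4)] by (simp del: elim_solution.simps)
qed simp

text \<open>The recursion of \<open>elim_solution\<close> for fractional moments, with \<open>c\<close> in place of the inverse of the pivot and the sum extended
  to all sites.\<close>

primrec moment_majorant :: "real \<Rightarrow> (nat \<Rightarrow> nat \<Rightarrow> real) \<Rightarrow> nat set \<Rightarrow> (nat \<Rightarrow> real) \<Rightarrow> nat \<Rightarrow> nat \<Rightarrow> real" where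
  "moment_majorant c \<kappa> S h 0 k = 0"
| "moment_majorant c \<kappa> S h (Suc m) k = c * (h k + (\<Sum>l\<in>S. \<kappa> k l * moment_majorant c \<kappa> S h m l))"

lemma moment_majorant_nonneg:
  assumes "c \<ge> 0" "\<And>k l. \<kappa> k l \<ge> 0" "\<And>k. h k \<ge> 0"
  shows "moment_majorant c \<kappa> S h m k \<ge> 0"
  by (induction m arbitrary: k) (auto intro!: mult_nonneg_nonneg add_nonneg_nonneg sum_nonneg assms)

lemma sum_moment_majorant:
  assumes c: "c \<ge> 0" and \<kappa>: "\<And>k l. \<kappa> k l \<ge> 0" and h: "\<And>k. h k \<ge> 0"
    and small: "\<And>l. l \<in> S \<Longrightarrow> c * (\<Sum>k\<in>S. \<kappa> k l) \<le> 1/2"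
  shows "(\<Sum>k\<in>S. moment_majorant c \<kappa> S h m k) \<le> 2 * c * (\<Sum>k\<in>S. h k)"
proof (induction m)
  case 0
  then show ?case using c h by (simp add: sum_nonneg)
next
  case (Suc m)
  let ?B = "moment_majorant c \<kappa> S h m"
  have "(\<Sum>k\<in>S. moment_majorant c \<kappa> S h (Suc m) k) = c * (\<Sum>k\<in>S. h k) + (\<Sum>k\<in>S. \<Sum>l\<in>S. c * (\<kappa> k l * ?B l))"
    by (simp add: distrib_left sum.distrib sum_distrib_left)
  also have "(\<Sum>k\<in>S. \<Sum>l\<in>S. c * (\<kappa> k l * ?B l)) = (\<Sum>l\<in>S. \<Sum>k\<in>S. c * (\<kappa> k l * ?B l))" by (rule sum.swap)
  also have "\<dots> = (\<Sum>l\<in>S. (c * (\<Sum>k\<in>S. \<kappa> k l)) * ?B l)"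
    by (simp add: sum_distrib_left sum_distrib_right mult_ac)
  also have "\<dots> \<le> (\<Sum>l\<in>S. 1/2 * ?B l)"
    by (intro sum_mono mult_right_mono small moment_majorant_nonneg c \<kappa> h)
  also have "\<dots> = 1/2 * (\<Sum>l\<in>S. ?B l)" by (simp add: sum_distrib_left)
  finally show ?case using Suc by linarith
qed

definition diagonal :: "(nat \<Rightarrow> real) \<Rightarrow> (nat \<Rightarrow> real) \<Rightarrow> nat \<Rightarrow> real" where
  "diagonal \<gamma> \<tau> k = 1 / \<tau> k - \<gamma> k"

locale iid_couplings =
  fixes D :: "real measure"
  assumes prob_D: "prob_space D" and sets_D: "sets D = sets borel"
begin

sublocale D: prob_space D by (rule prob_D)

definition couplings :: "(nat \<Rightarrow> real) measure" where
  "couplings = PiM UNIV (\<lambda>_. D)"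

lemma prob_couplings: "prob_space couplings"
  unfolding couplings_def by (intro prob_space_PiM prob_D)

sublocale couplings: prob_space couplings by (rule prob_couplings)

lemma space_D [simp]: "space D = UNIV"
  using sets_eq_imp_space_eq[OF sets_D] by simp

lemma space_couplings [simp]: "space couplings = UNIV"
  by (simp add: couplings_def space_PiM)

lemma measurable_component [measurable]: "(\<lambda>\<tau>. \<tau> k) \<in> borel_measurable couplings"
proof -
  have "(\<lambda>\<tau>. \<tau> k) \<in> measurable couplings D" unfolding couplings_def by (rule measurable_component_singleton) simp
  then show ?thesis by (simp add: measurable_cong_sets[OF refl sets_D])
qed

lemma measurable_update [measurable]: "(\<lambda>(t, \<tau>). \<tau>(k := t)) \<in> measurable (D \<Otimes>\<^sub>M couplings) couplings"
  unfolding couplings_def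
proof (rule measurable_PiM_single')
  fix i :: nat
  show "(\<lambda>p. (case p of (t, \<tau>) \<Rightarrow> \<tau>(k := t)) i) \<in> measurable (D \<Otimes>\<^sub>M PiM UNIV (\<lambda>_. D)) D"
    by (cases "i = k") (auto simp: case_prod_beta' intro!: measurable_compose[OF measurable_snd measurable_component_singleton])
qed (auto simp: space_pair_measure)

text \<open>Replacing the coupling at \<open>k\<close> by an independent copy does not change the law of the family.\<close>

lemma nn_integral_couplings:
  assumes f: "f \<in> borel_measurable couplings"
  shows "(\<integral>\<^sup>+\<tau>. f \<tau> \<partial>couplings) = (\<integral>\<^sup>+\<tau>. (\<integral>\<^sup>+t. f (\<tau>(k := t)) \<partial>D) \<partial>couplings)"
proof -
  interpret pair_sigma_finite D couplings ..
  have "distr (D \<Otimes>\<^sub>M couplings) couplings (\<lambda>(t, \<tau>). \<tau>(k := t)) = couplings"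
    using distr_pair_PiM_eq_PiM[of UNIV "\<lambda>_. D" k] prob_D unfolding couplings_def by simp
  then have "(\<integral>\<^sup>+\<tau>. f \<tau> \<partial>couplings) = (\<integral>\<^sup>+\<tau>. f \<tau> \<partial>distr (D \<Otimes>\<^sub>M couplings) couplings (\<lambda>(t, \<tau>). \<tau>(k := t)))" by simp
  also have "\<dots> = (\<integral>\<^sup>+p. f ((\<lambda>(t, \<tau>). \<tau>(k := t)) p) \<partial>(D \<Otimes>\<^sub>M couplings))"
    by (rule nn_integral_distr[OF measurable_update]) (simp add: f)
  also have "\<dots> = (\<integral>\<^sup>+p. (\<lambda>(t, \<tau>). f (\<tau>(k := t))) p \<partial>(D \<Otimes>\<^sub>M couplings))"
    by (simp add: case_prod_beta')
  also have "\<dots> = (\<integral>\<^sup>+\<tau>. (\<integral>\<^sup>+t. f (\<tau>(k := t)) \<partial>D) \<partial>couplings)"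
    by (subst nn_integral_snd[symmetric]) (use measurable_compose[OF measurable_update f] in \<open>auto simp: case_prod_beta'\<close>)
  finally show ?thesis .
qed

lemma measurable_elim_solution [measurable]:
  assumes d: "\<And>k. (\<lambda>\<tau>. d \<tau> k) \<in> borel_measurable N"
  shows "(\<lambda>\<tau>. elim_solution m (d \<tau>) K S h k) \<in> borel_measurable N"
proof (induction m arbitrary: S h k)
  case (Suc m)
  note [measurable] = Suc d
  show ?case unfolding elim_solution.simps by measurable
qed simp

context
  fixes s c :: real and \<gamma> :: "nat \<Rightarrow> real" and K :: "nat \<Rightarrow> nat \<Rightarrow> real"
  assumes s: "0 < s" "s \<le> 1" and c: "c \<ge> 0"
    and negative_moment: "\<And>e. (\<integral>\<^sup>+t. ennreal (\<bar>1 / t - e\<bar> powr - s) \<partial>D) \<le> ennreal c"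
    and no_atom: "\<And>e. AE t in D. 1 / t \<noteq> e"
begin

lemma diagonal_measurable [measurable]: "(\<lambda>\<tau>. diagonal \<gamma> \<tau> k) \<in> borel_measurable couplings"
  unfolding diagonal_def by measurable

lemma diagonal_update: "diagonal \<gamma> (\<tau>(k := t)) k = 1 / t - \<gamma> k" "i \<noteq> k \<Longrightarrow> diagonal \<gamma> (\<tau>(k := t)) i = diagonal \<gamma> \<tau> i"
  by (auto simp: diagonal_def)

text \<open>Integrate first over the coupling at \<open>k\<close>, on which neither the numerator nor the shift \<open>cf\<close> of the pivot depends: the
  pivot contributes the factor \<open>c\<close>, and the numerator is handled by subadditivity of \<open>x \<mapsto> x powr s\<close>.\<close>

lemma elim_solution_moment:
  "card S = m \<Longrightarrow> finite S \<Longrightarrow> S \<subseteq> U \<Longrightarrow> finite U \<Longrightarrow> k \<in> S \<Longrightarrow>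
    (\<integral>\<^sup>+\<tau>. ennreal (\<bar>elim_solution m (diagonal \<gamma> \<tau>) K S h k\<bar> powr s) \<partial>couplings)
     \<le> ennreal (moment_majorant c (\<lambda>k l. \<bar>K k l\<bar> powr s) U (\<lambda>k. \<bar>h k\<bar> powr s) m k)"
proof (induction m arbitrary: S k)
  case (Suc m)
  let ?R = "S - {k}"
  let ?\<kappa> = "\<lambda>k l. \<bar>K k l\<bar> powr s" and ?h = "\<lambda>k. \<bar>h k\<bar> powr s"
  define num where "num \<tau> = h k + (\<Sum>l\<in>?R. K k l * elim_solution m (diagonal \<gamma> \<tau>) K ?R h l)" for \<tau>
  define cf where "cf \<tau> = (\<Sum>l\<in>?R. K k l * elim_solution m (diagonal \<gamma> \<tau>) K ?R (\<lambda>i. K i k) l)" for \<tau>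
  have R: "card ?R = m" "finite ?R" "?R \<subseteq> U" using Suc.prems by auto
  have [measurable]: "num \<in> borel_measurable couplings" "cf \<in> borel_measurable couplings"
    unfolding num_def cf_def by measurable
  have upd: "elim_solution m (diagonal \<gamma> (\<tau>(k := t))) K ?R h' l = elim_solution m (diagonal \<gamma> \<tau>) K ?R h' l" if "l \<in> ?R" for \<tau> t h' l
    by (rule elim_solution_cong[OF R(1,2) _ that]) (auto simp: diagonal_update)
  have num_upd: "num (\<tau>(k := t)) = num \<tau>" and cf_upd: "cf (\<tau>(k := t)) = cf \<tau>" for \<tau> t
    unfolding num_def cf_def
    by (intro arg_cong2[where f="(+)"] sum.cong refl arg_cong2[where f="(*)"] upd, assumption)+
  have B0: "moment_majorant c ?\<kappa> U ?h m l \<ge> 0" for l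
    by (rule moment_majorant_nonneg) (use c in auto)
  have "(\<integral>\<^sup>+\<tau>. ennreal (\<bar>elim_solution (Suc m) (diagonal \<gamma> \<tau>) K S h k\<bar> powr s) \<partial>couplings)
      = (\<integral>\<^sup>+\<tau>. ennreal (\<bar>num \<tau>\<bar> powr s) * ennreal (\<bar>diagonal \<gamma> \<tau> k - cf \<tau>\<bar> powr - s) \<partial>couplings)"
  proof (rule nn_integral_cong)
    fix \<tau>
    have "\<bar>num \<tau> / (diagonal \<gamma> \<tau> k - cf \<tau>)\<bar> powr s = \<bar>num \<tau>\<bar> powr s * \<bar>diagonal \<gamma> \<tau> k - cf \<tau>\<bar> powr - s"
      by (simp only: abs_divide) (simp add: powr_divide powr_minus_divide)
    then show "ennreal (\<bar>elim_solution (Suc m) (diagonal \<gamma> \<tau>) K S h k\<bar> powr s)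
      = ennreal (\<bar>num \<tau>\<bar> powr s) * ennreal (\<bar>diagonal \<gamma> \<tau> k - cf \<tau>\<bar> powr - s)"
      by (simp add: num_def[symmetric] cf_def[symmetric] ennreal_mult[symmetric])
  qed
  also have "\<dots> = (\<integral>\<^sup>+\<tau>. (\<integral>\<^sup>+t. ennreal (\<bar>num \<tau>\<bar> powr s) * ennreal (\<bar>1 / t - (\<gamma> k + cf \<tau>)\<bar> powr - s) \<partial>D) \<partial>couplings)"
    by (subst nn_integral_couplings[of _ k]) (auto simp: num_upd cf_upd diagonal_update diff_diff_eq)
  also have "\<dots> \<le> (\<integral>\<^sup>+\<tau>. ennreal (\<bar>num \<tau>\<bar> powr s) * ennreal c \<partial>couplings)"
  proof (rule nn_integral_mono)
    fix \<tau>
    have "(\<lambda>t. ennreal (\<bar>1 / t - (\<gamma> k + cf \<tau>)\<bar> powr - s)) \<in> borel_measurable D"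
      by (subst measurable_cong_sets[OF sets_D refl]) measurable
    then have "(\<integral>\<^sup>+t. ennreal (\<bar>num \<tau>\<bar> powr s) * ennreal (\<bar>1 / t - (\<gamma> k + cf \<tau>)\<bar> powr - s) \<partial>D)
      = ennreal (\<bar>num \<tau>\<bar> powr s) * (\<integral>\<^sup>+t. ennreal (\<bar>1 / t - (\<gamma> k + cf \<tau>)\<bar> powr - s) \<partial>D)"
      by (rule nn_integral_cmult)
    also have "\<dots> \<le> ennreal (\<bar>num \<tau>\<bar> powr s) * ennreal c" by (intro mult_left_mono negative_moment) auto
    finally show "(\<integral>\<^sup>+t. ennreal (\<bar>num \<tau>\<bar> powr s) * ennreal (\<bar>1 / t - (\<gamma> k + cf \<tau>)\<bar> powr - s) \<partial>D)
      \<le> ennreal (\<bar>num \<tau>\<bar> powr s) * ennreal c" .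
  qed
  also have "\<dots> \<le> (\<integral>\<^sup>+\<tau>. (ennreal (?h k) + (\<Sum>l\<in>?R. ennreal (?\<kappa> k l) * ennreal (\<bar>elim_solution m (diagonal \<gamma> \<tau>) K ?R h l\<bar> powr s))) * ennreal c \<partial>couplings)"
  proof (intro nn_integral_mono mult_right_mono)
    fix \<tau>
    let ?x = "elim_solution m (diagonal \<gamma> \<tau>) K ?R h"
    have "\<bar>num \<tau>\<bar> powr s \<le> (\<bar>h k\<bar> + \<bar>\<Sum>l\<in>?R. K k l * ?x l\<bar>) powr s"
      unfolding num_def using s by (intro powr_mono2) auto
    also have "\<dots> \<le> ?h k + \<bar>\<Sum>l\<in>?R. K k l * ?x l\<bar> powr s"
      using s by (intro powr_subadditive) auto
    also have "\<dots> \<le> ?h k + (\<Sum>l\<in>?R. \<bar>K k l * ?x l\<bar> powr s)"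
      using powr_sum_subadditive[OF R(2) s] by (intro add_left_mono)
    also have "\<dots> = ?h k + (\<Sum>l\<in>?R. ?\<kappa> k l * \<bar>?x l\<bar> powr s)" by (simp add: abs_mult powr_mult)
    finally have "ennreal (\<bar>num \<tau>\<bar> powr s) \<le> ennreal (?h k + (\<Sum>l\<in>?R. ?\<kappa> k l * \<bar>?x l\<bar> powr s))" by (rule ennreal_leI)
    also have "\<dots> = ennreal (?h k) + (\<Sum>l\<in>?R. ennreal (?\<kappa> k l) * ennreal (\<bar>?x l\<bar> powr s))"
      by (simp add: sum_nonneg ennreal_mult flip: sum_ennreal)
    finally show "ennreal (\<bar>num \<tau>\<bar> powr s) \<le> ennreal (?h k) + (\<Sum>l\<in>?R. ennreal (?\<kappa> k l) * ennreal (\<bar>?x l\<bar> powr s))" .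
  qed simp
  also have "\<dots> = (ennreal (?h k) + (\<Sum>l\<in>?R. ennreal (?\<kappa> k l) * (\<integral>\<^sup>+\<tau>. ennreal (\<bar>elim_solution m (diagonal \<gamma> \<tau>) K ?R h l\<bar> powr s) \<partial>couplings))) * ennreal c"
    by (simp add: nn_integral_multc nn_integral_add nn_integral_sum nn_integral_cmult couplings.emeasure_space_1[unfolded space_couplings])
  also have "\<dots> \<le> (ennreal (?h k) + (\<Sum>l\<in>?R. ennreal (?\<kappa> k l) * ennreal (moment_majorant c ?\<kappa> U ?h m l))) * ennreal c"
    by (intro mult_right_mono add_left_mono sum_mono mult_left_mono Suc.IH R Suc.prems(4)) auto
  also have "\<dots> = ennreal ((?h k + (\<Sum>l\<in>?R. ?\<kappa> k l * moment_majorant c ?\<kappa> U ?h m l)) * c)"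
    using B0 c by (simp add: ennreal_mult sum_nonneg flip: sum_ennreal)
  also have "\<dots> \<le> ennreal (moment_majorant c ?\<kappa> U ?h (Suc m) k)"
  proof (rule ennreal_leI)
    have "(\<Sum>l\<in>?R. ?\<kappa> k l * moment_majorant c ?\<kappa> U ?h m l) \<le> (\<Sum>l\<in>U. ?\<kappa> k l * moment_majorant c ?\<kappa> U ?h m l)"
      using R Suc.prems B0 by (intro sum_mono2) auto
    then show "(?h k + (\<Sum>l\<in>?R. ?\<kappa> k l * moment_majorant c ?\<kappa> U ?h m l)) * c \<le> moment_majorant c ?\<kappa> U ?h (Suc m) k"
      using c by (simp add: mult.commute mult_left_mono)
  qed
  finally show ?case .
qed simp

text \<open>A pivot is \<open>1 / \<tau>\<^sub>k\<close> minus a quantity independent of \<open>\<tau>\<^sub>k\<close>, and \<open>1 / \<tau>\<^sub>k\<close> has no atoms.\<close>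

lemma AE_elim_pivot_nonzero:
  "AE \<tau> in couplings. \<forall>R k. finite R \<longrightarrow> k \<in> R \<longrightarrow> elim_pivot (card R - 1) (diagonal \<gamma> \<tau>) K R k \<noteq> 0"
proof -
  have single: "AE \<tau> in couplings. elim_pivot (card R - 1) (diagonal \<gamma> \<tau>) K R k \<noteq> 0" if R: "finite R" "k \<in> R" for R k
  proof -
    let ?R = "R - {k}"
    define cf where "cf \<tau> = (\<Sum>l\<in>?R. K k l * elim_solution (card R - 1) (diagonal \<gamma> \<tau>) K ?R (\<lambda>i. K i k) l)" for \<tau>
    have [measurable]: "cf \<in> borel_measurable couplings" unfolding cf_def by measurable
    have cR: "card ?R = card R - 1" "finite ?R" using R by auto
    have cf_upd: "cf (\<tau>(k := t)) = cf \<tau>" for \<tau> t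
      unfolding cf_def
      by (intro sum.cong refl arg_cong2[where f="(*)"] elim_solution_cong[OF cR]) (auto simp: diagonal_update)
    have "(\<integral>\<^sup>+\<tau>. indicator {\<tau>. diagonal \<gamma> \<tau> k - cf \<tau> = 0} \<tau> \<partial>couplings)
      = (\<integral>\<^sup>+\<tau>. (\<integral>\<^sup>+t. indicator {\<tau>. diagonal \<gamma> \<tau> k - cf \<tau> = 0} (\<tau>(k := t)) \<partial>D) \<partial>couplings)"
      by (rule nn_integral_couplings) measurable
    also have "\<dots> = (\<integral>\<^sup>+\<tau>. (\<integral>\<^sup>+t. 0 \<partial>D) \<partial>couplings)"
    proof (rule nn_integral_cong, rule nn_integral_cong_AE)
      fix \<tau>
      show "AE t in D. indicator {\<tau>. diagonal \<gamma> \<tau> k - cf \<tau> = 0} (\<tau>(k := t)) = (0::ennreal)"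
        using no_atom[of "\<gamma> k + cf \<tau>"] by eventually_elim (auto simp: indicator_def diagonal_update cf_upd)
    qed
    finally have "(\<integral>\<^sup>+\<tau>. indicator {\<tau>. diagonal \<gamma> \<tau> k - cf \<tau> = 0} \<tau> \<partial>couplings) = 0" by simp
    then have "AE \<tau> in couplings. indicator {\<tau>. diagonal \<gamma> \<tau> k - cf \<tau> = 0} \<tau> = (0::ennreal)"
      by (subst (asm) nn_integral_0_iff_AE) measurable
    then show ?thesis
      unfolding elim_pivot_def cf_def[symmetric] by eventually_elim (auto simp: indicator_def split: if_splits)
  qed
  have "countable {R :: nat set. finite R}" by (rule countable_Collect_finite)
  then have "AE \<tau> in couplings. \<forall>R\<in>{R. finite R}. \<forall>k\<in>R. elim_pivot (card R - 1) (diagonal \<gamma> \<tau>) K R k \<noteq> 0"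
  proof (subst AE_ball_countable, assumption, intro ballI)
    fix R :: "nat set" assume "R \<in> {R. finite R}"
    then have "finite R" by simp
    then show "AE \<tau> in couplings. \<forall>k\<in>R. elim_pivot (card R - 1) (diagonal \<gamma> \<tau>) K R k \<noteq> 0"
      using single by (subst AE_finite_all) auto
  qed
  then show ?thesis by eventually_elim auto
qed

text \<open>The expectations of \<open>\<Sum>\<^sub>k \<bar>v\<^sub>k\<bar> powr s\<close> are bounded uniformly in the volume, so by Fatou's lemma the lower limit of these sums
  is almost surely finite.\<close>

lemma AE_bounded_solutions:
  assumes sym: "\<And>i l. K i l = K l i" and diag: "\<And>i. K i i = 0"
    and small: "\<And>n l. l \<in> {n0..<n} \<Longrightarrow> c * (\<Sum>k\<in>{n0..<n}. \<bar>K k l\<bar> powr s) \<le> 1/2"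
    and h: "\<And>n. (\<Sum>k\<in>{n0..<n}. \<bar>h k\<bar> powr s) \<le> Hb"
  shows "AE \<tau> in couplings. \<exists>B. \<exists>\<^sub>\<infinity>n. \<exists>v. (\<Sum>k\<in>{n0..<n}. \<bar>v k\<bar> powr s) \<le> B \<and>
     (\<forall>i\<in>{n0..<n}. system_op (diagonal \<gamma> \<tau>) K {n0..<n} v i = h i)"
proof -
  define v where "v n \<tau> = elim_solution (card {n0..<n}) (diagonal \<gamma> \<tau>) K {n0..<n} h" for n \<tau>
  define X where "X n \<tau> = ennreal (\<Sum>k\<in>{n0..<n}. \<bar>v n \<tau> k\<bar> powr s)" for n \<tau>
  have [measurable]: "(\<lambda>\<tau>. v n \<tau> k) \<in> borel_measurable couplings" for n k
    unfolding v_def by measurable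
  have X_meas [measurable]: "X n \<in> borel_measurable couplings" for n
    unfolding X_def by measurable
  have X_int: "(\<integral>\<^sup>+\<tau>. X n \<tau> \<partial>couplings) \<le> ennreal (2 * c * Hb)" for n
  proof -
    let ?S = "{n0..<n}" and ?\<kappa> = "\<lambda>k l. \<bar>K k l\<bar> powr s" and ?h = "\<lambda>k. \<bar>h k\<bar> powr s"
    have "(\<integral>\<^sup>+\<tau>. X n \<tau> \<partial>couplings) = (\<Sum>k\<in>?S. (\<integral>\<^sup>+\<tau>. ennreal (\<bar>v n \<tau> k\<bar> powr s) \<partial>couplings))"
      unfolding X_def by (simp add: nn_integral_sum flip: sum_ennreal)
    also have "\<dots> \<le> (\<Sum>k\<in>?S. ennreal (moment_majorant c ?\<kappa> ?S ?h (card ?S) k))"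
      unfolding v_def by (intro sum_mono elim_solution_moment) auto
    also have "\<dots> = ennreal (\<Sum>k\<in>?S. moment_majorant c ?\<kappa> ?S ?h (card ?S) k)"
      by (intro sum_ennreal moment_majorant_nonneg) (use c in auto)
    also have "\<dots> \<le> ennreal (2 * c * (\<Sum>k\<in>?S. ?h k))"
      by (intro ennreal_leI sum_moment_majorant small) (use c in auto)
    also have "\<dots> \<le> ennreal (2 * c * Hb)"
      using c h by (intro ennreal_leI mult_left_mono) auto
    finally show ?thesis .
  qed
  have "(\<integral>\<^sup>+\<tau>. liminf (\<lambda>n. X n \<tau>) \<partial>couplings) \<le> liminf (\<lambda>n. \<integral>\<^sup>+\<tau>. X n \<tau> \<partial>couplings)"
    by (rule nn_integral_liminf) measurable
  also have "\<dots> \<le> ennreal (2 * c * Hb)"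
    by (rule order_trans[OF Liminf_le_Limsup Limsup_bounded]) (use X_int in auto)
  finally have "(\<integral>\<^sup>+\<tau>. liminf (\<lambda>n. X n \<tau>) \<partial>couplings) \<noteq> \<infinity>" by (auto simp: top_unique)
  then have "AE \<tau> in couplings. liminf (\<lambda>n. X n \<tau>) \<noteq> \<infinity>"
    by (intro nn_integral_PInf_AE) measurable
  then show ?thesis using AE_elim_pivot_nonzero
  proof eventually_elim
    case (elim \<tau>)
    obtain B where B: "liminf (\<lambda>n. X n \<tau>) < ennreal B" "B > 0"
    proof -
      have "liminf (\<lambda>n. X n \<tau>) < top" using elim(1) by (simp add: top.not_eq_extremum)
      then obtain b where "liminf (\<lambda>n. X n \<tau>) = ennreal b" "b \<ge> 0" by (cases "liminf (\<lambda>n. X n \<tau>)") auto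
      then show ?thesis by (intro that[of "b + 1"]) (auto intro: ennreal_lessI)
    qed
    have inf: "\<exists>\<^sub>\<infinity>n. X n \<tau> \<le> ennreal B"
    proof (rule ccontr)
      assume "\<not> ?thesis"
      then have "\<forall>\<^sub>F n in sequentially. ennreal B \<le> X n \<tau>"
      proof -
        have "\<forall>\<^sub>F n in sequentially. \<not> X n \<tau> \<le> ennreal B"
          using \<open>\<not> (\<exists>\<^sub>\<infinity>n. X n \<tau> \<le> ennreal B)\<close> by (simp add: frequently_def cofinite_eq_sequentially)
        then show ?thesis by eventually_elim auto
      qed
      then have "ennreal B \<le> liminf (\<lambda>n. X n \<tau>)" by (rule Liminf_bounded)
      then show False using B(1) by simp
    qed
    have solves: "system_op (diagonal \<gamma> \<tau>) K {n0..<n} (v n \<tau>) i = h i" if "i \<in> {n0..<n}" for n i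
      unfolding v_def
      by (rule elim_solution_solves[OF sym diag refl _ _ that]) (use elim(2) finite_subset in \<open>blast+\<close>)
    have "\<exists>\<^sub>\<infinity>n. \<exists>w. (\<Sum>k\<in>{n0..<n}. \<bar>w k\<bar> powr s) \<le> B \<and>
     (\<forall>i\<in>{n0..<n}. system_op (diagonal \<gamma> \<tau>) K {n0..<n} w i = h i)"
      using inf
    proof (rule INFM_mono)
      fix n assume "X n \<tau> \<le> ennreal B"
      then have "(\<Sum>k\<in>{n0..<n}. \<bar>v n \<tau> k\<bar> powr s) \<le> B" using B(2) by (simp add: X_def)
      then show "\<exists>w. (\<Sum>k\<in>{n0..<n}. \<bar>w k\<bar> powr s) \<le> B \<and>
        (\<forall>i\<in>{n0..<n}. system_op (diagonal \<gamma> \<tau>) K {n0..<n} w i = h i)" using solves by blast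
    qed
    then show ?case by blast
  qed
qed

end

end

lemma sum_squares_le_powr_sum:
  fixes v :: "'i \<Rightarrow> real"
  assumes "finite S" "0 < s" "s \<le> 1" "(\<Sum>k\<in>S. \<bar>v k\<bar> powr s) \<le> B"
  shows "(\<Sum>k\<in>S. (v k)\<^sup>2) \<le> B powr (2 / s)"
proof -
  have B0: "B \<ge> 0" using assms(4) sum_nonneg[of S "\<lambda>k. \<bar>v k\<bar> powr s"] by simp
  have each: "\<bar>v k\<bar> \<le> B powr (1 / s)" if "k \<in> S" for k
  proof -
    have "\<bar>v k\<bar> powr s \<le> B" using member_le_sum[OF that, of "\<lambda>k. \<bar>v k\<bar> powr s"] assms by simp
    then have "(\<bar>v k\<bar> powr s) powr (1 / s) \<le> B powr (1 / s)" using assms by (intro powr_mono2) auto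
    then show ?thesis using assms by (simp add: powr_powr)
  qed
  have "(\<Sum>k\<in>S. (v k)\<^sup>2) \<le> (\<Sum>k\<in>S. \<bar>v k\<bar> powr s * (B powr (1 / s)) powr (2 - s))"
  proof (rule sum_mono)
    fix k assume k: "k \<in> S"
    have "(v k)\<^sup>2 = \<bar>v k\<bar> powr s * \<bar>v k\<bar> powr (2 - s)"
      by (cases "v k = 0") (simp_all add: powr_add[symmetric])
    also have "\<dots> \<le> \<bar>v k\<bar> powr s * (B powr (1 / s)) powr (2 - s)"
      using each[OF k] assms by (intro mult_left_mono powr_mono2) auto
    finally show "(v k)\<^sup>2 \<le> \<bar>v k\<bar> powr s * (B powr (1 / s)) powr (2 - s)" .
  qed
  also have "\<dots> = (\<Sum>k\<in>S. \<bar>v k\<bar> powr s) * (B powr (1 / s)) powr (2 - s)" by (simp add: sum_distrib_right)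
  also have "\<dots> \<le> B * (B powr (1 / s)) powr (2 - s)" using assms(4) by (intro mult_right_mono) auto
  also have "\<dots> = B powr (2 / s)"
  proof (cases "B = 0")
    case False
    have "B * (B powr (1 / s)) powr (2 - s) = B powr (1 + (2 - s) / s)"
      using False B0 by (simp add: powr_powr powr_add)
    also have "1 + (2 - s) / s = 2 / s" using assms by (simp add: field_simps)
    finally show ?thesis .
  qed (use assms in simp)
  finally show ?thesis .
qed

section \<open>Completeness of eigenvectors\<close>

lemma subspace_closure_span:
  fixes E :: "'h::real_normed_vector set"
  shows "subspace (closure (span E))"
proof (rule subspaceI)
  show "0 \<in> closure (span E)" using closure_subset span_zero by blast
  fix x y :: 'h and c :: real
  assume "x \<in> closure (span E)"
  then obtain u where u: "\<And>n. u n \<in> span E" "u \<longlonglongrightarrow> x" unfolding closure_sequential by blast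
  show "c *\<^sub>R x \<in> closure (span E)"
    unfolding closure_sequential
    by (intro exI[of _ "\<lambda>n. c *\<^sub>R u n"] conjI allI span_scale u(1) tendsto_scaleR tendsto_const u(2))
  assume "y \<in> closure (span E)"
  then obtain v where v: "\<And>n. v n \<in> span E" "v \<longlonglongrightarrow> y" unfolding closure_sequential by blast
  show "x + y \<in> closure (span E)"
    unfolding closure_sequential
    by (intro exI[of _ "\<lambda>n. u n + v n"] conjI allI span_add u(1) v(1) tendsto_add u(2) v(2))
qed

lemma orthogonal_to_closure_span:
  fixes g :: "'h::real_inner"
  assumes "\<And>e. e \<in> E \<Longrightarrow> inner g e = 0" "x \<in> closure (span E)"
  shows "inner g x = 0"
proof -
  have span: "inner g y = 0" if "y \<in> span E" for y
    using that by (induction rule: span_induct_alt) (auto simp: inner_add_right assms(1))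
  obtain u where u: "\<And>n. u n \<in> span E" "u \<longlonglongrightarrow> x" using assms(2) unfolding closure_sequential by blast
  have "(\<lambda>n. inner g (u n)) \<longlonglongrightarrow> inner g x" by (intro tendsto_inner tendsto_const u(2))
  then show ?thesis using span[OF u(1)] by (simp add: LIMSEQ_const_iff)
qed

definition orthonormal :: "'h::real_inner set \<Rightarrow> bool" where
  "orthonormal E \<longleftrightarrow> (\<forall>e\<in>E. \<forall>e'\<in>E. inner e e' = (if e = e' then 1 else 0))"

context bounded_selfadjoint
begin

lemma maximal_orthonormal_eigenvectors:
  obtains E where "orthonormal E" "\<And>e. e \<in> E \<Longrightarrow> \<exists>l. H e = l *\<^sub>R e"
    "\<And>g l. (\<And>e. e \<in> E \<Longrightarrow> inner g e = 0) \<Longrightarrow> H g = l *\<^sub>R g \<Longrightarrow> g = 0"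
proof -
  define A where "A = {E. orthonormal E \<and> (\<forall>e\<in>E. \<exists>l. H e = l *\<^sub>R e)}"
  have "\<exists>M\<in>A. \<forall>X\<in>A. M \<subseteq> X \<longrightarrow> X = M"
  proof (rule subset_Zorn')
    fix \<C> assume ch: "subset.chain A \<C>"
    have "orthonormal (\<Union>\<C>)"
      unfolding orthonormal_def
    proof (intro ballI)
      fix e e' assume "e \<in> \<Union>\<C>" "e' \<in> \<Union>\<C>"
      then obtain X Y where XY: "X \<in> \<C>" "Y \<in> \<C>" "e \<in> X" "e' \<in> Y" by blast
      then have "X \<subseteq> Y \<or> Y \<subseteq> X" using ch unfolding subset.chain_def by blast
      moreover have "orthonormal X" "orthonormal Y" using ch XY unfolding subset.chain_def A_def by blast+
      ultimately show "inner e e' = (if e = e' then 1 else 0)"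
        using XY unfolding orthonormal_def by blast
    qed
    moreover have "\<forall>e\<in>\<Union>\<C>. \<exists>l. H e = l *\<^sub>R e" using ch unfolding subset.chain_def A_def by blast
    ultimately show "\<Union>\<C> \<in> A" by (simp add: A_def)
  qed
  then obtain E where E: "E \<in> A" and max: "\<And>X. X \<in> A \<Longrightarrow> E \<subseteq> X \<Longrightarrow> X = E" by blast
  show ?thesis
  proof (rule that[of E])
    show "orthonormal E" "\<And>e. e \<in> E \<Longrightarrow> \<exists>l. H e = l *\<^sub>R e" using E by (auto simp: A_def)
    fix g l assume g: "\<And>e. e \<in> E \<Longrightarrow> inner g e = 0" and Hg: "H g = l *\<^sub>R g"
    show "g = 0"
    proof (rule ccontr)
      assume "g \<noteq> 0"
      define u where "u = (1 / norm g) *\<^sub>R g"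
      have uu: "inner u u = 1" using \<open>g \<noteq> 0\<close> by (simp add: u_def dot_square_norm power2_eq_square)
      have uE: "inner u e = 0" "inner e u = 0" if "e \<in> E" for e
        using g[OF that] by (auto simp: u_def inner_commute)
      have "u \<notin> E" using uE(1)[of u] uu by auto
      have "orthonormal (insert u E)"
        using E uE uu \<open>u \<notin> E\<close> unfolding A_def orthonormal_def by auto
      moreover have "H u = l *\<^sub>R u" by (simp add: u_def linear_cmul[OF linear_H] Hg)
      ultimately have "insert u E \<in> A" using E by (auto simp: A_def)
      then have "insert u E = E" by (rule max) auto
      then show False using \<open>u \<notin> E\<close> by auto
    qed
  qed
qed

text \<open>On the orthogonal complement of the eigenvectors \<open>H\<close> agrees with \<open>H0\<close>.  By \<open>AE_not_in_range\<close> the spectral measures of \<open>H0\<close>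
  are carried by the countable set \<open>Z\<close>, so that of a vector in the complement has an atom, and the corresponding
  eigenprojection is an eigenvector of \<open>H\<close> in the complement, against maximality.\<close>

lemma orthonormal_eigenvectors_complete:
  assumes E: "\<And>e. e \<in> E \<Longrightarrow> \<exists>l. H e = l *\<^sub>R e"
    and max: "\<And>g l. (\<And>e. e \<in> E \<Longrightarrow> inner g e = 0) \<Longrightarrow> H g = l *\<^sub>R g \<Longrightarrow> g = 0"
    and H0: "bounded_selfadjoint H0 M0"
    and agree: "\<And>g. (\<And>x. x \<in> closure (span {\<phi>. \<exists>l. H \<phi> = l *\<^sub>R \<phi>}) \<Longrightarrow> inner g x = 0) \<Longrightarrow> H g = H0 g"
    and Z: "countable Z" "\<And>l f. l \<notin> Z \<Longrightarrow> \<exists>u. H0 u - l *\<^sub>R u = f"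
  shows "closure (span E) = UNIV"
proof -
  interpret H0: bounded_selfadjoint H0 M0 by (rule H0)
  define W where "W = closure (span E)"
  have W: "closed W" "subspace W" unfolding W_def by (auto intro: subspace_closure_span)
  define Wp where "Wp = {g. \<forall>e\<in>E. inner g e = 0}"
  have Wp_W: "inner g x = 0" if "g \<in> Wp" "x \<in> W" for g x
    using orthogonal_to_closure_span[of E g x] that unfolding Wp_def W_def by blast
  have Wp_I: "g \<in> Wp" if "\<And>x. x \<in> W \<Longrightarrow> inner g x = 0" for g
    using that span_base closure_subset unfolding Wp_def W_def by blast
  have Wp_H: "H g \<in> Wp" if "g \<in> Wp" for g
    unfolding Wp_def
  proof (intro CollectI ballI)
    fix e assume "e \<in> E"
    then obtain l where "H e = l *\<^sub>R e" using E by blast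
    then show "inner (H g) e = 0" using that \<open>e \<in> E\<close> by (simp add: sym Wp_def)
  qed
  have Wp_subspace: "subspace Wp" unfolding Wp_def by (rule subspaceI) (auto simp: inner_add_left)
  have Wp_closed: "closed Wp"
  proof -
    have "Wp = (\<Inter>e\<in>E. {g. inner g e = 0})" by (auto simp: Wp_def)
    moreover have "closed {g. inner g e = 0}" for e :: 'h
      by (intro closed_Collect_eq continuous_intros)
    ultimately show ?thesis by (simp add: closed_INT)
  qed
  have W_H: "H x \<in> W" if "x \<in> W" for x
  proof -
    obtain y where y: "y \<in> W" "\<And>w. w \<in> W \<Longrightarrow> inner (H x - y) w = 0" using projection_exists[OF W, of "H x"] by blast
    then have "H x - y \<in> Wp" by (intro Wp_I)
    then have "inner (H x - y) (H x) = 0"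
      using Wp_W[OF Wp_H \<open>x \<in> W\<close>] by (simp add: sym[symmetric])
    moreover have "inner (H x - y) y = 0" using y by blast
    ultimately have "inner (H x - y) (H x - y) = 0" by (simp add: inner_diff_right)
    then show ?thesis using y(1) by simp
  qed
  \<comment> \<open>Every eigenvector is in \<open>W\<close>, not only those in \<open>E\<close>: its component in \<open>Wp\<close> is again an eigenvector.\<close>
  have eig_W: "\<phi> \<in> W" if \<phi>: "H \<phi> = l *\<^sub>R \<phi>" for \<phi> l
  proof -
    obtain y where y: "y \<in> W" "\<And>w. w \<in> W \<Longrightarrow> inner (\<phi> - y) w = 0" using projection_exists[OF W, of \<phi>] by blast
    define z where "z = \<phi> - y"
    have z: "z \<in> Wp" unfolding z_def by (rule Wp_I) (rule y(2))
    define q where "q = H y - l *\<^sub>R y"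
    have zq: "H z - l *\<^sub>R z = - q"
      by (simp add: z_def q_def linear_diff[OF linear_H] \<phi> algebra_simps)
    have "q \<in> W" unfolding q_def using W(2) W_H[OF y(1)] y(1) by (intro subspace_diff subspace_mul)
    moreover have "H z - l *\<^sub>R z \<in> Wp" using Wp_subspace Wp_H[OF z] z by (intro subspace_diff subspace_mul)
    ultimately have "inner (- q) q = 0" unfolding zq by (intro Wp_W)
    then have "H z = l *\<^sub>R z" using zq by simp
    then have "z = 0" using z by (intro max[of z l]) (auto simp: Wp_def)
    then show ?thesis using y(1) by (simp add: z_def)
  qed
  have eig_span_W: "closure (span {\<phi>. \<exists>l. H \<phi> = l *\<^sub>R \<phi>}) \<subseteq> W"
    by (intro closure_minimal span_minimal W) (use eig_W in blast)
  have H_H0: "H g = H0 g" if "g \<in> Wp" for g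
    using Wp_W[OF that] eig_span_W by (intro agree) blast
  have Wp_0: "g = 0" if g: "g \<in> Wp" for g
  proof (rule ccontr)
    assume "g \<noteq> 0"
    define f where "f = (1 / norm g) *\<^sub>R g"
    have f: "norm f = 1" "f \<in> Wp" using \<open>g \<noteq> 0\<close> Wp_subspace g by (auto simp: f_def subspace_mul)
    obtain \<mu> where sm: "H0.spectral_measure f \<mu>" using H0.spectral_measure_exists[OF f(1)] by blast
    have "AE x in \<mu>. x \<in> Z"
      using H0.AE_not_in_range[OF sm] by eventually_elim (use Z(2) in blast)
    then obtain l where l: "measure \<mu> {l} > 0"
      using countable_support_atom[OF H0.spectral_measure_prob[OF sm] H0.spectral_measure_sets[OF sm] Z(1)] by blast
    obtain \<phi> p where \<phi>: "H0 \<phi> = l *\<^sub>R \<phi>" "inner \<phi> \<phi> = measure \<mu> {l}" "(\<lambda>k. opoly H0 (p k) f) \<longlonglongrightarrow> \<phi>"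
      by (rule H0.eigenprojection[OF sm, of l])
    \<comment> \<open>The eigenprojection is a limit of polynomials of \<open>H0\<close> applied to \<open>f\<close>, hence it stays in \<open>Wp\<close>.\<close>
    have "opoly H0 q f \<in> Wp" for q
    proof (induction q)
      case 0 show ?case using subspace_0[OF Wp_subspace] by simp
    next
      case (pCons b q)
      have "H0 (opoly H0 q f) \<in> Wp" using Wp_H[OF pCons(2)] H_H0[OF pCons(2)] by simp
      then show ?case using Wp_subspace f(2) by (simp add: subspace_add subspace_mul)
    qed
    from closed_sequentially[OF Wp_closed this \<phi>(3)] have "\<phi> \<in> Wp" .
    then have "\<phi> = 0" using \<phi>(1) H_H0 by (intro max[of \<phi> l]) (auto simp: Wp_def)
    then show False using \<phi>(2) l by simp
  qed
  show ?thesis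
  proof (intro equalityI subsetI UNIV_I)
    fix x :: 'h
    obtain y where y: "y \<in> W" "\<And>w. w \<in> W \<Longrightarrow> inner (x - y) w = 0" using projection_exists[OF W, of x] by blast
    then have "x - y \<in> Wp" by (intro Wp_I)
    then have "x = y" using Wp_0[of "x - y"] by simp
    then show "x \<in> closure (span E)" using y(1) by (simp add: W_def)
  qed
qed

end

section \<open>Finite-rank perturbations\<close>

text \<open>If \<open>U\<close> maps each \<open>e \<in> D\<close> to a preimage under \<open>H' - l\<close>, then \<open>H - l\<close> maps the span of \<open>U ` D\<close> into the span of \<open>D\<close>.  Both have
  dimension \<open>card D\<close>, so \<open>H - l\<close> is onto the span of \<open>D\<close> as soon as it is injective.\<close>

lemma finite_rank_dichotomy:
  fixes H H' :: "'h::real_inner \<Rightarrow> 'h"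
  assumes lin: "linear H" "linear H'" and D: "finite D" "independent D"
    and range: "\<And>d. d \<in> D \<Longrightarrow> \<exists>u. H' u - l *\<^sub>R u = d"
    and pert: "\<And>v. H v - H' v \<in> span D" and d: "d \<in> D"
  shows "(\<exists>\<phi>. \<phi> \<noteq> 0 \<and> H \<phi> = l *\<^sub>R \<phi>) \<or> (\<exists>u. H u - l *\<^sub>R u = d)"
proof (cases "\<exists>\<phi>. \<phi> \<noteq> 0 \<and> H \<phi> = l *\<^sub>R \<phi>")
  case False
  define T T' where "T v = H v - l *\<^sub>R v" and "T' v = H' v - l *\<^sub>R v" for v
  have linT: "linear T" "linear T'"
    unfolding T_def T'_def by (intro linear_compose_sub lin linear_scaleR)+
  have injT: "inj T"
  proof (rule linear_injective_0[OF linT(1), THEN iffD2], intro allI impI)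
    fix v assume "T v = 0"
    then have "H v = l *\<^sub>R v" by (simp add: T_def)
    then show "v = 0" using False by blast
  qed
  define U where "U e = (SOME u. T' u = e)" for e
  have U: "T' (U e) = e" if "e \<in> D" for e
    unfolding U_def by (rule someI_ex) (use range[OF that] in \<open>simp add: T'_def\<close>)
  have injU: "inj_on U D" by (rule inj_on_inverseI[where f=U and g=T' and A=D, OF U])
  have T'U: "T' ` (U ` D) = D" using U by force
  have indU: "independent (U ` D)"
  proof (rule ccontr)
    assume "\<not> independent (U ` D)"
    then obtain b where b: "b \<in> D" "U b \<in> span (U ` D - {U b})" unfolding dependent_def by blast
    have "b = T' (U b)" using U[OF b(1)] by simp
    also have "\<dots> \<in> T' ` span (U ` D - {U b})" using b(2) by blast
    also have "\<dots> = span (T' ` (U ` D - {U b}))" by (rule linear_span_image[OF linT(2), symmetric])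
    also have "\<dots> \<subseteq> span (D - {b})"
    proof (rule span_mono, rule subsetI)
      fix x assume "x \<in> T' ` (U ` D - {U b})"
      then obtain c where c: "c \<in> D" "U c \<noteq> U b" "x = T' (U c)" by blast
      then show "x \<in> D - {b}" using U[OF c(1)] by auto
    qed
    finally show False using D(2) b(1) unfolding dependent_def by blast
  qed
  have indTU: "independent (T ` (U ` D))"
    by (rule linear_independent_injective_image[OF linT(1) indU]) (use injT in \<open>auto intro: inj_on_subset\<close>)
  have cardTU: "card (T ` (U ` D)) = card D"
    using injT injU by (simp add: card_image inj_on_subset)
  have TU_D: "T ` (U ` D) \<subseteq> span D"
  proof
    fix x assume "x \<in> T ` (U ` D)"
    then obtain e where e: "e \<in> D" "x = T (U e)" by blast
    have "x = T' (U e) + (H (U e) - H' (U e))" using e by (simp add: T_def T'_def)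
    then show "x \<in> span D" using U[OF e(1)] e(1) pert[of "U e"] by (simp add: span_add span_base)
  qed
  have "d \<in> span (T ` (U ` D))"
  proof (rule ccontr)
    assume nd: "d \<notin> span (T ` (U ` D))"
    then have "independent (insert d (T ` (U ` D)))" using indTU by (rule independent_insertI)
    moreover have "insert d (T ` (U ` D)) \<subseteq> span D" using TU_D d by (auto intro: span_base)
    ultimately have "card (insert d (T ` (U ` D))) \<le> card D" using independent_span_bound[OF D(1)] by blast
    moreover have "d \<notin> T ` (U ` D)" using nd by (rule contrapos_nn) (rule span_base)
    ultimately show False using cardTU D(1) by simp
  qed
  also have "span (T ` (U ` D)) = T ` span (U ` D)" by (rule linear_span_image[OF linT(1)])
  finally show ?thesis by (auto simp: T_def)
qed simp

lemma point_masses_independent: "independent (point_mass ` A)"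
proof (rule ccontr)
  assume "\<not> independent (point_mass ` A)"
  then obtain x where x: "x \<in> A" "point_mass x \<in> span (point_mass ` A - {point_mass x})" unfolding dependent_def by blast
  have "inner (point_mass x) y = 0" if "y \<in> span (point_mass ` A - {point_mass x})" for y :: "'a ell2"
    using that
  proof (induction rule: span_induct_alt)
    case (step c z w)
    then obtain t where "z = point_mass t" "t \<noteq> x" by blast
    then show ?case using step by (simp add: inner_add_right)
  qed simp
  from this[OF x(2)] show False by simp
qed

lemma norm_sum_point_masses:
  assumes "finite S" "inj_on a S"
  shows "(norm (\<Sum>k\<in>S. v k *\<^sub>R point_mass (a k)))\<^sup>2 = (\<Sum>k\<in>S. (v k)\<^sup>2)"
proof -
  define w where "w = (\<Sum>k\<in>S. v k *\<^sub>R point_mass (a k))"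
  have app: "ell2_app w (a k) = v k" if "k \<in> S" for k
  proof -
    have "ell2_app w (a k) = (\<Sum>l\<in>S. if l = k then v l else 0)"
      unfolding w_def ell2_app_sum using assms(2) that by (intro sum.cong) (auto simp: inj_on_def)
    then show ?thesis using that assms(1) by simp
  qed
  have "inner w w = (\<Sum>k\<in>S. v k * ell2_app w (a k))"
    by (subst (1) w_def) (simp add: inner_sum_left)
  also have "\<dots> = (\<Sum>k\<in>S. (v k)\<^sup>2)" using app by (intro sum.cong) (auto simp: power2_eq_square)
  finally show ?thesis by (simp add: w_def power2_norm_eq_inner)
qed

section \<open>Operators with finitely or infinitely many potential wells\<close>

locale sparse_schroedinger = hierarchical_structure C for C :: "'a::metric_space set \<Rightarrow> real" +
  fixes a :: "nat \<Rightarrow> 'a" and \<alpha> \<beta> :: real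
  assumes inj_a: "inj a" and \<alpha>_pos: "0 < \<alpha>" and \<alpha>_\<beta>: "\<alpha> < \<beta>"
begin

text \<open>Clamping does not affect couplings in the support of their law, and it makes the potential bounded by the same constant
  for all parameters instead of almost all of them, so that every \<open>hamiltonian S \<tau>\<close> is a bounded operator.\<close>

definition clamp :: "real \<Rightarrow> real" where "clamp t = max \<alpha> (min \<beta> t)"

lemma clamp_bounds: "\<alpha> \<le> clamp t" "clamp t \<le> \<beta>" "clamp t > 0"
  using \<alpha>_\<beta> \<alpha>_pos by (auto simp: clamp_def)

lemma clamp_id: "t \<in> {\<alpha>..\<beta>} \<Longrightarrow> clamp t = t"
  by (auto simp: clamp_def)

definition well :: "nat set \<Rightarrow> (nat \<Rightarrow> real) \<Rightarrow> 'a \<Rightarrow> real" where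
  "well S \<tau> x = (if x \<in> a ` S then clamp (\<tau> (inv a x)) else 0)"

lemma well_site: "well S \<tau> (a i) = (if i \<in> S then clamp (\<tau> i) else 0)"
  using inj_a by (auto simp: well_def inj_image_mem_iff)

lemma well_bound: "\<bar>well S \<tau> x\<bar> \<le> \<beta>"
  using clamp_bounds[of "\<tau> (inv a x)"] \<alpha>_pos \<alpha>_\<beta> by (auto simp: well_def)

definition well_op :: "nat set \<Rightarrow> (nat \<Rightarrow> real) \<Rightarrow> 'a ell2 \<Rightarrow> 'a ell2" where
  "well_op S \<tau> v = Abs_ell2 (\<lambda>x. well S \<tau> x * ell2_app v x)"

lemma well_op_bounded: "ell2_app (well_op S \<tau> v) = (\<lambda>x. well S \<tau> x * ell2_app v x) \<and> norm (well_op S \<tau> v) \<le> \<beta> * norm v"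
proof -
  have \<beta>0: "\<beta> \<ge> 0" using \<alpha>_pos \<alpha>_\<beta> by simp
  have fin: "(\<Sum>x\<in>F. (well S \<tau> x * ell2_app v x)\<^sup>2) \<le> (\<beta> * norm v)\<^sup>2" if "finite F" for F
  proof -
    have "(\<Sum>x\<in>F. (well S \<tau> x * ell2_app v x)\<^sup>2) \<le> (\<Sum>x\<in>F. \<beta>\<^sup>2 * (ell2_app v x)\<^sup>2)"
    proof (rule sum_mono)
      fix x
      have "(well S \<tau> x)\<^sup>2 \<le> \<beta>\<^sup>2" using well_bound[of S \<tau> x] \<beta>0 by (metis abs_le_square_iff abs_of_nonneg)
      then show "(well S \<tau> x * ell2_app v x)\<^sup>2 \<le> \<beta>\<^sup>2 * (ell2_app v x)\<^sup>2"
        by (simp add: power_mult_distrib mult_right_mono)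
    qed
    also have "\<dots> = \<beta>\<^sup>2 * (\<Sum>x\<in>F. (ell2_app v x)\<^sup>2)" by (simp add: sum_distrib_left)
    also have "\<dots> \<le> \<beta>\<^sup>2 * (norm v)\<^sup>2" by (intro mult_left_mono ell2_finite_sum_le that) auto
    finally show ?thesis by (simp add: power_mult_distrib)
  qed
  obtain w where w: "ell2_app w = (\<lambda>x. well S \<tau> x * ell2_app v x)" and norm_w: "norm w \<le> \<beta> * norm v"
    by (rule ell2_from_finite_sums[OF fin mult_nonneg_nonneg[OF \<beta>0 norm_ge_zero]])
  then have "well_op S \<tau> v = w" unfolding well_op_def by (metis ell2_app_inverse)
  with w norm_w show ?thesis by simp
qed

lemma well_op_app [simp]: "ell2_app (well_op S \<tau> v) x = well S \<tau> x * ell2_app v x"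
  using well_op_bounded[of S \<tau> v] by simp

lemma norm_well_op: "norm (well_op S \<tau> v) \<le> \<beta> * norm v"
  using well_op_bounded by blast

lemma linear_well_op: "linear (well_op S \<tau>)"
  by (rule linearI; rule ell2_eqI) (simp_all add: algebra_simps)

lemma well_op_sym: "inner (well_op S \<tau> v) w = inner v (well_op S \<tau> w)"
  unfolding ell2_inner by (simp add: mult_ac)

definition hamiltonian :: "nat set \<Rightarrow> (nat \<Rightarrow> real) \<Rightarrow> 'a ell2 \<Rightarrow> 'a ell2" where
  "hamiltonian S \<tau> v = laplacian_op v - well_op S \<tau> v"

definition window :: real where "window = 2 * total_weight + \<beta>"

lemma hamiltonian_selfadjoint: "bounded_selfadjoint (hamiltonian S \<tau>) window"
proof (rule bounded_selfadjoint.intro)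
  show "linear (hamiltonian S \<tau>)"
    unfolding hamiltonian_def[abs_def] by (intro linear_compose_sub linear_laplacian_op linear_well_op)
  show "inner (hamiltonian S \<tau> x) y = inner x (hamiltonian S \<tau> y)" for x y
    by (simp add: hamiltonian_def inner_diff_left inner_diff_right laplacian_op_sym well_op_sym)
  show "norm (hamiltonian S \<tau> x) \<le> window * norm x" for x
    unfolding hamiltonian_def window_def
    using norm_triangle_ineq4[of "laplacian_op x" "well_op S \<tau> x"] norm_laplacian_op[of x] norm_well_op[of S \<tau> x]
    by (simp add: distrib_right)
  show "window > 0" using total_weight_nonneg \<alpha>_pos \<alpha>_\<beta> by (simp add: window_def)
qed

lemma laplacian_selfadjoint: "bounded_selfadjoint laplacian_op window"
proof -
  have "well_op {} \<tau> v = 0" for \<tau> v by (rule ell2_eqI) (simp add: well_def)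
  then have "hamiltonian {} (\<lambda>_. 0) = laplacian_op" by (auto simp: hamiltonian_def)
  then show ?thesis using hamiltonian_selfadjoint[of "{}" "\<lambda>_. 0"] by simp
qed

lemma hamiltonian_cong: "(\<And>i. i \<in> S \<Longrightarrow> \<tau> i = \<tau>' i) \<Longrightarrow> hamiltonian S \<tau> = hamiltonian S \<tau>'"
proof -
  assume *: "\<And>i. i \<in> S \<Longrightarrow> \<tau> i = \<tau>' i"
  have "well S \<tau> = well S \<tau>'" using * inj_a by (auto simp: well_def fun_eq_iff)
  then show ?thesis by (simp add: hamiltonian_def well_op_def fun_eq_iff)
qed

lemma hamiltonian_remove_site:
  assumes "j \<in> S"
  shows "hamiltonian S \<tau> v = hamiltonian (S - {j}) \<tau> v - (clamp (\<tau> j) * inner (point_mass (a j)) v) *\<^sub>R point_mass (a j)"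
proof (rule ell2_eqI)
  fix x
  show "ell2_app (hamiltonian S \<tau> v) x = ell2_app (hamiltonian (S - {j}) \<tau> v - (clamp (\<tau> j) * inner (point_mass (a j)) v) *\<^sub>R point_mass (a j)) x"
  proof (cases "x = a j")
    case True
    then show ?thesis using assms by (simp add: hamiltonian_def well_site)
  next
    case False
    then have "x \<in> a ` S \<longleftrightarrow> x \<in> a ` (S - {j})" by auto
    then show ?thesis using False by (simp add: hamiltonian_def well_def)
  qed
qed

text \<open>Let \<open>R\<close> be the free resolvent and \<open>u = R (\<delta>\<^sub>b + \<Sum>\<^sub>k v\<^sub>k \<delta>\<^sub>a\<^sub>k)\<close>, so that \<open>(L - l) u = \<delta>\<^sub>b + \<Sum>\<^sub>k v\<^sub>k \<delta>\<^sub>a\<^sub>k\<close>.  The system says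
  that \<open>v\<^sub>i = \<tau>\<^sub>i u(a\<^sub>i)\<close> for \<open>n0 \<le> i < n\<close>; hence \<open>(H - l) u\<close> equals \<open>\<delta>\<^sub>b\<close> except at sites with index at least \<open>n\<close>.  The vectors
  \<open>u\<close> are bounded, therefore they solve \<open>(H - l) u = \<delta>\<^sub>b\<close> weakly in the limit.\<close>

lemma moment_finite_if_bounded_solutions:
  assumes g: "g > 0" "\<And>n. g \<le> \<bar>level_eigenvalue n - l\<bar>" and b: "b < n0"
    and s: "0 < s" "s \<le> 1"
    and K: "\<And>i k. K i k = (if i = k then 0 else ell2_app (free_resolvent l (point_mass (a k))) (a i))"
    and d: "\<And>k. d k = 1 / clamp (\<tau> k) - ell2_app (free_resolvent l (point_mass (a k))) (a k)"
    and h: "\<And>k. h k = ell2_app (free_resolvent l (point_mass (a b))) (a k)"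
    and sol: "\<exists>\<^sub>\<infinity>n. \<exists>v. (\<Sum>k\<in>{n0..<n}. \<bar>v k\<bar> powr s) \<le> B \<and>
     (\<forall>i\<in>{n0..<n}. system_op d K {n0..<n} v i = h i)"
    and sm: "bounded_selfadjoint.spectral_measure (hamiltonian {n0..} \<tau>) window (point_mass (a b)) \<mu>"
  shows "inverse_square_moment \<mu> l < \<infinity>"
proof -
  interpret H: bounded_selfadjoint "hamiltonian {n0..} \<tau>" window by (rule hamiltonian_selfadjoint)
  let ?R = "free_resolvent l"
  define G where "G = {n. \<exists>v. (\<Sum>k\<in>{n0..<n}. \<bar>v k\<bar> powr s) \<le> B \<and>
     (\<forall>i\<in>{n0..<n}. system_op d K {n0..<n} v i = h i)}"
  have "infinite G" using sol by (simp add: G_def frequently_cofinite)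
  then obtain r where r: "strict_mono (r :: nat \<Rightarrow> nat)" "\<And>m. r m \<in> G" using infinite_enumerate by blast
  define solves where "solves m v \<longleftrightarrow> (\<Sum>k\<in>{n0..<r m}. \<bar>v k\<bar> powr s) \<le> B \<and>
     (\<forall>i\<in>{n0..<r m}. system_op d K {n0..<r m} v i = h i)" for m v
  define v where "v m = (SOME v. solves m v)" for m
  have "\<exists>v. solves m v" for m using r(2)[of m] by (simp add: G_def solves_def)
  then have v_solves: "solves m (v m)" for m unfolding v_def by (rule someI_ex)
  have v: "(\<Sum>k\<in>{n0..<r m}. \<bar>v m k\<bar> powr s) \<le> B"
    "i \<in> {n0..<r m} \<Longrightarrow> system_op d K {n0..<r m} (v m) i = h i" for m i
    using v_solves[of m] unfolding solves_def by blast+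
  define src where "src m = (\<Sum>k\<in>{n0..<r m}. v m k *\<^sub>R point_mass (a k))" for m
  define u where "u m = ?R (point_mass (a b) + src m)" for m
  define cR where "cR = \<bar>1 / (total_weight - l)\<bar> + total_weight / g\<^sup>2"
  have linR: "linear ?R" and normR: "norm (?R x) \<le> cR * norm x" for x
    unfolding cR_def by (rule linear_free_resolvent[OF g], rule norm_free_resolvent[OF g])
  have cR0: "cR \<ge> 0" using total_weight_nonneg g(1) by (simp add: cR_def)
  define Bs where "Bs = sqrt (B powr (2 / s))"
  have src_norm: "norm (src m) \<le> Bs" for m
  proof -
    have "(norm (src m))\<^sup>2 = (\<Sum>k\<in>{n0..<r m}. (v m k)\<^sup>2)"
      unfolding src_def by (rule norm_sum_point_masses) (use inj_a in \<open>auto intro: inj_on_subset\<close>)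
    also have "\<dots> \<le> B powr (2 / s)" by (rule sum_squares_le_powr_sum[OF _ s v(1)]) simp
    finally show ?thesis unfolding Bs_def by (rule real_le_rsqrt)
  qed
  define Bu where "Bu = cR * (1 + Bs)"
  have u_norm: "norm (u m) \<le> Bu" for m
  proof -
    have "norm (u m) \<le> cR * norm (point_mass (a b) + src m)" unfolding u_def by (rule normR)
    also have "norm (point_mass (a b) + src m) \<le> 1 + Bs"
      using norm_triangle_ineq[of "point_mass (a b)" "src m"] src_norm[of m] by simp
    then have "cR * norm (point_mass (a b) + src m) \<le> cR * (1 + Bs)" by (rule mult_left_mono[OF _ cR0])
    finally show ?thesis by (simp add: Bu_def)
  qed
  have Bu0: "Bu \<ge> 0" using u_norm[of 0] norm_ge_zero order_trans by blast
  have res: "hamiltonian {n0..} \<tau> (u m) - l *\<^sub>R u m = point_mass (a b) + src m - well_op {n0..} \<tau> (u m)" for m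
  proof -
    have "laplacian_op (u m) - l *\<^sub>R u m = point_mass (a b) + src m"
      unfolding u_def by (rule laplacian_free_resolvent[OF g])
    then show ?thesis by (simp add: hamiltonian_def algebra_simps)
  qed
  have src_app: "ell2_app (src m) (a i) = (if i \<in> {n0..<r m} then v m i else 0)" for m i
  proof -
    have "ell2_app (src m) (a i) = (\<Sum>k\<in>{n0..<r m}. if k = i then v m k else 0)"
      unfolding src_def ell2_app_sum using inj_a by (intro sum.cong) (auto simp: inj_def)
    then show ?thesis by simp
  qed
  have u_app: "clamp (\<tau> i) * ell2_app (u m) (a i) = v m i" if i: "i \<in> {n0..<r m}" for m i
  proof -
    have "ell2_app (u m) (a i) = h i + (\<Sum>k\<in>{n0..<r m}. v m k * ell2_app (?R (point_mass (a k))) (a i))"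
      by (simp add: u_def src_def linear_add[OF linR] linear_sum[OF linR] linear_cmul[OF linR] h)
    also have "(\<Sum>k\<in>{n0..<r m}. v m k * ell2_app (?R (point_mass (a k))) (a i))
        = (\<Sum>k\<in>{n0..<r m}. K i k * v m k + (if k = i then ell2_app (?R (point_mass (a i))) (a i) * v m i else 0))"
      by (intro sum.cong) (auto simp: K)
    also have "\<dots> = (\<Sum>k\<in>{n0..<r m}. K i k * v m k) + ell2_app (?R (point_mass (a i))) (a i) * v m i"
      using i by (simp add: sum.distrib)
    finally have "ell2_app (u m) (a i) = h i + (\<Sum>k\<in>{n0..<r m}. K i k * v m k) + ell2_app (?R (point_mass (a i))) (a i) * v m i"
      by simp
    moreover have "d i * v m i - (\<Sum>k\<in>{n0..<r m}. K i k * v m k) = h i"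
      using v(2)[OF i] by (simp add: system_op_def)
    ultimately have "ell2_app (u m) (a i) = v m i / clamp (\<tau> i)" by (simp add: d algebra_simps)
    then show ?thesis using clamp_bounds(3)[of "\<tau> i"] by simp
  qed
  have "inverse_square_moment \<mu> l \<le> ennreal (Bu\<^sup>2)"
  proof (rule H.weak_range_moment_bound[OF sm Bu0 u_norm])
    fix y
    show "(\<lambda>m. inner y (hamiltonian {n0..} \<tau> (u m) - l *\<^sub>R u m)) \<longlonglongrightarrow> inner y (point_mass (a b))"
    proof (rule bounded_pointwise_imp_weak)
      show "norm (hamiltonian {n0..} \<tau> (u m) - l *\<^sub>R u m) \<le> 1 + Bs + \<beta> * Bu" for m
      proof -
        have "\<beta> * norm (u m) \<le> \<beta> * Bu" using u_norm[of m] \<alpha>_pos \<alpha>_\<beta> by (intro mult_left_mono) auto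
        then have "norm (well_op {n0..} \<tau> (u m)) \<le> \<beta> * Bu" using norm_well_op order_trans by blast
        moreover have "norm (point_mass (a b) + src m) \<le> 1 + Bs"
          using norm_triangle_ineq[of "point_mass (a b)" "src m"] src_norm[of m] by simp
        ultimately show ?thesis unfolding res
          using norm_triangle_ineq4[of "point_mass (a b) + src m" "well_op {n0..} \<tau> (u m)"] by linarith
      qed
      fix x
      have ev: "\<forall>\<^sub>F m in sequentially. ell2_app (hamiltonian {n0..} \<tau> (u m) - l *\<^sub>R u m) x = ell2_app (point_mass (a b)) x"
      proof (cases "x \<in> range a")
        case False
        have "ell2_app (src m) x = 0" for m
          unfolding src_def ell2_app_sum using False by (intro sum.neutral) auto
        then show ?thesis unfolding res using False by (simp add: well_def image_iff)
      next
        case True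
        then obtain i where x: "x = a i" by blast
        have "ell2_app (hamiltonian {n0..} \<tau> (u m) - l *\<^sub>R u m) x = ell2_app (point_mass (a b)) x" if m: "m \<ge> Suc i" for m
        proof (cases "n0 \<le> i")
          case True
          have "i < r m" using strict_mono_imp_increasing[OF r(1), of m] m by linarith
          then have "i \<in> {n0..<r m}" using True by simp
          then show ?thesis unfolding res using True u_app[of i m] by (simp add: x src_app well_site)
        next
          case False
          then show ?thesis unfolding res by (simp add: x src_app well_site)
        qed
        then show ?thesis unfolding eventually_sequentially by blast
      qed
      show "(\<lambda>m. ell2_app (hamiltonian {n0..} \<tau> (u m) - l *\<^sub>R u m) x) \<longlonglongrightarrow> ell2_app (point_mass (a b)) x"
        by (rule tendsto_eventually[OF ev])
    qed
  qed
  then show ?thesis using ennreal_less_top le_less_trans infinity_ennreal_def by metis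
qed

end

section \<open>Fractional moments for random couplings\<close>

lemma nn_integral_powr_singularity:
  fixes s w :: real
  assumes "0 < s" "s < 1"
  shows "(\<integral>\<^sup>+t. ennreal (\<bar>t - w\<bar> powr - s) * indicator {w - 1..w + 1} t \<partial>lborel) \<le> ennreal (2 / (1 - s))"
proof -
  have base: "(\<integral>\<^sup>+x. ennreal (x powr - s) * indicator {0..1} x \<partial>lborel) = ennreal (1 / (1 - s))"
  proof -
    have "((\<lambda>x. x powr - s) has_integral (1 powr (- s + 1) / (- s + 1))) {0..1::real}"
      using assms by (intro has_integral_powr_from_0) auto
    then have "(\<integral>\<^sup>+x. ennreal (indicator {0..1} x * x powr - s) \<partial>lborel) = ennreal (1 powr (- s + 1) / (- s + 1))"
    proof (intro nn_integral_has_integral_lborel)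
      assume "((\<lambda>x. x powr - s) has_integral (1 powr (- s + 1) / (- s + 1))) {0..1::real}"
      then have "((\<lambda>x. if x \<in> {0..1} then x powr - s else 0) has_integral (1 powr (- s + 1) / (- s + 1))) UNIV"
        by (simp only: has_integral_restrict_UNIV)
      also have "(\<lambda>x::real. if x \<in> {0..1} then x powr - s else 0) = (\<lambda>x. indicator {0..1} x * x powr - s)"
        by (auto simp: indicator_def fun_eq_iff)
      finally show "((\<lambda>x. indicator {0..1} x * x powr - s) has_integral (1 powr (- s + 1) / (- s + 1))) (UNIV::real set)" .
    qed auto
    moreover have "ennreal (indicator {0..1} x * x powr - s) = ennreal (x powr - s) * indicator {0..1} x" for x :: real
      by (simp add: indicator_def)
    ultimately show ?thesis by simp
  qed
  have "(\<integral>\<^sup>+t. ennreal (\<bar>t - w\<bar> powr - s) * indicator {w - 1..w + 1} t \<partial>lborel)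
      = ennreal \<bar>1\<bar> * (\<integral>\<^sup>+x. ennreal (\<bar>(w + 1 * x) - w\<bar> powr - s) * indicator {w - 1..w + 1} (w + 1 * x) \<partial>lborel)"
    by (rule nn_integral_real_affine) auto
  also have "\<dots> = (\<integral>\<^sup>+x. ennreal (\<bar>x\<bar> powr - s) * indicator {-1..1} x \<partial>lborel)"
    by (simp add: indicator_def)
  also have "\<dots> \<le> (\<integral>\<^sup>+x. ennreal (x powr - s) * indicator {0..1} x + ennreal ((- x) powr - s) * indicator {0..1} (- x) \<partial>lborel)"
    by (intro nn_integral_mono) (auto simp: indicator_def abs_if)
  also have "\<dots> = (\<integral>\<^sup>+x. ennreal (x powr - s) * indicator {0..1} x \<partial>lborel)
      + (\<integral>\<^sup>+x. ennreal ((- x) powr - s) * indicator {0..1} (- x) \<partial>lborel)"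
    by (rule nn_integral_add) auto
  also have "(\<integral>\<^sup>+x. ennreal ((- x) powr - s) * indicator {0..1} (- x) \<partial>lborel)
      = (\<integral>\<^sup>+x. ennreal (x powr - s) * indicator {0..1} x \<partial>lborel)"
    using nn_integral_real_affine[of "\<lambda>x. ennreal (x powr - s) * indicator {0..1} x" "-1" 0] by simp
  finally show ?thesis using assms by (simp add: base ennreal_plus[symmetric] del: ennreal_plus)
qed

lemma inner_ell2_measurable:
  assumes count: "countable (UNIV :: 'a set)" and inf: "infinite (UNIV :: 'a set)"
    and w: "\<And>y. (\<lambda>\<tau>. ell2_app (w \<tau>) y) \<in> borel_measurable N"
  shows "(\<lambda>\<tau>. inner (z :: 'a ell2) (w \<tau>)) \<in> borel_measurable N"
proof -
  define e where "e = from_nat_into (UNIV :: 'a set)"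
  define F where "F n = e ` {..n}" for n :: nat
  have surj: "range e = UNIV" unfolding e_def by (rule range_from_nat_into[OF UNIV_not_empty count])
  have "filterlim F (finite_subsets_at_top UNIV) sequentially"
    unfolding filterlim_finite_subsets_at_top
  proof (intro allI impI)
    fix X :: "'a set" assume X: "finite X \<and> X \<subseteq> UNIV"
    then obtain I where I: "finite I" "X = e ` I" using surj by (metis finite_subset_image)
    obtain n0 where "I \<subseteq> {..n0}" using I(1) by (meson finite_nat_iff_bounded_le)
    then have "X \<subseteq> F n" if "n \<ge> n0" for n using I(2) that by (fastforce simp: F_def)
    then show "\<forall>\<^sub>F n in sequentially. finite (F n) \<and> X \<subseteq> F n \<and> F n \<subseteq> UNIV"
      unfolding eventually_sequentially by (intro exI[of _ n0]) (auto simp: F_def)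
  qed
  then have lim: "(\<lambda>n. \<Sum>x\<in>F n. ell2_app z x *\<^sub>R point_mass x) \<longlonglongrightarrow> z"
    by (rule filterlim_compose[OF ell2_finite_approx])
  show ?thesis
  proof (rule borel_measurable_LIMSEQ_real)
    fix \<tau>
    have "(\<lambda>n. inner (\<Sum>x\<in>F n. ell2_app z x *\<^sub>R point_mass x) (w \<tau>)) \<longlonglongrightarrow> inner z (w \<tau>)"
      by (rule tendsto_inner[OF lim tendsto_const])
    then show "(\<lambda>n. \<Sum>x\<in>F n. ell2_app z x * ell2_app (w \<tau>) x) \<longlonglongrightarrow> inner z (w \<tau>)"
      by (simp add: inner_sum_left)
  qed (use w in measurable)
qed

locale random_schroedinger = sparse_schroedinger C a \<alpha> \<beta>
  for C :: "'a::metric_space set \<Rightarrow> real" and a :: "nat \<Rightarrow> 'a" and \<alpha> \<beta> :: real +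
  fixes \<rho> :: "real \<Rightarrow> real" and K r :: real
  assumes \<rho>_meas: "(\<lambda>t. ennreal (\<rho> t)) \<in> borel_measurable borel"
    and \<rho>_bound: "\<And>t. 0 \<le> \<rho> t \<and> \<rho> t \<le> K"
    and \<rho>_support: "\<And>t. t \<notin> {\<alpha>..\<beta>} \<Longrightarrow> \<rho> t = 0"
    and \<rho>_prob: "prob_space (density lborel (\<lambda>t. ennreal (\<rho> t)))"
    and r: "0 < r" "r < 1"
    and sparse: "(\<lambda>M. SUP i\<in>{M..}. \<Sum>\<^sub>\<infinity>j\<in>{M..} - {i}. ennreal (1 / dist (a i) (a j) powr r)) \<longlonglongrightarrow> 0"
begin

abbreviation law :: "real measure" where "law \<equiv> density lborel (\<lambda>t. ennreal (\<rho> t))"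

sublocale iid_couplings law
  by (rule iid_couplings.intro[OF \<rho>_prob]) simp

lemma K_nonneg: "K \<ge> 0" using \<rho>_bound[of 0] by linarith

lemma \<rho>_meas_lborel [measurable]: "(\<lambda>t. ennreal (\<rho> t)) \<in> borel_measurable lborel"
  using \<rho>_meas by simp

lemma AE_law: "AE t in law. t \<in> {\<alpha>..\<beta>}"
proof (subst AE_density[OF \<rho>_meas_lborel], rule AE_I2, rule impI)
  fix t assume "0 < ennreal (\<rho> t)"
  then show "t \<in> {\<alpha>..\<beta>}" using \<rho>_support[of t] by (cases "t \<in> {\<alpha>..\<beta>}") simp_all
qed

lemma AE_couplings_window: "AE \<tau> in couplings. \<forall>k. \<tau> k \<in> {\<alpha>..\<beta>}"
proof -
  have "AE \<tau> in PiM UNIV (\<lambda>_. law). \<tau> k \<in> {\<alpha>..\<beta>}" for k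
    by (rule AE_PiM_component[where M="\<lambda>_. law" and I=UNIV and P="\<lambda>t. t \<in> {\<alpha>..\<beta>}", OF prob_D UNIV_I AE_law])
  then show ?thesis unfolding AE_all_countable couplings_def by (rule allI)
qed

lemma law_no_atom: "AE t in law. 1 / t \<noteq> e"
proof (subst AE_density[OF \<rho>_meas_lborel])
  have "AE t in lborel. t \<noteq> 1 / e" by (rule AE_lborel_singleton)
  moreover have "AE t in lborel. t \<noteq> (0::real)" by (rule AE_lborel_singleton)
  ultimately show "AE t in lborel. 0 < ennreal (\<rho> t) \<longrightarrow> 1 / t \<noteq> e"
    by eventually_elim auto
qed

text \<open>For \<open>t \<le> \<beta>\<close> one has \<open>\<bar>1 / t - e\<bar> \<ge> \<bar>1 - t e\<bar> / \<beta>\<close>.  This is at least \<open>1 / (2 \<beta>)\<close> if \<open>\<bar>e\<bar> \<le> 1 / (2 \<beta>)\<close>, and at least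
  \<open>\<bar>t - 1 / e\<bar> / (2 \<beta>\<^sup>2)\<close> otherwise; the power \<open>-r\<close> of the latter is integrable near its singularity.  The bound does not
  involve \<open>e\<close>.\<close>

lemma law_negative_moment:
  "(\<integral>\<^sup>+t. ennreal (\<bar>1 / t - e\<bar> powr - r) \<partial>law)
     \<le> ennreal ((2 * \<beta>) powr r + (2 * \<beta>\<^sup>2) powr r * (K * (2 / (1 - r)) + 1))"
proof -
  have \<beta>0: "\<beta> > 0" using \<alpha>_pos \<alpha>_\<beta> by simp
  have tot: "(\<integral>\<^sup>+t. ennreal (\<rho> t) \<partial>lborel) = 1"
    using D.emeasure_space_1 by (simp add: emeasure_density)
  let ?S = "\<lambda>w t. ennreal (\<bar>t - w\<bar> powr - r) * indicator {w - 1..w + 1} t"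
  have pw: "ennreal (\<rho> t) * ennreal (\<bar>1 / t - e\<bar> powr - r) \<le> ennreal ((2 * \<beta>) powr r) * ennreal (\<rho> t)
      + ennreal ((2 * \<beta>\<^sup>2) powr r) * (ennreal K * ?S (1 / e) t + ennreal (\<rho> t))" for t
  proof (cases "t \<in> {\<alpha>..\<beta>} \<and> 1 / t - e \<noteq> 0")
    case False
    then show ?thesis using \<rho>_support[of t] by auto
  next
    case True
    then have t: "0 < t" "t \<le> \<beta>" and ne: "1 / t - e \<noteq> 0" using \<alpha>_pos by auto
    have "1 / t - e = (1 - t * e) / t" using t(1) by (simp add: field_simps)
    then have eq: "\<bar>1 / t - e\<bar> = \<bar>1 - t * e\<bar> / t" using t(1) by simp
    also have "\<dots> \<ge> \<bar>1 - t * e\<bar> / \<beta>" using t \<beta>0 by (intro divide_left_mono) auto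
    finally have low: "\<bar>1 - t * e\<bar> / \<beta> \<le> \<bar>1 / t - e\<bar>" .
    show ?thesis
    proof (cases "\<bar>e\<bar> \<le> 1 / (2 * \<beta>)")
      case True
      have "\<bar>t * e\<bar> \<le> \<beta> * (1 / (2 * \<beta>))" unfolding abs_mult using t True by (intro mult_mono) auto
      then have "\<bar>t * e\<bar> \<le> 1 / 2" using \<beta>0 by simp
      then have "1 / 2 \<le> \<bar>1 - t * e\<bar>" by linarith
      then have "1 / 2 / \<beta> \<le> \<bar>1 - t * e\<bar> / \<beta>" using \<beta>0 by (intro divide_right_mono) auto
      then have "1 / (2 * \<beta>) \<le> \<bar>1 / t - e\<bar>" using low by simp
      then have "\<bar>1 / t - e\<bar> powr - r \<le> (1 / (2 * \<beta>)) powr - r"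
        using \<beta>0 r by (intro powr_mono2') auto
      also have "\<dots> = (2 * \<beta>) powr r" using \<beta>0 by (simp add: powr_divide powr_minus_divide)
      finally have "ennreal (\<bar>1 / t - e\<bar> powr - r) \<le> ennreal ((2 * \<beta>) powr r)" by (rule ennreal_leI)
      then have "ennreal (\<rho> t) * ennreal (\<bar>1 / t - e\<bar> powr - r) \<le> ennreal ((2 * \<beta>) powr r) * ennreal (\<rho> t)"
        by (subst mult.commute) (rule mult_right_mono, auto)
      then show ?thesis by (rule order_trans) simp
    next
      case False
      define w where "w = 1 / e"
      have e0: "e \<noteq> 0" using False \<beta>0 by auto
      have "\<bar>1 - t * e\<bar> = \<bar>e\<bar> * \<bar>t - w\<bar>"
      proof -
        have "1 - t * e = - (e * (t - w))" using e0 by (simp add: w_def algebra_simps)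
        then show ?thesis by (simp add: abs_mult)
      qed
      then have tw: "t \<noteq> w" using ne eq by auto
      have "1 / (2 * \<beta>) * \<bar>t - w\<bar> / \<beta> \<le> \<bar>e\<bar> * \<bar>t - w\<bar> / \<beta>"
        using False \<beta>0 by (intro divide_right_mono mult_right_mono) auto
      also have "\<dots> \<le> \<bar>1 / t - e\<bar>" using low \<open>\<bar>1 - t * e\<bar> = \<bar>e\<bar> * \<bar>t - w\<bar>\<close> by simp
      finally have "\<bar>t - w\<bar> / (2 * \<beta>\<^sup>2) \<le> \<bar>1 / t - e\<bar>" by (simp add: power2_eq_square)
      then have "\<bar>1 / t - e\<bar> powr - r \<le> (\<bar>t - w\<bar> / (2 * \<beta>\<^sup>2)) powr - r"
        using tw \<beta>0 r by (intro powr_mono2') auto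
      also have "\<dots> = (2 * \<beta>\<^sup>2) powr r * \<bar>t - w\<bar> powr - r"
        using \<beta>0 by (simp add: powr_divide powr_minus_divide)
      finally have A: "ennreal (\<bar>1 / t - e\<bar> powr - r) \<le> ennreal ((2 * \<beta>\<^sup>2) powr r) * ennreal (\<bar>t - w\<bar> powr - r)"
        by (simp add: ennreal_mult[symmetric] ennreal_leI)
      have B: "ennreal (\<rho> t) * ennreal (\<bar>t - w\<bar> powr - r) \<le> ennreal K * ?S w t + ennreal (\<rho> t)"
      proof (cases "t \<in> {w - 1..w + 1}")
        case True
        have "ennreal (\<rho> t) * ennreal (\<bar>t - w\<bar> powr - r) \<le> ennreal K * ennreal (\<bar>t - w\<bar> powr - r)"
          using \<rho>_bound[of t] by (intro mult_right_mono ennreal_leI) auto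
        then show ?thesis using True by (simp add: add_increasing2)
      next
        case False
        then have "1 \<le> \<bar>t - w\<bar>" by auto
        then have "\<bar>t - w\<bar> powr - r \<le> 1 powr - r" using r by (intro powr_mono2') auto
        then have "ennreal (\<rho> t) * ennreal (\<bar>t - w\<bar> powr - r) \<le> ennreal (\<rho> t) * ennreal 1"
          by (intro mult_left_mono ennreal_leI) auto
        then show ?thesis using False by simp
      qed
      have "ennreal (\<rho> t) * ennreal (\<bar>1 / t - e\<bar> powr - r)
          \<le> ennreal (\<rho> t) * (ennreal ((2 * \<beta>\<^sup>2) powr r) * ennreal (\<bar>t - w\<bar> powr - r))"
        by (intro mult_left_mono A) auto
      also have "\<dots> = ennreal ((2 * \<beta>\<^sup>2) powr r) * (ennreal (\<rho> t) * ennreal (\<bar>t - w\<bar> powr - r))"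
        by (simp add: mult_ac)
      also have "\<dots> \<le> ennreal ((2 * \<beta>\<^sup>2) powr r) * (ennreal K * ?S w t + ennreal (\<rho> t))"
        by (intro mult_left_mono B) auto
      finally show ?thesis unfolding w_def by (rule order_trans) simp
    qed
  qed
  have "(\<integral>\<^sup>+t. ennreal (\<bar>1 / t - e\<bar> powr - r) \<partial>law) = (\<integral>\<^sup>+t. ennreal (\<rho> t) * ennreal (\<bar>1 / t - e\<bar> powr - r) \<partial>lborel)"
    by (rule nn_integral_density[OF \<rho>_meas_lborel]) simp
  also have "\<dots> \<le> (\<integral>\<^sup>+t. ennreal ((2 * \<beta>) powr r) * ennreal (\<rho> t)
      + ennreal ((2 * \<beta>\<^sup>2) powr r) * (ennreal K * ?S (1 / e) t + ennreal (\<rho> t)) \<partial>lborel)"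
    by (intro nn_integral_mono pw)
  also have "\<dots> = ennreal ((2 * \<beta>) powr r)
      + ennreal ((2 * \<beta>\<^sup>2) powr r) * (ennreal K * (\<integral>\<^sup>+t. ?S (1 / e) t \<partial>lborel) + 1)"
    by (simp add: nn_integral_add nn_integral_cmult tot)
  also have "\<dots> \<le> ennreal ((2 * \<beta>) powr r)
      + ennreal ((2 * \<beta>\<^sup>2) powr r) * (ennreal K * ennreal (2 / (1 - r)) + 1)"
    by (intro add_mono mult_left_mono nn_integral_powr_singularity r) auto
  also have "\<dots> = ennreal ((2 * \<beta>) powr r + (2 * \<beta>\<^sup>2) powr r * (K * (2 / (1 - r)) + 1))"
    using K_nonneg r by (simp add: ennreal_mult[symmetric] ennreal_1[symmetric] ennreal_plus[symmetric] del: ennreal_1 ennreal_plus)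
  finally show ?thesis .
qed

definition moment_const :: real where
  "moment_const = (2 * \<beta>) powr r + (2 * \<beta>\<^sup>2) powr r * (K * (2 / (1 - r)) + 1)"

lemma moment_const_nonneg: "moment_const \<ge> 0"
  unfolding moment_const_def using K_nonneg r by (intro add_nonneg_nonneg mult_nonneg_nonneg) auto

definition tail_bound :: "nat \<Rightarrow> real \<Rightarrow> bool" where
  "tail_bound n0 q \<longleftrightarrow> (\<forall>i\<ge>n0. \<forall>F. finite F \<longrightarrow> F \<subseteq> {n0..} - {i} \<longrightarrow> (\<Sum>k\<in>F. 1 / dist (a i) (a k) powr r) \<le> q)"

lemma sparse_tail:
  assumes "q > 0"
  shows "\<exists>n0\<ge>N. tail_bound n0 q"
proof -
  let ?f = "\<lambda>i j. ennreal (1 / dist (a i) (a j) powr r)"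
  have "\<forall>\<^sub>F M in sequentially. (SUP i\<in>{M..}. \<Sum>\<^sub>\<infinity>j\<in>{M..} - {i}. ?f i j) < ennreal q"
    using sparse by (rule order_tendstoD(2)) (use assms in simp)
  then obtain M where M: "\<And>m. m \<ge> M \<Longrightarrow> (SUP i\<in>{m..}. \<Sum>\<^sub>\<infinity>j\<in>{m..} - {i}. ?f i j) < ennreal q"
    unfolding eventually_sequentially by blast
  define n0 where "n0 = max M N"
  have "(\<Sum>k\<in>F. 1 / dist (a i) (a k) powr r) \<le> q" if i: "i \<ge> n0" and F: "finite F" "F \<subseteq> {n0..} - {i}" for i F
  proof -
    have "ennreal (\<Sum>k\<in>F. 1 / dist (a i) (a k) powr r) = (\<Sum>k\<in>F. ?f i k)" by (simp add: sum_ennreal)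
    also have "\<dots> \<le> (\<Sum>\<^sub>\<infinity>j\<in>{n0..} - {i}. ?f i j)"
      by (subst nonneg_infsum_complete) (use F in \<open>auto intro!: SUP_upper\<close>)
    also have "\<dots> \<le> (SUP i\<in>{n0..}. \<Sum>\<^sub>\<infinity>j\<in>{n0..} - {i}. ?f i j)" using i by (intro SUP_upper) auto
    also have "\<dots> \<le> ennreal q" using M[of n0] by (simp add: n0_def less_imp_le)
    finally show ?thesis using assms by (simp add: ennreal_le_iff)
  qed
  then show ?thesis unfolding tail_bound_def by (intro exI[of _ n0]) (auto simp: n0_def)
qed

text \<open>The decay of the free resolvent and \<open>tail_bound\<close> make the matrix of the system small in the sense of \<open>AE_bounded_solutions\<close>
  for the exponent \<open>r\<close>.\<close>

lemma AE_moment_finite: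
  assumes g: "g > 0" "\<And>n. g \<le> \<bar>level_eigenvalue n - l\<bar>"
    and tail: "tail_bound n0 q" and q: "moment_const * ((total_weight / g\<^sup>2) powr r * q) \<le> 1 / 2"
    and b: "b < n0"
  shows "AE \<tau> in couplings. \<forall>\<mu>. bounded_selfadjoint.spectral_measure (hamiltonian {n0..} \<tau>) window (point_mass (a b)) \<mu>
     \<longrightarrow> inverse_square_moment \<mu> l < \<infinity>"
proof -
  define Q where "Q = total_weight / g\<^sup>2"
  have Q0: "Q \<ge> 0" using total_weight_nonneg by (simp add: Q_def)
  define Kf where "Kf i k = (if i = k then 0 else ell2_app (free_resolvent l (point_mass (a k))) (a i))" for i k
  define h where "h k = ell2_app (free_resolvent l (point_mass (a b))) (a k)" for k
  define \<gamma> where "\<gamma> k = ell2_app (free_resolvent l (point_mass (a k))) (a k)" for k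
  have entry: "\<bar>ell2_app (free_resolvent l (point_mass (a k))) (a i)\<bar> powr r \<le> Q powr r * (1 / dist (a i) (a k) powr r)"
    if "i \<noteq> k" for i k
  proof -
    have "a i \<noteq> a k" using inj_a that by (auto simp: inj_def)
    then have "\<bar>ell2_app (free_resolvent l (point_mass (a k))) (a i)\<bar> \<le> Q / dist (a i) (a k)"
      unfolding Q_def by (rule free_resolvent_kernel_decay[OF g])
    then have "\<bar>ell2_app (free_resolvent l (point_mass (a k))) (a i)\<bar> powr r \<le> (Q / dist (a i) (a k)) powr r"
      using r by (intro powr_mono2) auto
    also have "\<dots> = Q powr r * (1 / dist (a i) (a k) powr r)" using Q0 by (simp add: powr_divide)
    finally show ?thesis .
  qed
  have small: "moment_const * (\<Sum>k\<in>{n0..<n}. \<bar>Kf k i\<bar> powr r) \<le> 1 / 2" if i: "i \<in> {n0..<n}" for n i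
  proof -
    have "(\<Sum>k\<in>{n0..<n}. \<bar>Kf k i\<bar> powr r) = (\<Sum>k\<in>{n0..<n} - {i}. \<bar>Kf k i\<bar> powr r)"
      by (rule sum.mono_neutral_right) (auto simp: Kf_def)
    also have "\<dots> \<le> (\<Sum>k\<in>{n0..<n} - {i}. Q powr r * (1 / dist (a i) (a k) powr r))"
      by (intro sum_mono) (use entry in \<open>auto simp: Kf_def dist_commute\<close>)
    also have "\<dots> = Q powr r * (\<Sum>k\<in>{n0..<n} - {i}. 1 / dist (a i) (a k) powr r)" by (simp add: sum_distrib_left)
    also have "\<dots> \<le> Q powr r * q"
    proof (rule mult_left_mono)
      have "finite ({n0..<n} - {i})" "{n0..<n} - {i} \<subseteq> {n0..} - {i}" by auto
      then show "(\<Sum>k\<in>{n0..<n} - {i}. 1 / dist (a i) (a k) powr r) \<le> q"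
        using tail i unfolding tail_bound_def by (meson atLeastLessThan_iff)
    qed simp
    finally have "moment_const * (\<Sum>k\<in>{n0..<n}. \<bar>Kf k i\<bar> powr r) \<le> moment_const * (Q powr r * q)"
      by (rule mult_left_mono[OF _ moment_const_nonneg])
    then show ?thesis using q unfolding Q_def by linarith
  qed
  \<comment> \<open>The site \<open>b\<close> is not covered by \<open>tail_bound\<close>; up to the factor \<open>c0\<close> distances from it are those from the site \<open>n0\<close>.\<close>
  define c0 where "c0 = dist (a b) (a n0)"
  have c0: "c0 \<ge> 1" unfolding c0_def using inj_a b by (intro dist_ge_1) (auto simp: inj_def)
  have h_sum: "(\<Sum>k\<in>{n0..<n}. \<bar>h k\<bar> powr r) \<le> Q powr r * (c0 powr r * q + 1)" for n
  proof -
    have pt: "1 / dist (a k) (a b) powr r \<le> c0 powr r * (1 / dist (a n0) (a k) powr r)" if k: "k \<in> {n0..<n} - {n0}" for k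
    proof -
      have ne: "a k \<noteq> a b" "a n0 \<noteq> a k" using b k by (auto simp: inj_eq[OF inj_a])
      have d1: "1 \<le> dist (a k) (a b)" by (rule dist_ge_1[OF ne(1)])
      have "dist (a n0) (a k) \<le> max c0 (dist (a k) (a b))"
        using ultrametric[of "a n0" "a k" "a b"] by (simp add: c0_def dist_commute)
      also have "\<dots> \<le> c0 * dist (a k) (a b)"
        using c0 d1 mult_left_mono[OF d1, of c0] mult_right_mono[OF c0, of "dist (a k) (a b)"] by simp
      finally have "dist (a n0) (a k) powr r \<le> (c0 * dist (a k) (a b)) powr r"
        using r by (intro powr_mono2) auto
      then have "dist (a n0) (a k) powr r \<le> c0 powr r * dist (a k) (a b) powr r"
        using c0 by (simp add: powr_mult)
      moreover have "dist (a n0) (a k) powr r > 0" "dist (a k) (a b) powr r > 0" using ne by auto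
      ultimately show ?thesis by (simp add: divide_simps mult.commute)
    qed
    have hk: "\<bar>h k\<bar> powr r \<le> Q powr r * (1 / dist (a k) (a b) powr r)" if "k \<in> {n0..<n}" for k
      unfolding h_def using b that by (intro entry) auto
    have "(\<Sum>k\<in>{n0..<n}. \<bar>h k\<bar> powr r) \<le> Q powr r * (\<Sum>k\<in>{n0..<n}. 1 / dist (a k) (a b) powr r)"
      unfolding sum_distrib_left by (intro sum_mono hk)
    also have "\<dots> \<le> Q powr r * (c0 powr r * q + 1)"
    proof (rule mult_left_mono)
      have one: "1 / dist (a n0) (a b) powr r \<le> 1"
      proof -
        have "1 powr r \<le> c0 powr r" using c0 r by (intro powr_mono2) auto
        then show ?thesis using c0 by (simp add: c0_def dist_commute divide_simps)
      qed
      have "(\<Sum>k\<in>{n0..<n}. 1 / dist (a k) (a b) powr r)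
          \<le> (\<Sum>k\<in>insert n0 ({n0..<n} - {n0}). 1 / dist (a k) (a b) powr r)"
        by (rule sum_mono2) auto
      also have "\<dots> = 1 / dist (a n0) (a b) powr r + (\<Sum>k\<in>{n0..<n} - {n0}. 1 / dist (a k) (a b) powr r)"
        by (rule sum.insert) auto
      also have "\<dots> \<le> 1 + (\<Sum>k\<in>{n0..<n} - {n0}. c0 powr r * (1 / dist (a n0) (a k) powr r))"
        by (intro add_mono one sum_mono pt)
      also have "\<dots> = 1 + c0 powr r * (\<Sum>k\<in>{n0..<n} - {n0}. 1 / dist (a n0) (a k) powr r)"
        by (simp only: sum_distrib_left)
      also have "\<dots> \<le> 1 + c0 powr r * q"
      proof (intro add_left_mono mult_left_mono)
        have "finite ({n0..<n} - {n0})" "{n0..<n} - {n0} \<subseteq> {n0..} - {n0}" by auto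
        then show "(\<Sum>k\<in>{n0..<n} - {n0}. 1 / dist (a n0) (a k) powr r) \<le> q"
          using tail unfolding tail_bound_def by blast
      qed simp
      finally show "(\<Sum>k\<in>{n0..<n}. 1 / dist (a k) (a b) powr r) \<le> c0 powr r * q + 1" by simp
    qed simp
    finally show ?thesis .
  qed
  have "AE \<tau> in couplings. \<exists>B. \<exists>\<^sub>\<infinity>n. \<exists>v. (\<Sum>k\<in>{n0..<n}. \<bar>v k\<bar> powr r) \<le> B \<and>
     (\<forall>i\<in>{n0..<n}. system_op (diagonal \<gamma> \<tau>) Kf {n0..<n} v i = h i)"
  proof (rule AE_bounded_solutions[of r moment_const])
    show "(\<integral>\<^sup>+t. ennreal (\<bar>1 / t - e\<bar> powr - r) \<partial>law) \<le> ennreal moment_const" for e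
      unfolding moment_const_def by (rule law_negative_moment)
    show "AE t in law. 1 / t \<noteq> e" for e by (rule law_no_atom)
    show "Kf i k = Kf k i" for i k
      unfolding Kf_def using free_resolvent_kernel_sym[OF g] by auto
    show "Kf i i = 0" for i by (simp add: Kf_def)
    show "moment_const * (\<Sum>k\<in>{n0..<n}. \<bar>Kf k i\<bar> powr r) \<le> 1 / 2" if "i \<in> {n0..<n}" for n i by (rule small[OF that])
    show "(\<Sum>k\<in>{n0..<n}. \<bar>h k\<bar> powr r) \<le> Q powr r * (c0 powr r * q + 1)" for n by (rule h_sum)
  qed (use r moment_const_nonneg in auto)
  then show ?thesis using AE_couplings_window
  proof eventually_elim
    case (elim \<tau>)
    then obtain B where B: "\<exists>\<^sub>\<infinity>n. \<exists>v. (\<Sum>k\<in>{n0..<n}. \<bar>v k\<bar> powr r) \<le> B \<and>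
      (\<forall>i\<in>{n0..<n}. system_op (diagonal \<gamma> \<tau>) Kf {n0..<n} v i = h i)" by blast
    show ?case
    proof (intro allI impI)
      fix \<mu> assume sm: "bounded_selfadjoint.spectral_measure (hamiltonian {n0..} \<tau>) window (point_mass (a b)) \<mu>"
      show "inverse_square_moment \<mu> l < \<infinity>"
      proof (rule moment_finite_if_bounded_solutions[OF g b _ _ _ _ _ B sm])
        show "Kf i k = (if i = k then 0 else ell2_app (free_resolvent l (point_mass (a k))) (a i))" for i k
          by (rule Kf_def)
        show "diagonal \<gamma> \<tau> k = 1 / clamp (\<tau> k) - ell2_app (free_resolvent l (point_mass (a k))) (a k)" for k
          using elim(2) by (simp add: diagonal_def \<gamma>_def clamp_id)
        show "h k = ell2_app (free_resolvent l (point_mass (a b))) (a k)" for k by (rule h_def)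
      qed (use r in auto)
    qed
  qed
qed

end

section \<open>Spectral averaging\<close>

context random_schroedinger
begin

text \<open>The choice is made from a set that depends on \<open>hamiltonian S \<tau>\<close> only, so the chosen measure does not see couplings outside
  \<open>S\<close> (\<open>site_measure_cong\<close>).\<close>

definition site_measure :: "nat set \<Rightarrow> (nat \<Rightarrow> real) \<Rightarrow> nat \<Rightarrow> real measure" where
  "site_measure S \<tau> b = (SOME \<mu>. bounded_selfadjoint.spectral_measure (hamiltonian S \<tau>) window (point_mass (a b)) \<mu>)"

lemma site_measure: "bounded_selfadjoint.spectral_measure (hamiltonian S \<tau>) window (point_mass (a b)) (site_measure S \<tau> b)"
  unfolding site_measure_def
  by (rule someI_ex) (rule bounded_selfadjoint.spectral_measure_exists[OF hamiltonian_selfadjoint norm_point_mass])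

lemma site_measure_cong: "(\<And>i. i \<in> S \<Longrightarrow> \<tau> i = \<tau>' i) \<Longrightarrow> site_measure S \<tau> b = site_measure S \<tau>' b"
  unfolding site_measure_def using hamiltonian_cong[of S \<tau> \<tau>'] by simp

lemma countable_space: "countable (UNIV :: 'a set)" and infinite_space: "infinite (UNIV :: 'a set)"
  using space unfolding homogeneous_ultrametric_measure_space_def by blast+

lemma opoly_measurable:
  "(\<lambda>\<tau>. ell2_app (opoly (hamiltonian S \<tau>) p v) y) \<in> borel_measurable couplings"
proof (induction p arbitrary: y)
  case 0
  then show ?case by (simp add: bounded_selfadjoint.opoly_0[OF hamiltonian_selfadjoint])
next
  case (pCons c p)
  have lap: "(\<lambda>\<tau>. inner (laplacian_op (point_mass y)) (opoly (hamiltonian S \<tau>) p v)) \<in> borel_measurable couplings"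
    by (rule inner_ell2_measurable[OF countable_space infinite_space pCons(2)])
  have well_meas: "(\<lambda>\<tau>. well S \<tau> y) \<in> borel_measurable couplings"
    unfolding well_def clamp_def by measurable
  have "ell2_app (opoly (hamiltonian S \<tau>) (pCons c p) v) y = c * ell2_app v y
      + (inner (laplacian_op (point_mass y)) (opoly (hamiltonian S \<tau>) p v) - well S \<tau> y * ell2_app (opoly (hamiltonian S \<tau>) p v) y)" for \<tau>
    by (simp add: bounded_selfadjoint.opoly_pCons[OF hamiltonian_selfadjoint] laplacian_op_sym)
      (simp add: hamiltonian_def)
  moreover have "(\<lambda>\<tau>. c * ell2_app v y
      + (inner (laplacian_op (point_mass y)) (opoly (hamiltonian S \<tau>) p v) - well S \<tau> y * ell2_app (opoly (hamiltonian S \<tau>) p v) y))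
      \<in> borel_measurable couplings"
    using lap well_meas pCons(2)[of y] by measurable
  ultimately show ?case by simp
qed

lemma site_measure_kernel: "(\<lambda>\<tau>. site_measure S \<tau> b) \<in> measurable couplings (prob_algebra borel)"
proof (rule measurable_kernel_if_poly_moments[where M=window])
  fix \<tau>
  interpret H: bounded_selfadjoint "hamiltonian S \<tau>" window by (rule hamiltonian_selfadjoint)
  note sm = site_measure[of S \<tau> b]
  show "prob_space (site_measure S \<tau> b)" by (rule H.spectral_measure_prob[OF sm])
  show "sets (site_measure S \<tau> b) = sets borel" by (rule H.spectral_measure_sets[OF sm])
  show "AE x in site_measure S \<tau> b. \<bar>x\<bar> \<le> window" by (rule H.spectral_measure_AE[OF sm])
next
  fix p
  have "(\<integral>x. poly p x \<partial>site_measure S \<tau> b) = ell2_app (opoly (hamiltonian S \<tau>) p (point_mass (a b))) (a b)" for \<tau>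
    using bounded_selfadjoint.spectral_measure_poly[OF hamiltonian_selfadjoint site_measure] by simp
  then show "(\<lambda>\<tau>. \<integral>x. poly p x \<partial>site_measure S \<tau> b) \<in> borel_measurable couplings"
    using opoly_measurable by simp
qed

lemma site_measure_subprob: "(\<lambda>\<tau>. site_measure S \<tau> b) \<in> measurable couplings (subprob_algebra borel)"
  by (rule measurable_prob_algebraD[OF site_measure_kernel])

lemma moment_measurable:
  "(\<lambda>p. inverse_square_moment (site_measure S (fst p) b) (snd p)) \<in> borel_measurable (couplings \<Otimes>\<^sub>M borel)"
  unfolding inverse_square_moment_def
proof (rule nn_integral_measurable_subprob_algebra2[where N=borel])
  show "(\<lambda>p. site_measure S (fst p) b) \<in> measurable (couplings \<Otimes>\<^sub>M borel) (subprob_algebra borel)"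
    by (rule measurable_compose[OF measurable_fst site_measure_subprob])
  show "(\<lambda>(p, x). inverse (ennreal ((x - snd p)\<^sup>2))) \<in> borel_measurable ((couplings \<Otimes>\<^sub>M borel) \<Otimes>\<^sub>M borel)"
  proof -
    have "(\<lambda>q. snd q - snd (fst q)) \<in> borel_measurable ((couplings \<Otimes>\<^sub>M borel) \<Otimes>\<^sub>M (borel :: real measure))"
      by (intro borel_measurable_diff measurable_snd measurable_compose[OF measurable_fst measurable_snd])
    then have "(\<lambda>q. inverse (ennreal ((snd q - snd (fst q))\<^sup>2))) \<in> borel_measurable ((couplings \<Otimes>\<^sub>M borel) \<Otimes>\<^sub>M (borel :: real measure))"
      by measurable
    then show ?thesis by (simp add: case_prod_beta')
  qed
qed

text \<open>Changing the coupling at \<open>j\<close> is a rank-one perturbation along the point mass whose spectral measure is considered.  By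
  \<open>rank_one_Poisson\<close> its Poisson integrals are Cauchy densities in the coupling, of total integral \<open>pi\<close>, so the average over
  a law with density at most \<open>K\<close> gives an interval a mass of at most \<open>K * pi\<close> times its length.\<close>

lemma averaged_site_measure_null:
  assumes Z: "Z \<in> null_sets lborel"
  shows "(\<integral>\<^sup>+t. emeasure (site_measure UNIV (\<tau>(j := t)) j) Z \<partial>law) = 0"
proof -
  define f where "f = point_mass (a j)"
  define \<kappa> where "\<kappa> t = site_measure UNIV (\<tau>(j := t)) j" for t
  define H0 where "H0 = hamiltonian (UNIV - {j}) \<tau>"
  have H0: "bounded_selfadjoint H0 window" unfolding H0_def by (rule hamiltonian_selfadjoint)
  have Ht: "hamiltonian UNIV (\<tau>(j := t)) = (\<lambda>v. H0 v - (clamp t * inner f v) *\<^sub>R f)" for t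
  proof
    fix v
    have "hamiltonian (UNIV - {j}) (\<tau>(j := t)) = H0" unfolding H0_def by (rule hamiltonian_cong) auto
    then show "hamiltonian UNIV (\<tau>(j := t)) v = H0 v - (clamp t * inner f v) *\<^sub>R f"
      using hamiltonian_remove_site[of j UNIV "\<tau>(j := t)" v] by (simp add: f_def)
  qed
  have \<kappa>_meas: "\<kappa> \<in> measurable law (subprob_algebra borel)"
  proof -
    have "(\<lambda>t. \<tau>(j := t)) \<in> measurable law couplings"
      using measurable_compose[OF measurable_Pair2'[of \<tau> couplings law] measurable_update[of j]] by simp
    then show ?thesis unfolding \<kappa>_def by (rule measurable_compose[OF _ site_measure_subprob])
  qed
  have space_law: "space law \<noteq> {}" by simp
  define \<nu> where "\<nu> = law \<bind> \<kappa>"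
  have \<nu>: "emeasure \<nu> A = (\<integral>\<^sup>+t. emeasure (\<kappa> t) A \<partial>law)" if "A \<in> sets borel" for A
    unfolding \<nu>_def by (rule emeasure_bind[OF space_law \<kappa>_meas that])
  have \<nu>_sets: "sets \<nu> = sets borel" unfolding \<nu>_def by (rule sets_bind[OF sets_kernel[OF \<kappa>_meas] space_law])
  have interval: "emeasure \<nu> {E - \<eta>..E + \<eta>} \<le> ennreal (K * pi * (2 * \<eta>))" if \<eta>: "\<eta> > 0" for E \<eta>
  proof -
    have nf: "norm f = 1" by (simp add: f_def)
    obtain p q where q: "q > 0" and pq: "\<And>t Mt \<mu>. bounded_selfadjoint (\<lambda>x. H0 x - (t * inner f x) *\<^sub>R f) Mt \<Longrightarrow>
      bounded_selfadjoint.spectral_measure (\<lambda>x. H0 x - (t * inner f x) *\<^sub>R f) Mt f \<mu> \<Longrightarrow>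
      (\<integral>x. 1 / ((x - E)\<^sup>2 + \<eta>\<^sup>2) \<partial>\<mu>) = (1 / \<eta>) * (q / ((p - t)\<^sup>2 + q\<^sup>2))"
      by (rule rank_one_Poisson[OF H0 nf \<eta>, of E]) blast
    have mass: "emeasure (\<kappa> t) {E - \<eta>..E + \<eta>} \<le> ennreal (2 * \<eta>) * ennreal (q / ((p - clamp t)\<^sup>2 + q\<^sup>2))" for t
    proof -
      have bs: "bounded_selfadjoint (\<lambda>x. H0 x - (clamp t * inner f x) *\<^sub>R f) window"
        using hamiltonian_selfadjoint[of UNIV "\<tau>(j := t)"] unfolding Ht .
      have sm: "bounded_selfadjoint.spectral_measure (\<lambda>x. H0 x - (clamp t * inner f x) *\<^sub>R f) window f (\<kappa> t)"
        using site_measure[of UNIV "\<tau>(j := t)" j] unfolding Ht \<kappa>_def f_def .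
      interpret B: bounded_selfadjoint "\<lambda>x. H0 x - (clamp t * inner f x) *\<^sub>R f" window by (rule bs)
      interpret \<kappa>t: prob_space "\<kappa> t" by (rule B.spectral_measure_prob[OF sm])
      have "measure (\<kappa> t) {E - \<eta>..E + \<eta>} \<le> 2 * \<eta>\<^sup>2 * (\<integral>x. 1 / ((x - E)\<^sup>2 + \<eta>\<^sup>2) \<partial>\<kappa> t)"
        by (rule B.measure_le_Poisson[OF sm \<eta>])
      also have "\<dots> = 2 * \<eta> * (q / ((p - clamp t)\<^sup>2 + q\<^sup>2))"
        unfolding pq[OF bs sm] using \<eta> by (simp add: power2_eq_square)
      finally have "measure (\<kappa> t) {E - \<eta>..E + \<eta>} \<le> 2 * \<eta> * (q / ((p - clamp t)\<^sup>2 + q\<^sup>2))" .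
      then show ?thesis using \<eta> q
        by (simp add: \<kappa>t.emeasure_eq_measure ennreal_mult[symmetric] ennreal_leI)
    qed
    have "emeasure \<nu> {E - \<eta>..E + \<eta>} \<le> (\<integral>\<^sup>+t. ennreal (2 * \<eta>) * ennreal (q / ((p - clamp t)\<^sup>2 + q\<^sup>2)) \<partial>law)"
      by (subst \<nu>) (auto intro!: nn_integral_mono mass)
    also have "\<dots> = (\<integral>\<^sup>+t. ennreal (\<rho> t) * (ennreal (2 * \<eta>) * ennreal (q / ((p - clamp t)\<^sup>2 + q\<^sup>2))) \<partial>lborel)"
      by (rule nn_integral_density[OF \<rho>_meas_lborel]) (simp add: clamp_def)
    also have "\<dots> \<le> (\<integral>\<^sup>+t. (ennreal K * ennreal (2 * \<eta>)) * ennreal (q / ((p - t)\<^sup>2 + q\<^sup>2)) \<partial>lborel)"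
    proof (rule nn_integral_mono)
      fix t
      show "ennreal (\<rho> t) * (ennreal (2 * \<eta>) * ennreal (q / ((p - clamp t)\<^sup>2 + q\<^sup>2)))
        \<le> (ennreal K * ennreal (2 * \<eta>)) * ennreal (q / ((p - t)\<^sup>2 + q\<^sup>2))"
      proof (cases "t \<in> {\<alpha>..\<beta>}")
        case True
        have "ennreal (\<rho> t) \<le> ennreal K" using \<rho>_bound by (intro ennreal_leI) auto
        then show ?thesis unfolding clamp_id[OF True] mult.assoc by (rule mult_right_mono) simp
      qed (simp add: \<rho>_support)
    qed
    also have "\<dots> = (ennreal K * ennreal (2 * \<eta>)) * ennreal pi"
      by (subst nn_integral_cmult) (simp_all add: nn_integral_Cauchy_density[OF q])
    also have "\<dots> = ennreal (K * pi * (2 * \<eta>))"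
      using K_nonneg \<eta> by (simp add: ennreal_mult[symmetric] mult_ac)
    finally show ?thesis .
  qed
  have "Z \<in> null_sets \<nu>"
    by (rule null_set_if_interval_bound[OF \<nu>_sets interval _ Z]) (use K_nonneg in auto)
  then show ?thesis using \<nu>[of Z] Z by (auto simp: \<kappa>_def null_sets_def)
qed

text \<open>A volume from which on the fractional moment estimate applies at all energies at distance at least \<open>1 / (N + 1)\<close> from the
  eigenvalues of the Laplacian.  It is beyond \<open>j\<close> in order that the coupling at \<open>j\<close> does not enter.\<close>

definition cutoff :: "nat \<Rightarrow> nat \<Rightarrow> nat" where
  "cutoff j N = (SOME n0. j < n0 \<and> (\<exists>q. tail_bound n0 q \<and>
     moment_const * ((total_weight / (1 / real (Suc N))\<^sup>2) powr r * q) \<le> 1 / 2))"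

lemma cutoff:
  "j < cutoff j N"
  "\<exists>q. tail_bound (cutoff j N) q \<and> moment_const * ((total_weight / (1 / real (Suc N))\<^sup>2) powr r * q) \<le> 1 / 2"
proof -
  define c where "c = moment_const * (total_weight / (1 / real (Suc N))\<^sup>2) powr r"
  have c: "c \<ge> 0" unfolding c_def using moment_const_nonneg by simp
  \<comment> \<open>Any positive \<open>q\<close> with \<open>c q \<le> 1 / 2\<close> will do; the summand \<open>1\<close> covers the case \<open>c = 0\<close>.\<close>
  define q where "q = 1 / (2 * (c + 1))"
  have "q > 0" using c by (simp add: q_def)
  then obtain n0 where "n0 \<ge> Suc j" "tail_bound n0 q"
    using sparse_tail[of q "Suc j"] by blast
  moreover have "c * q \<le> 1 / 2" using c by (simp add: q_def divide_simps)
  ultimately have "\<exists>n0. j < n0 \<and> (\<exists>q. tail_bound n0 q \<and>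
     moment_const * ((total_weight / (1 / real (Suc N))\<^sup>2) powr r * q) \<le> 1 / 2)"
    unfolding c_def by (intro exI[of _ n0] conjI exI[of _ q]) (auto simp: mult.assoc)
  from someI_ex[OF this] show "j < cutoff j N"
    "\<exists>q. tail_bound (cutoff j N) q \<and> moment_const * ((total_weight / (1 / real (Suc N))\<^sup>2) powr r * q) \<le> 1 / 2"
    unfolding cutoff_def by blast+
qed

text \<open>The energies at which \<open>finite_rank_dichotomy\<close> is not available.  Only couplings beyond the cutoff are involved, so being
  exceptional does not depend on the coupling at \<open>j\<close> (\<open>exceptional_update\<close>).\<close>

definition exceptional :: "nat \<Rightarrow> (nat \<Rightarrow> real) \<Rightarrow> real \<Rightarrow> bool" where
  "exceptional j \<tau> l \<longleftrightarrow> l \<in> laplacian_spectrum \<or>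
     (\<exists>N. (\<forall>n. 1 / real (Suc N) \<le> \<bar>level_eigenvalue n - l\<bar>) \<and>
       (\<exists>b<cutoff j N. inverse_square_moment (site_measure {cutoff j N..} \<tau> b) l = \<infinity>))"

lemma exceptional_update: "exceptional j (\<tau>(j := t)) l \<longleftrightarrow> exceptional j \<tau> l"
proof -
  have "site_measure {cutoff j N..} (\<tau>(j := t)) b = site_measure {cutoff j N..} \<tau> b" for N b
    by (rule site_measure_cong) (use cutoff(1)[of j N] in auto)
  then show ?thesis by (simp add: exceptional_def)
qed

lemma exceptional_measurable: "{p \<in> space (couplings \<Otimes>\<^sub>M borel). exceptional j (fst p) (snd p)} \<in> sets (couplings \<Otimes>\<^sub>M borel)"
proof -
  have snd_meas: "snd \<in> measurable (couplings \<Otimes>\<^sub>M borel) borel" by (rule measurable_snd)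
  have spec: "laplacian_spectrum \<in> sets borel"
    using countable_laplacian_spectrum by (rule sets.countable[rotated]) auto
  have [measurable]: "Measurable.pred (couplings \<Otimes>\<^sub>M borel) (\<lambda>p. snd p \<in> laplacian_spectrum)"
    by (rule measurable_compose[OF snd_meas]) (use spec in simp)
  have [measurable]: "Measurable.pred (couplings \<Otimes>\<^sub>M borel) (\<lambda>p. 1 / real (Suc N) \<le> \<bar>level_eigenvalue n - snd p\<bar>)" for N n
    using snd_meas by measurable
  have [measurable]: "Measurable.pred (couplings \<Otimes>\<^sub>M borel) (\<lambda>p. inverse_square_moment (site_measure S (fst p) b) (snd p) = \<infinity>)" for S b
    using moment_measurable[of S b] by measurable
  show ?thesis unfolding exceptional_def by measurable
qed

text \<open>At each fixed energy outside the spectrum of the Laplacian this is \<open>AE_moment_finite\<close>; Fubini's theorem exchanges the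
  two quantifiers.\<close>

lemma AE_not_exceptional:
  "AE \<tau> in couplings. AE l in lborel. \<not> exceptional j \<tau> l"
proof -
  interpret pair_sigma_finite couplings lborel ..
  have "{p \<in> space (couplings \<Otimes>\<^sub>M lborel). exceptional j (fst p) (snd p)} \<in> sets (couplings \<Otimes>\<^sub>M lborel)"
    using exceptional_measurable[of j] by (simp add: space_pair_measure sets_pair_measure_cong[OF refl sets_lborel])
  then have "{p \<in> space (couplings \<Otimes>\<^sub>M lborel). \<not> exceptional j (fst p) (snd p)} \<in> sets (couplings \<Otimes>\<^sub>M lborel)"
    by (rule sets.sets_Collect_neg)
  note commute = AE_commute[OF this]
  have "AE l in lborel. l \<notin> laplacian_spectrum"
    by (rule AE_not_in[OF countable_imp_null_set_lborel[OF countable_laplacian_spectrum]])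
  then have "AE l in lborel. AE \<tau> in couplings. \<not> exceptional j \<tau> l"
  proof eventually_elim
    case (elim l)
    have "AE \<tau> in couplings. \<forall>b. (\<forall>n. 1 / real (Suc N) \<le> \<bar>level_eigenvalue n - l\<bar>) \<longrightarrow> b < cutoff j N \<longrightarrow>
       inverse_square_moment (site_measure {cutoff j N..} \<tau> b) l < \<infinity>" for N
      unfolding AE_all_countable
    proof
      fix b
      show "AE \<tau> in couplings. (\<forall>n. 1 / real (Suc N) \<le> \<bar>level_eigenvalue n - l\<bar>) \<longrightarrow> b < cutoff j N \<longrightarrow>
         inverse_square_moment (site_measure {cutoff j N..} \<tau> b) l < \<infinity>"
      proof (cases "(\<forall>n. 1 / real (Suc N) \<le> \<bar>level_eigenvalue n - l\<bar>) \<and> b < cutoff j N")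
        case True
        obtain q where q: "tail_bound (cutoff j N) q"
          "moment_const * ((total_weight / (1 / real (Suc N))\<^sup>2) powr r * q) \<le> 1 / 2" using cutoff(2) by blast
        have "AE \<tau> in couplings. \<forall>\<mu>. bounded_selfadjoint.spectral_measure (hamiltonian {cutoff j N..} \<tau>) window (point_mass (a b)) \<mu>
          \<longrightarrow> inverse_square_moment \<mu> l < \<infinity>"
          by (rule AE_moment_finite[OF _ _ q]) (use True in auto)
        then show ?thesis by eventually_elim (use site_measure in blast)
      next
        case False then show ?thesis by (intro AE_I2) blast
      qed
    qed
    then have "AE \<tau> in couplings. \<forall>N b. (\<forall>n. 1 / real (Suc N) \<le> \<bar>level_eigenvalue n - l\<bar>) \<longrightarrow> b < cutoff j N \<longrightarrow>
       inverse_square_moment (site_measure {cutoff j N..} \<tau> b) l < \<infinity>"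
      by (subst AE_all_countable) blast
    then show ?case
    proof eventually_elim
      case (elim \<tau>)
      then show ?case using \<open>l \<notin> laplacian_spectrum\<close> unfolding exceptional_def by fastforce
    qed
  qed
  then show ?thesis by (simp only: commute)
qed

text \<open>The set of exceptional energies is Lebesgue null and independent of the coupling at \<open>j\<close>, so it is null for the spectral
  measure averaged over this coupling.\<close>

lemma AE_site_measure_not_exceptional:
  "AE \<tau> in couplings. AE l in site_measure UNIV \<tau> j. \<not> exceptional j \<tau> l"
proof -
  define h where "h \<tau> = (\<integral>\<^sup>+l. indicator {l. exceptional j \<tau> l} l \<partial>site_measure UNIV \<tau> j)" for \<tau>
  have Ex_meas: "{l. exceptional j \<tau> l} \<in> sets borel" for \<tau>
  proof -
    have "Pair \<tau> -` {p \<in> space (couplings \<Otimes>\<^sub>M borel). exceptional j (fst p) (snd p)} \<in> sets borel"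
      by (rule sets_Pair1[OF exceptional_measurable])
    then show ?thesis by (simp add: space_pair_measure vimage_def)
  qed
  have h_meas: "h \<in> borel_measurable couplings"
    unfolding h_def
  proof (rule nn_integral_measurable_subprob_algebra2[where N=borel, OF _ site_measure_subprob])
    have "(\<lambda>p. indicator {p \<in> space (couplings \<Otimes>\<^sub>M borel). exceptional j (fst p) (snd p)} p :: ennreal) \<in> borel_measurable (couplings \<Otimes>\<^sub>M borel)"
      by (rule borel_measurable_indicator[OF exceptional_measurable])
    then show "(\<lambda>(\<tau>, l). indicator {l. exceptional j \<tau> l} l :: ennreal) \<in> borel_measurable (couplings \<Otimes>\<^sub>M borel)"
      by (rule measurable_cong[THEN iffD1, rotated]) (auto simp: space_pair_measure indicator_def)
  qed
  have h_eq: "h \<tau> = emeasure (site_measure UNIV \<tau> j) {l. exceptional j \<tau> l}" for \<tau>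
    unfolding h_def
    by (rule nn_integral_indicator)
      (use Ex_meas bounded_selfadjoint.spectral_measure_sets[OF hamiltonian_selfadjoint site_measure] in simp)
  have "(\<integral>\<^sup>+\<tau>. h \<tau> \<partial>couplings) = (\<integral>\<^sup>+\<tau>. (\<integral>\<^sup>+t. h (\<tau>(j := t)) \<partial>law) \<partial>couplings)"
    by (rule nn_integral_couplings[OF h_meas])
  also have "\<dots> = (\<integral>\<^sup>+\<tau>. 0 \<partial>couplings)"
  proof (rule nn_integral_cong_AE)
    show "AE \<tau> in couplings. (\<integral>\<^sup>+t. h (\<tau>(j := t)) \<partial>law) = 0"
      using AE_not_exceptional[of j]
    proof eventually_elim
      case (elim \<tau>)
      have "{l. exceptional j \<tau> l} \<in> null_sets lborel"
        using elim Ex_meas[of \<tau>] by (subst (asm) AE_iff_null) auto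
      from averaged_site_measure_null[OF this] show ?case
        unfolding h_eq exceptional_update .
    qed
  qed
  finally have "(\<integral>\<^sup>+\<tau>. h \<tau> \<partial>couplings) = 0" by simp
  then have "AE \<tau> in couplings. h \<tau> = 0" by (simp only: nn_integral_0_iff_AE[OF h_meas])
  then show ?thesis
  proof eventually_elim
    case (elim \<tau>)
    have "{l. exceptional j \<tau> l} \<in> null_sets (site_measure UNIV \<tau> j)"
      using elim Ex_meas[of \<tau>] bounded_selfadjoint.spectral_measure_sets[OF hamiltonian_selfadjoint site_measure]
      by (intro null_setsI) (auto simp: h_eq)
    then show ?case by (auto dest: AE_not_in)
  qed
qed

lemma range_or_eigenvalue:
  assumes "\<not> exceptional j \<tau> l"
  shows "(\<exists>\<phi>. \<phi> \<noteq> 0 \<and> hamiltonian UNIV \<tau> \<phi> = l *\<^sub>R \<phi>) \<or> (\<exists>u. hamiltonian UNIV \<tau> u - l *\<^sub>R u = point_mass (a j))"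
proof -
  have "l \<notin> laplacian_spectrum" using assms by (simp add: exceptional_def)
  then obtain N where N: "\<forall>n. 1 / real (Suc N) \<le> \<bar>level_eigenvalue n - l\<bar>" using spectral_gap by blast
  define n0 where "n0 = cutoff j N"
  have fin: "inverse_square_moment (site_measure {n0..} \<tau> b) l < \<infinity>" if "b < n0" for b
    using assms N that unfolding exceptional_def n0_def by (auto simp: less_top)
  show ?thesis
  proof (rule finite_rank_dichotomy[where D="point_mass ` (a ` {..<n0})" and H'="hamiltonian {n0..} \<tau>"])
    show "linear (hamiltonian UNIV \<tau>)" "linear (hamiltonian {n0..} \<tau>)"
      using bounded_selfadjoint.linear_H[OF hamiltonian_selfadjoint] by auto
    show "independent (point_mass ` (a ` {..<n0}))" by (rule point_masses_independent)
    show "\<exists>u. hamiltonian {n0..} \<tau> u - l *\<^sub>R u = d" if dD: "d \<in> point_mass ` (a ` {..<n0})" for d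
    proof -
      obtain b where b: "b < n0" "d = point_mass (a b)" using dD by blast
      show ?thesis unfolding b(2)
        by (rule bounded_selfadjoint.range_if_moment_finite[OF hamiltonian_selfadjoint site_measure fin[OF b(1)]])
    qed
    show "hamiltonian UNIV \<tau> v - hamiltonian {n0..} \<tau> v \<in> span (point_mass ` (a ` {..<n0}))" for v
    proof -
      have "hamiltonian UNIV \<tau> v - hamiltonian {n0..} \<tau> v
        = - (\<Sum>b<n0. (clamp (\<tau> b) * ell2_app v (a b)) *\<^sub>R point_mass (a b))"
      proof (rule ell2_eqI)
        fix x
        show "ell2_app (hamiltonian UNIV \<tau> v - hamiltonian {n0..} \<tau> v) x
          = ell2_app (- (\<Sum>b<n0. (clamp (\<tau> b) * ell2_app v (a b)) *\<^sub>R point_mass (a b))) x"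
        proof (cases "x \<in> range a")
          case True
          then obtain i where x: "x = a i" by blast
          have "(\<Sum>b<n0. clamp (\<tau> b) * ell2_app v (a b) * (if a i = a b then 1 else 0))
            = (\<Sum>b<n0. if b = i then clamp (\<tau> b) * ell2_app v (a b) else 0)"
            by (intro sum.cong) (auto simp: inj_eq[OF inj_a])
          then show ?thesis by (auto simp: x hamiltonian_def well_site)
        next
          case False
          have "(\<Sum>b<n0. clamp (\<tau> b) * ell2_app v (a b) * (if x = a b then 1 else 0)) = 0"
            using False by (intro sum.neutral) auto
          then show ?thesis using False by (auto simp: hamiltonian_def well_def)
        qed
      qed
      also have "\<dots> \<in> span (point_mass ` (a ` {..<n0}))"
        by (intro span_neg span_sum span_scale span_base) auto
      finally show ?thesis .
    qed
    show "point_mass (a j) \<in> point_mass ` (a ` {..<n0})" using cutoff(1)[of j N] by (auto simp: n0_def)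
  qed auto
qed

text \<open>At a nonexceptional energy \<open>l\<close> that is not an eigenvalue, the point mass is in the range of \<open>H - l\<close>, and such energies
  have spectral measure zero.  So the spectral measure is carried by the eigenvalues.\<close>

lemma AE_site_in_point_space:
  "AE \<tau> in couplings. \<forall>j. point_mass (a j) \<in> closure (span {\<phi>. \<exists>l. hamiltonian UNIV \<tau> \<phi> = l *\<^sub>R \<phi>})"
  unfolding AE_all_countable
proof
  fix j
  show "AE \<tau> in couplings. point_mass (a j) \<in> closure (span {\<phi>. \<exists>l. hamiltonian UNIV \<tau> \<phi> = l *\<^sub>R \<phi>})"
    using AE_site_measure_not_exceptional[of j]
  proof eventually_elim
    case (elim \<tau>)
    interpret H: bounded_selfadjoint "hamiltonian UNIV \<tau>" window by (rule hamiltonian_selfadjoint)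
    note sm = site_measure[of UNIV \<tau> j]
    define Eg where "Eg = {l. \<exists>\<phi>. \<phi> \<noteq> 0 \<and> hamiltonian UNIV \<tau> \<phi> = l *\<^sub>R \<phi>}"
    have "countable Eg"
      unfolding Eg_def
    proof (rule H.countable_eigenvalues)
      show "countable (range (point_mass :: 'a \<Rightarrow> 'a ell2))" using countable_space by simp
      show "x = 0" if "\<And>d. d \<in> range point_mass \<Longrightarrow> inner x d = 0" for x :: "'a ell2"
      proof (rule ell2_eqI)
        fix y
        have "inner x (point_mass y) = 0" by (rule that) simp
        then show "ell2_app x y = ell2_app 0 y" by simp
      qed
    qed
    moreover have "AE l in site_measure UNIV \<tau> j. l \<in> Eg"
      using elim H.AE_not_in_range[OF sm]
    proof eventually_elim
      case (elim l)
      then show ?case using range_or_eigenvalue[OF elim(1)] unfolding Eg_def by blast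
    qed
    ultimately show ?case by (rule H.pure_point_vector_in_closure[OF sm norm_point_mass])
  qed
qed

end

section \<open>Complex eigenfunctions\<close>

lemma infsum_of_real_complex:
  "(\<Sum>\<^sub>\<infinity>x\<in>A. complex_of_real (f x)) = of_real (\<Sum>\<^sub>\<infinity>x\<in>A. f x)"
proof (cases "f summable_on A")
  case True
  then show ?thesis by (intro infsumI) (simp add: has_sum_of_real_iff)
next
  case False
  have "\<not> (\<lambda>x. complex_of_real (f x)) summable_on A"
  proof
    assume "(\<lambda>x. complex_of_real (f x)) summable_on A"
    then have "(\<lambda>x. Re (complex_of_real (f x))) summable_on A" by (rule summable_on_Re)
    then show False using False by simp
  qed
  then show ?thesis using False by (simp add: infsum_not_exists)
qed

definition embed_complex :: "'a ell2 \<Rightarrow> 'a \<Rightarrow> complex" where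
  "embed_complex v x = of_real (ell2_app v x)"

lemma embed_complex_inject: "embed_complex v = embed_complex w \<Longrightarrow> v = w"
  by (rule ell2_eqI) (simp add: embed_complex_def fun_eq_iff)

lemma embed_complex_L2: "embed_complex v \<in> L2"
  using ell2_app_summable[of v] by (simp add: L2_def embed_complex_def)

lemma L2_inner_embed_complex: "L2_inner (embed_complex v) (embed_complex w) = of_real (inner v w)"
  unfolding L2_inner_def embed_complex_def ell2_inner
  by (simp add: infsum_of_real_complex[symmetric])

lemma ell2_of_L2:
  assumes "(\<lambda>x. (f x)\<^sup>2) summable_on UNIV"
  shows "\<exists>v. ell2_app v = f"
  by (rule exI[of _ "Abs_ell2 f"]) (use assms in \<open>simp add: Abs_ell2_inverse\<close>)

text \<open>The real and the imaginary part of a function are approximated separately, and the two finite sums are merged.\<close>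

lemma orthonormal_basis_embed_complex:
  assumes E: "orthonormal E" and dense: "closure (span E) = (UNIV :: 'a ell2 set)"
  shows "orthonormal_basis (embed_complex ` E)"
  unfolding orthonormal_basis_def
proof (intro conjI ballI allI impI)
  show "embed_complex ` E \<subseteq> L2" using embed_complex_L2 by blast
  fix u u' assume "u \<in> embed_complex ` E" "u' \<in> embed_complex ` E"
  then obtain e e' where e: "e \<in> E" "e' \<in> E" "u = embed_complex e" "u' = embed_complex e'" by blast
  then show "L2_inner u u' = (if u = u' then 1 else 0)"
    using E embed_complex_inject[of e e'] by (auto simp: L2_inner_embed_complex orthonormal_def)
next
  fix f :: "'a \<Rightarrow> complex" and \<epsilon> :: real
  assume f: "f \<in> L2" and \<epsilon>: "\<epsilon> > 0"
  have fs: "(\<lambda>x. (cmod (f x))\<^sup>2) summable_on UNIV" using f by (simp add: L2_def)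
  have "(\<lambda>x. (Re (f x))\<^sup>2) summable_on UNIV" "(\<lambda>x. (Im (f x))\<^sup>2) summable_on UNIV"
    by (rule summable_on_sq_comparison[OF fs], simp add: cmod_power2)+
  then obtain vr vi where vr: "ell2_app vr = (\<lambda>x. Re (f x))" and vi: "ell2_app vi = (\<lambda>x. Im (f x))"
    using ell2_of_L2 by metis
  have approx: "\<exists>F c. finite F \<and> F \<subseteq> E \<and> norm (v - (\<Sum>e\<in>F. c e *\<^sub>R e)) < \<epsilon> / 2" for v
  proof -
    have "v \<in> closure (span E)" using dense by simp
    then obtain y where y: "y \<in> span E" "dist y v < \<epsilon> / 2" unfolding closure_approachable using \<epsilon> by (meson half_gt_zero)
    then obtain F c where "finite F" "F \<subseteq> E" "y = (\<Sum>e\<in>F. c e *\<^sub>R e)" unfolding span_explicit by blast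
    then show ?thesis using y(2) by (intro exI[of _ F] exI[of _ c]) (auto simp: dist_norm norm_minus_commute)
  qed
  obtain F1 c1 where F1: "finite F1" "F1 \<subseteq> E" "norm (vr - (\<Sum>e\<in>F1. c1 e *\<^sub>R e)) < \<epsilon> / 2" using approx by blast
  obtain F2 c2 where F2: "finite F2" "F2 \<subseteq> E" "norm (vi - (\<Sum>e\<in>F2. c2 e *\<^sub>R e)) < \<epsilon> / 2" using approx by blast
  define F where "F = F1 \<union> F2"
  define d1 where "d1 e = (if e \<in> F1 then c1 e else 0)" for e
  define d2 where "d2 e = (if e \<in> F2 then c2 e else 0)" for e
  have F: "finite F" "F \<subseteq> E" using F1 F2 by (auto simp: F_def)
  have s1: "(\<Sum>e\<in>F. d1 e *\<^sub>R e) = (\<Sum>e\<in>F1. c1 e *\<^sub>R e)"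
    using F(1) by (intro sum.mono_neutral_cong_right) (auto simp: F_def d1_def)
  have s2: "(\<Sum>e\<in>F. d2 e *\<^sub>R e) = (\<Sum>e\<in>F2. c2 e *\<^sub>R e)"
    using F(1) by (intro sum.mono_neutral_cong_right) (auto simp: F_def d2_def)
  define wr where "wr = vr - (\<Sum>e\<in>F. d1 e *\<^sub>R e)"
  define wi where "wi = vi - (\<Sum>e\<in>F. d2 e *\<^sub>R e)"
  have nr: "norm wr < \<epsilon> / 2" and ni: "norm wi < \<epsilon> / 2" using F1(3) F2(3) by (simp_all add: wr_def wi_def s1 s2)
  have inj: "inj_on embed_complex F" using embed_complex_inject by (auto simp: inj_on_def)
  define c where "c u = Complex (d1 (inv_into F embed_complex u)) (d2 (inv_into F embed_complex u))" for u
  have pointwise: "f x - (\<Sum>u\<in>embed_complex ` F. c u * u x) = Complex (ell2_app wr x) (ell2_app wi x)" for x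
  proof -
    have "(\<Sum>u\<in>embed_complex ` F. c u * u x) = (\<Sum>e\<in>F. Complex (d1 e) (d2 e) * of_real (ell2_app e x))"
      by (subst sum.reindex[OF inj]) (auto simp: c_def inv_into_f_f[OF inj] embed_complex_def intro!: sum.cong)
    also have "\<dots> = Complex (\<Sum>e\<in>F. d1 e * ell2_app e x) (\<Sum>e\<in>F. d2 e * ell2_app e x)"
      by (auto simp: complex_eq_iff)
    finally show ?thesis by (simp add: complex_eq_iff wr_def wi_def vr vi)
  qed
  have "L2_norm (\<lambda>x. f x - (\<Sum>u\<in>embed_complex ` F. c u * u x)) = sqrt ((norm wr)\<^sup>2 + (norm wi)\<^sup>2)"
    unfolding L2_norm_def pointwise ell2_norm_sq
    by (simp add: cmod_power2 infsum_add[OF ell2_app_summable ell2_app_summable])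
  also have "\<dots> \<le> norm wr + norm wi" by (rule sqrt_sum_squares_le_sum) auto
  also have "\<dots> < \<epsilon>" using nr ni by linarith
  finally have "L2_norm (\<lambda>x. f x - (\<Sum>u\<in>embed_complex ` F. c u * u x)) < \<epsilon>" .
  moreover have "finite (embed_complex ` F)" "embed_complex ` F \<subseteq> embed_complex ` E" using F by auto
  ultimately show "\<exists>F c. finite F \<and> F \<subseteq> embed_complex ` E \<and> L2_norm (\<lambda>x. f x - (\<Sum>e\<in>F. c e * e x)) < \<epsilon>" by blast
qed

context sparse_schroedinger
begin

lemma potential_well:
  assumes "\<And>i. \<tau> i \<in> {\<alpha>..\<beta>}"
  shows "potential \<tau> a x = - well UNIV \<tau> x"
proof (cases "x \<in> range a")
  case True
  then obtain k where x: "x = a k" by blast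
  have "(\<Sum>\<^sub>\<infinity>i. \<tau> i * delta (a i) x) = (\<Sum>\<^sub>\<infinity>i\<in>{k}. \<tau> i * delta (a i) x)"
    by (rule infsum_cong_neutral) (auto simp: delta_def x inj_eq[OF inj_a])
  then show ?thesis using assms[of k] by (simp add: potential_def x delta_def well_site clamp_id)
next
  case False
  then have "delta (a i) x = 0" for i by (auto simp: delta_def)
  then show ?thesis using False by (simp add: potential_def well_def)
qed

lemma schroedinger_embed_complex:
  assumes "\<And>i. \<tau> i \<in> {\<alpha>..\<beta>}"
  shows "schroedinger C (potential \<tau> a) (embed_complex v) x = embed_complex (hamiltonian UNIV \<tau> v) x"
  using hierarchical_laplacian_of_real[of v x]
  by (simp add: schroedinger_def embed_complex_def[abs_def] potential_well[OF assms] hamiltonian_def)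

text \<open>A vector orthogonal to the eigenvectors of \<open>H\<close> vanishes on the support of the potential, hence \<open>H\<close> acts on it
  as the Laplacian, which is invertible off a countable set of energies.\<close>

lemma pure_point_if_sites_in_point_space:
  assumes \<tau>: "\<And>i. \<tau> i \<in> {\<alpha>..\<beta>}"
    and sites: "\<And>j. point_mass (a j) \<in> closure (span {\<phi>. \<exists>l. hamiltonian UNIV \<tau> \<phi> = l *\<^sub>R \<phi>})"
  shows "pure_point_spectrum (schroedinger C (potential \<tau> a))"
proof -
  interpret H: bounded_selfadjoint "hamiltonian UNIV \<tau>" window by (rule hamiltonian_selfadjoint)
  obtain E where E: "orthonormal E" "\<And>e. e \<in> E \<Longrightarrow> \<exists>l. hamiltonian UNIV \<tau> e = l *\<^sub>R e"
    and max: "\<And>g l. (\<And>e. e \<in> E \<Longrightarrow> inner g e = 0) \<Longrightarrow> hamiltonian UNIV \<tau> g = l *\<^sub>R g \<Longrightarrow> g = 0"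
    by (rule H.maximal_orthonormal_eigenvectors) blast
  have "closure (span E) = UNIV"
  proof (rule H.orthonormal_eigenvectors_complete[OF E(2) max laplacian_selfadjoint _ countable_laplacian_spectrum])
    fix g assume g: "\<And>x. x \<in> closure (span {\<phi>. \<exists>l. hamiltonian UNIV \<tau> \<phi> = l *\<^sub>R \<phi>}) \<Longrightarrow> inner g x = 0"
    have "ell2_app g (a j) = 0" for j using g[OF sites[of j]] by simp
    then have "well_op UNIV \<tau> g = 0" by (intro ell2_eqI) (auto simp: well_def)
    then show "hamiltonian UNIV \<tau> g = laplacian_op g" by (simp add: hamiltonian_def)
  next
    fix l f assume "l \<notin> laplacian_spectrum"
    then obtain N where N: "\<And>n. 1 / real (Suc N) \<le> \<bar>level_eigenvalue n - l\<bar>" using spectral_gap by blast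
    have "laplacian_op (free_resolvent l f) - l *\<^sub>R free_resolvent l f = f"
      by (rule laplacian_free_resolvent[OF _ N]) simp
    then show "\<exists>u. laplacian_op u - l *\<^sub>R u = f" by blast
  qed
  then have basis: "orthonormal_basis (embed_complex ` E)" by (rule orthonormal_basis_embed_complex[OF E(1)])
  moreover have "eigenfunction (schroedinger C (potential \<tau> a)) u" if u: "u \<in> embed_complex ` E" for u
  proof -
    obtain e where e: "e \<in> E" "u = embed_complex e" using u by blast
    obtain l where l: "hamiltonian UNIV \<tau> e = l *\<^sub>R e" using E(2)[OF e(1)] by blast
    have "inner e e = 1" using E(1) e(1) by (simp add: orthonormal_def)
    have "u \<noteq> (\<lambda>x. 0)"
    proof
      assume "u = (\<lambda>x. 0)"
      then have "e = 0" using e(2) by (intro ell2_eqI) (simp add: embed_complex_def fun_eq_iff)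
      then show False using \<open>inner e e = 1\<close> by simp
    qed
    moreover have "schroedinger C (potential \<tau> a) u x = of_real l * u x" for x
      unfolding e(2) schroedinger_embed_complex[OF \<tau>] l by (simp add: embed_complex_def)
    ultimately show ?thesis unfolding eigenfunction_def using embed_complex_L2 e(2) by blast
  qed
  ultimately show ?thesis unfolding pure_point_spectrum_def by blast
qed

end

theorem theorem7p3:
  fixes C :: "'a::metric_space set \<Rightarrow> real"
    and a :: "nat \<Rightarrow> 'a"
    and P :: "'w measure"
    and \<sigma> :: "nat \<Rightarrow> 'w \<Rightarrow> real"
    and \<rho> :: "real \<Rightarrow> real"
    and \<alpha> \<beta> K r :: real
  assumes "homogeneous_ultrametric_measure_space TYPE('a)"
    and "homogeneous_choice_function C"
    and "inj a"
    and "prob_space P"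
    and "prob_space.indep_vars P (\<lambda>_. borel) \<sigma> UNIV"
    and "\<And>i. distributed P lborel (\<sigma> i) (\<lambda>t. ennreal (\<rho> t))"
    and "\<And>t. 0 \<le> \<rho> t \<and> \<rho> t \<le> K"
    and "\<And>t. t \<notin> {\<alpha>..\<beta>} \<Longrightarrow> \<rho> t = 0"
    and "0 < \<alpha>" and "\<alpha> < \<beta>"
    and "\<exists>y N. mono_on {N..} (\<lambda>i. dist (a i) y)"
    and "0 < r" and "r < 1 / 3"
    and "(\<lambda>M. SUP i\<in>{M..}. \<Sum>\<^sub>\<infinity>j\<in>{M..} - {i}. ennreal (1 / dist (a i) (a j) powr r))
           \<longlonglongrightarrow> 0"
  shows "AE \<omega> in P. pure_point_spectrum (schroedinger C (potential (\<lambda>i. \<sigma> i \<omega>) a))"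
proof -
  interpret P: prob_space P by fact
  let ?law = "density lborel (\<lambda>t. ennreal (\<rho> t))"
  have meas: "\<sigma> i \<in> borel_measurable P" for i
    using assms(6)[of i] by (simp add: distributed_def)
  have law: "distr P lborel (\<sigma> i) = ?law" for i
    using assms(6)[of i] by (simp add: distributed_def)
  have law_borel: "distr P borel (\<sigma> i) = ?law" for i
    unfolding law[of i, symmetric] by (rule distr_cong) auto
  have prob_law: "prob_space ?law"
    unfolding law_borel[of 0, symmetric] by (rule P.prob_space_distr[OF meas])
  interpret random_schroedinger C a \<alpha> \<beta> \<rho> K r
    by (intro random_schroedinger.intro sparse_schroedinger.intro hierarchical_structure.intro
        sparse_schroedinger_axioms.intro random_schroedinger_axioms.intro assms prob_law)
      (use assms(6)[of 0] assms(12,13) in \<open>auto simp: distributed_def\<close>)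
  \<comment> \<open>By independence the joint law of the couplings is the product measure.\<close>
  have couplings: "distr P (PiM UNIV (\<lambda>_. borel)) (\<lambda>\<omega> i. \<sigma> i \<omega>) = couplings"
    using P.indep_vars_iff_distr_eq_PiM[of UNIV \<sigma> "\<lambda>_. borel"] assms(5) meas
    by (simp add: couplings_def law_borel restrict_UNIV)
  have vec: "(\<lambda>\<omega> i. \<sigma> i \<omega>) \<in> measurable P (PiM UNIV (\<lambda>_. borel))"
    by (rule measurable_PiM_single') (use meas in auto)
  have "AE \<tau> in couplings. pure_point_spectrum (schroedinger C (potential \<tau> a))"
    using AE_couplings_window AE_site_in_point_space
    by eventually_elim (intro pure_point_if_sites_in_point_space, auto)
  then have "AE \<tau> in distr P (PiM UNIV (\<lambda>_. borel)) (\<lambda>\<omega> i. \<sigma> i \<omega>). pure_point_spectrum (schroedinger C (potential \<tau> a))"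
    by (simp only: couplings)
  then show ?thesis by (rule AE_distrD[OF vec])
qed

end
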